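(* There is an absolute constant $C>0$ such that the following holds. Suppose $P$ is weakly communicating, let $s_0\in\mathcal S$ be arbitrary, $\eta=1/n$ and $\xi\in(0,1/n]$. Let $\widehat\pi$ be a (deterministic, Markov) Blackwell-optimal policy of the average-reward MDP $(\underline{\widehat P},\widetilde r)$. Then for every $\delta\in(0,1)$, with probability at least $1-\delta$, $$\rho^\star-\rho^{\widehat\pi}\le\sqrt{\frac{C\log^3\!\big(\frac{SAn}{\delta\xi}\big)}{n}\Big(\|h^\star\|_{\mathrm{sp}}+\|\underline h^{\widehat\pi}\|_{\mathrm{sp}}+1\Big)}\;\mathbf 1 .$$
   Context: $\mathcal S$ finite with $S$ states, $\mathcal A$ finite with $A$ actions; transition kernel $P$; known reward $r:\mathcal S\times\mathcal A\to[0,1]$. Policies stationary Markov; $P_\pi,r_\pi$ the induced transition matrix and reward. Empirical kernel $\widehat P$: $n$ i.i.d. samples from each $P(\cdot|s,a)$, independent across pairs, $\widehat P(s'|s,a)$ = fraction equal to $s'$. Anchored kernels: $\underline{\widehat P}(s'|s,a)=(1-\eta)\widehat P(s'|s,a)+\eta\mathbb 1\{s'=s_0\}$ and $\underline P(s'|s,a)=(1-\eta)P(s'|s,a)+\eta\mathbb 1\{s'=s_0\}$. Perturbed reward $\widetilde r=r+\Delta$ with $\Delta(s,a)$ i.i.d. Uniform$[0,\xi]$, independent of the samples. Gain $\rho^\pi=P^\infty_\pi r_\pi$ ($P^\infty_\pi$ Cesàro limit of $P_\pi^t$), bias $h^\pi=\mathrm{C\text{-}lim}_T\sum_{t<T}(P_\pi^tr_\pi-\rho^\pi)$.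 A deterministic policy is Blackwell-optimal for a model $(Q,\tilde r)$ if it maximizes $(I-\gamma Q_\pi)^{-1}\tilde r_\pi$ simultaneously over all policies for all $\gamma$ in some interval $[\bar\gamma,1)$. $\rho^\star,h^\star$: gain and bias of a Blackwell-optimal policy of $(P,r)$. $\underline h^{\pi}$: bias of $\pi$ in $(\underline P,r)$ (true anchored kernel, unperturbed reward). $\|x\|_{\mathrm{sp}}=\max_sx(s)-\min_sx(s)$. Weakly communicating: states split into states transient under every stationary policy and a set where every state is reachable from every other. *)

theory Defs
  imports "HOL-Probability.Probability"
begin

text \<open>States are {..<S}, actions {..<A} (explicit carriers so that the constant C
can be absolute, i.e. independent of S and A).  A kernel is Q s a s'.
A stationary Markov (possibly randomized) policy is sigma s a = probability of action a in state s.\<close>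

definition policy_ok :: "nat \<Rightarrow> nat \<Rightarrow> (nat \<Rightarrow> nat \<Rightarrow> real) \<Rightarrow> bool" where
  "policy_ok S A \<sigma> \<longleftrightarrow> (\<forall>s<S. (\<forall>a<A. 0 \<le> \<sigma> s a) \<and> (\<Sum>a<A. \<sigma> s a) = 1)"

definition det_pol :: "(nat \<Rightarrow> nat) \<Rightarrow> nat \<Rightarrow> nat \<Rightarrow> real" where
  "det_pol \<pi> s a = (if a = \<pi> s then 1 else 0)"

definition det_ok :: "nat \<Rightarrow> nat \<Rightarrow> (nat \<Rightarrow> nat) \<Rightarrow> bool" where
  "det_ok S A \<pi> \<longleftrightarrow> (\<forall>s<S. \<pi> s < A)"

definition Pmat :: "nat \<Rightarrow> (nat \<Rightarrow> nat \<Rightarrow> nat \<Rightarrow> real) \<Rightarrow> (nat \<Rightarrow> nat \<Rightarrow> real) \<Rightarrow> nat \<Rightarrow> nat \<Rightarrow> real" where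
  "Pmat A Q \<sigma> s s' = (\<Sum>a<A. \<sigma> s a * Q s a s')"

definition rvec :: "nat \<Rightarrow> (nat \<Rightarrow> nat \<Rightarrow> real) \<Rightarrow> (nat \<Rightarrow> nat \<Rightarrow> real) \<Rightarrow> nat \<Rightarrow> real" where
  "rvec A r \<sigma> s = (\<Sum>a<A. \<sigma> s a * r s a)"

primrec matpow :: "nat \<Rightarrow> (nat \<Rightarrow> nat \<Rightarrow> real) \<Rightarrow> nat \<Rightarrow> nat \<Rightarrow> nat \<Rightarrow> real" where
  "matpow S M 0 i j = (if i = j then 1 else 0)"
| "matpow S M (Suc t) i j = (\<Sum>k<S. M i k * matpow S M t k j)"

definition mvec :: "nat \<Rightarrow> (nat \<Rightarrow> nat \<Rightarrow> real) \<Rightarrow> (nat \<Rightarrow> real) \<Rightarrow> nat \<Rightarrow> real" where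
  "mvec S M v i = (\<Sum>j<S. M i j * v j)"

definition cesaro :: "(nat \<Rightarrow> real) \<Rightarrow> real" where
  "cesaro x = lim (\<lambda>T. (\<Sum>k<T. x k) / real T)"

definition gain :: "nat \<Rightarrow> (nat \<Rightarrow> nat \<Rightarrow> real) \<Rightarrow> (nat \<Rightarrow> real) \<Rightarrow> nat \<Rightarrow> real" where
  "gain S M v s = cesaro (\<lambda>t. mvec S (matpow S M t) v s)"

definition bias :: "nat \<Rightarrow> (nat \<Rightarrow> nat \<Rightarrow> real) \<Rightarrow> (nat \<Rightarrow> real) \<Rightarrow> nat \<Rightarrow> real" where
  "bias S M v s = cesaro (\<lambda>T. \<Sum>t<T. (mvec S (matpow S M t) v s - gain S M v s))"

text \<open>Discounted value (I - gamma M)^{-1} v, written as its Neumann series.\<close>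
definition disc_value :: "nat \<Rightarrow> (nat \<Rightarrow> nat \<Rightarrow> real) \<Rightarrow> (nat \<Rightarrow> real) \<Rightarrow> real \<Rightarrow> nat \<Rightarrow> real" where
  "disc_value S M v \<gamma> s = (\<Sum>t. \<gamma> ^ t * mvec S (matpow S M t) v s)"

definition blackwell_opt :: "nat \<Rightarrow> nat \<Rightarrow> (nat \<Rightarrow> nat \<Rightarrow> nat \<Rightarrow> real) \<Rightarrow> (nat \<Rightarrow> nat \<Rightarrow> real) \<Rightarrow> (nat \<Rightarrow> nat) \<Rightarrow> bool" where
  "blackwell_opt S A Q r \<pi> \<longleftrightarrow> det_ok S A \<pi> \<and>
     (\<exists>\<gamma>0. 0 \<le> \<gamma>0 \<and> \<gamma>0 < 1 \<and>
        (\<forall>\<gamma>. \<gamma>0 \<le> \<gamma> \<and> \<gamma> < 1 \<longrightarrow>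
          (\<forall>\<sigma>. policy_ok S A \<sigma> \<longrightarrow>
             (\<forall>s<S. disc_value S (Pmat A Q \<sigma>) (rvec A r \<sigma>) \<gamma> s
                    \<le> disc_value S (Pmat A Q (det_pol \<pi>)) (rvec A r (det_pol \<pi>)) \<gamma> s))))"

definition reachable :: "nat \<Rightarrow> nat \<Rightarrow> (nat \<Rightarrow> nat \<Rightarrow> nat \<Rightarrow> real) \<Rightarrow> nat \<Rightarrow> nat \<Rightarrow> bool" where
  "reachable S A Q s s' \<longleftrightarrow> (\<exists>\<sigma> t. policy_ok S A \<sigma> \<and> matpow S (Pmat A Q \<sigma>) t s s' > 0)"

definition transient_state :: "nat \<Rightarrow> (nat \<Rightarrow> nat \<Rightarrow> real) \<Rightarrow> nat \<Rightarrow> bool" where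
  "transient_state S M s \<longleftrightarrow> summable (\<lambda>t. matpow S M t s s)"

definition weakly_communicating :: "nat \<Rightarrow> nat \<Rightarrow> (nat \<Rightarrow> nat \<Rightarrow> nat \<Rightarrow> real) \<Rightarrow> bool" where
  "weakly_communicating S A Q \<longleftrightarrow>
     (\<exists>C \<subseteq> {..<S}.
        (\<forall>s\<in>C. \<forall>s'\<in>C. reachable S A Q s s') \<and>
        (\<forall>s\<in>{..<S} - C. \<forall>\<sigma>. policy_ok S A \<sigma> \<longrightarrow> transient_state S (Pmat A Q \<sigma>) s))"

definition span :: "nat \<Rightarrow> (nat \<Rightarrow> real) \<Rightarrow> real" where
  "span S x = Max (x ` {..<S}) - Min (x ` {..<S})"

definition kern :: "(nat \<Rightarrow> nat \<Rightarrow> nat pmf) \<Rightarrow> nat \<Rightarrow> nat \<Rightarrow> nat \<Rightarrow> real" where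
  "kern P s a s' = pmf (P s a) s'"

definition emp_kern :: "nat \<Rightarrow> (nat \<times> nat \<times> nat \<Rightarrow> nat) \<Rightarrow> nat \<Rightarrow> nat \<Rightarrow> nat \<Rightarrow> real" where
  "emp_kern n X s a s' = real (card {i. i < n \<and> X (s, a, i) = s'}) / real n"

definition anchor :: "real \<Rightarrow> nat \<Rightarrow> (nat \<Rightarrow> nat \<Rightarrow> nat \<Rightarrow> real) \<Rightarrow> nat \<Rightarrow> nat \<Rightarrow> nat \<Rightarrow> real" where
  "anchor \<eta> s0 Q s a s' = (1 - \<eta>) * Q s a s' + \<eta> * (if s' = s0 then 1 else 0)"

definition sample_space :: "nat \<Rightarrow> nat \<Rightarrow> (nat \<Rightarrow> nat \<Rightarrow> nat pmf) \<Rightarrow> nat \<Rightarrow> real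
    \<Rightarrow> ((nat \<times> nat \<times> nat \<Rightarrow> nat) \<times> (nat \<times> nat \<Rightarrow> real)) measure" where
  "sample_space S A P n \<xi> =
     (PiM ({..<S} \<times> {..<A} \<times> {..<n}) (\<lambda>(s, a, i). measure_pmf (P s a)))
     \<Otimes>\<^sub>M (PiM ({..<S} \<times> {..<A}) (\<lambda>_. uniform_measure lborel {0..\<xi>}))"

end

theory Submission
  imports Defs
begin

text \<open>A reset to \<open>s0\<close> with probability \<open>1/n\<close> changes values only by an additive constant compared with
  discounting by \<open>\<gamma> = 1 - 1/n\<close>. So \<open>\<pi>hat\<close> is optimal for the empirical \<open>\<gamma>\<close>-discounted model,
  the bias span in the anchored kernel is the span of the true \<open>\<gamma>\<close>-discounted value
  \<open>V\<close> of \<open>\<pi>hat\<close>, and it suffices to compare, for \<open>\<pi>star\<close> and for \<open>\<pi>hat\<close>, the true and the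
  empirical discounted values.

  Let \<open>d\<close> be the deviation of the empirical mean of \<open>V\<close> at a state-action pair from its true
  mean \<open>\<mu>\<close>. Since \<open>exp (y - y\<^sup>2) \<le> 1 + y\<close>, with high probability \<open>\<bar>d\<bar>\<close> is at most
  \<open>\<kappa>\<close> times the empirical mean of \<open>(V - \<mu>)\<^sup>2\<close> plus \<open>L / (n \<kappa>)\<close>.
  By Bellman's equation this square telescopes along the empirical chain, so the maximum
  principle bounds the error by a multiple of \<open>sqrt (L n (span V + 1))\<close>.

  The value of \<open>\<pi>hat\<close> depends on the samples. The random rewards separate the optimal action
  values by some \<open>\<omega> > 0\<close>. If a state-action pair is replaced by a terminal payoff within \<open>\<omega>/2\<close> of
  its action value, \<open>\<pi>hat\<close> remains the strictly greedy policy. Hence \<open>\<pi>hat\<close> is one of the few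
  policies, indexed by a grid of payoffs, that do not use the samples of this pair, and a union
  bound applies.\<close>

section \<open>Stochastic matrices\<close>

text \<open>Two obstacles shape the argument. The span of the value of \<open>\<pi>hat\<close> is
  random and stands on the right-hand side, so no fixed multiplier \<open>\<kappa>\<close> can
  serve. Because the exponential inequality is compensated by the observed squares,
  \<open>\<kappa>\<close> may depend on the selected policy; taking it proportional to
  \<open>sqrt (L / (n (span V + 1)))\<close> balances the error terms, and the factor
  \<open>1 - \<gamma> = 1/n\<close> turns the value error into the claimed rate. Discounted values
  must also be turned back into gains although the bias of \<open>\<pi>hat\<close> in the unanchored
  kernel is not controlled. A lower bound on its discounted values by one constant passes to its
  gain by averaging. The benchmark must therefore be constant in the state: weak communication gives
  \<open>\<pi>star\<close> one gain \<rho> everywhere, and its discounted values lie within the span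
  of its bias of \<open>n \<rho>\<close>. The grid of payoffs enters only through the logarithm of
  its size, so \<omega> can be small enough for a union bound over all action pairs. If
  \<open>n\<close> is too small for the exponential inequality to apply, the claimed bound exceeds 1
  and is trivial.\<close>

definition substoch :: "nat \<Rightarrow> (nat \<Rightarrow> nat \<Rightarrow> real) \<Rightarrow> bool" where
  "substoch S M \<longleftrightarrow> (\<forall>i<S. (\<forall>j<S. 0 \<le> M i j) \<and> (\<Sum>j<S. M i j) \<le> 1)"

definition stoch :: "nat \<Rightarrow> (nat \<Rightarrow> nat \<Rightarrow> real) \<Rightarrow> bool" where
  "stoch S M \<longleftrightarrow> (\<forall>i<S. (\<forall>j<S. 0 \<le> M i j) \<and> (\<Sum>j<S. M i j) = 1)"

lemma stoch_substoch: "stoch S M \<Longrightarrow> substoch S M"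
  by (auto simp: stoch_def substoch_def)

lemma mvec_cong: "(\<And>j. j < S \<Longrightarrow> x j = y j) \<Longrightarrow> mvec S M x i = mvec S M y i"
  by (simp add: mvec_def)

lemma mvec_mono:
  assumes "substoch S M" "i < S" "\<And>j. j < S \<Longrightarrow> x j \<le> y j"
  shows "mvec S M x i \<le> mvec S M y i"
  unfolding mvec_def using assms by (intro sum_mono mult_left_mono) (auto simp: substoch_def)

lemma mvec_const: "stoch S M \<Longrightarrow> i < S \<Longrightarrow> mvec S M (\<lambda>_. c) i = c"
  by (simp add: mvec_def stoch_def flip: sum_distrib_right)

lemma mvec_add: "mvec S M (\<lambda>j. x j + y j) i = mvec S M x i + mvec S M y i"
  by (simp add: mvec_def sum.distrib algebra_simps)

lemma mvec_diff: "mvec S M (\<lambda>j. x j - y j) i = mvec S M x i - mvec S M y i"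
  by (simp add: mvec_def sum_subtractf algebra_simps)

lemma mvec_minus: "mvec S M (\<lambda>j. - x j) i = - mvec S M x i"
  by (simp add: mvec_def sum_negf)

lemma mvec_cmult: "mvec S M (\<lambda>j. c * x j) i = c * mvec S M x i"
  by (simp add: mvec_def sum_distrib_left algebra_simps)

lemma mvec_sum: "mvec S M (\<lambda>i. \<Sum>j\<in>J. f j i) i = (\<Sum>j\<in>J. mvec S M (f j) i)"
  unfolding mvec_def sum_distrib_left by (rule sum.swap)

lemma mvec_le_const:
  assumes "substoch S M" "i < S" "\<And>j. j < S \<Longrightarrow> x j \<le> c" "0 \<le> c"
  shows "mvec S M x i \<le> c"
proof -
  have "mvec S M x i \<le> (\<Sum>j<S. M i j * c)"
    unfolding mvec_def using assms by (intro sum_mono mult_left_mono) (auto simp: substoch_def)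
  also have "\<dots> = (\<Sum>j<S. M i j) * c" by (simp add: sum_distrib_right)
  also have "\<dots> \<le> 1 * c" using assms by (intro mult_right_mono) (auto simp: substoch_def)
  finally show ?thesis by simp
qed

lemma mvec_le_const':
  assumes "stoch S M" "i < S" "\<And>j. j < S \<Longrightarrow> x j \<le> c"
  shows "mvec S M x i \<le> c"
  using mvec_mono[OF stoch_substoch[OF assms(1)] assms(2,3)] by (simp add: mvec_const[OF assms(1,2)])

lemma mvec_ge_const':
  assumes "stoch S M" "i < S" "\<And>j. j < S \<Longrightarrow> c \<le> x j"
  shows "c \<le> mvec S M x i"
  using mvec_mono[OF stoch_substoch[OF assms(1)] assms(2), of "\<lambda>_. c" x] assms(3)
  by (simp add: mvec_const[OF assms(1,2)])

lemma mvec_abs_le: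
  assumes "substoch S M" "i < S" "\<And>j. j < S \<Longrightarrow> \<bar>x j\<bar> \<le> c"
  shows "\<bar>mvec S M x i\<bar> \<le> c"
proof -
  have c: "0 \<le> c" using assms(3)[OF assms(2)] by linarith
  have "mvec S M x i \<le> c" "mvec S M (\<lambda>j. - x j) i \<le> c"
    using assms c by (auto intro!: mvec_le_const simp: abs_le_iff)
  then show ?thesis by (simp add: mvec_minus)
qed

lemma finite_argmax:
  fixes x :: "nat \<Rightarrow> real"
  assumes "0 < S"
  obtains m where "m < S" "\<And>j. j < S \<Longrightarrow> x j \<le> x m"
proof -
  have "Max (x ` {..<S}) \<in> x ` {..<S}" using assms by (intro Max_in) auto
  then obtain m where "m < S" "x m = Max (x ` {..<S})" by auto
  then show ?thesis using that[of m] by (auto intro!: Max_ge)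
qed

text \<open>At a maximiser the average is at most the maximum, and \<open>\<gamma> < 1\<close>
  allows solving for it. A nonpositive maximum is treated apart, because a row of mass below 1 may
  raise a negative average.\<close>

lemma max_principle:
  assumes M: "substoch S M" and g: "0 \<le> \<gamma>" "\<gamma> < 1" and c: "0 \<le> c"
    and x: "\<And>i. i < S \<Longrightarrow> x i \<le> \<gamma> * mvec S M x i + c"
    and i: "i < S"
  shows "x i \<le> c / (1 - \<gamma>)"
proof -
  obtain m where m: "m < S" "\<And>j. j < S \<Longrightarrow> x j \<le> x m"
    using finite_argmax[of S x] i by auto
  have "x m \<le> c / (1 - \<gamma>)"
  proof (cases "x m \<le> 0")
    case True
    then show ?thesis using g c by (meson diff_gt_0_iff_gt divide_nonneg_pos order_trans)
  next
    case False
    have "x m \<le> \<gamma> * mvec S M x m + c" using x m by blast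
    also have "\<dots> \<le> \<gamma> * x m + c"
      using mvec_le_const[OF M m(1) m(2)] False g by (intro add_right_mono mult_left_mono) auto
    finally show ?thesis using g by (simp add: field_simps)
  qed
  then show ?thesis using m(2)[OF i] by linarith
qed

lemma max_principle_abs:
  assumes M: "substoch S M" and g: "0 \<le> \<gamma>" "\<gamma> < 1"
    and x: "\<And>i. i < S \<Longrightarrow> \<bar>x i - \<gamma> * mvec S M x i\<bar> \<le> c"
    and i: "i < S"
  shows "\<bar>x i\<bar> \<le> c / (1 - \<gamma>)"
proof -
  have c: "0 \<le> c" using x[OF i] by linarith
  have "x i \<le> c / (1 - \<gamma>)"
    by (rule max_principle[OF M g c _ i]) (use x in \<open>fastforce simp: abs_le_iff\<close>)
  moreover have "- x i \<le> c / (1 - \<gamma>)"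
    by (rule max_principle[OF M g c _ i]) (use x in \<open>fastforce simp: abs_le_iff mvec_minus\<close>)
  ultimately show ?thesis by linarith
qed

section \<open>Cesaro limits of stochastic matrices\<close>

lemma mvec_matpow_0: "i < S \<Longrightarrow> mvec S (matpow S M 0) v i = v i"
  by (simp add: mvec_def if_distrib[where f="\<lambda>x. x * _"] cong: if_cong)

lemma mvec_matpow_Suc: "mvec S (matpow S M (Suc t)) v i = mvec S M (mvec S (matpow S M t) v) i"
  unfolding mvec_def matpow.simps sum_distrib_left sum_distrib_right
  by (subst sum.swap) (simp add: mult_ac)

lemma mvec_matpow_shift:
  "i < S \<Longrightarrow> mvec S (matpow S M t) (mvec S M v) i = mvec S (matpow S M (Suc t)) v i"
proof (induction t arbitrary: i)
  case 0
  then show ?case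
    by (simp only: mvec_matpow_0 mvec_matpow_Suc) (auto intro: mvec_cong simp: mvec_matpow_0)
next
  case (Suc t)
  show ?case
    by (subst (1 2) mvec_matpow_Suc) (rule mvec_cong, erule Suc.IH)
qed

lemma stoch_matpow: "stoch S M \<Longrightarrow> stoch S (matpow S M t)"
proof (induction t)
  case 0
  then show ?case by (auto simp: stoch_def)
next
  case (Suc t)
  have "(\<Sum>j<S. matpow S M (Suc t) i j) = 1" if "i < S" for i
  proof -
    have "(\<Sum>j<S. matpow S M (Suc t) i j) = mvec S (matpow S M (Suc t)) (\<lambda>_. 1) i"
      by (simp add: mvec_def)
    also have "\<dots> = mvec S M (\<lambda>_. 1) i"
      unfolding mvec_matpow_Suc using Suc that by (intro mvec_cong) (simp add: mvec_const)
    finally show ?thesis using Suc.prems that by (simp add: mvec_const)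
  qed
  then show ?case using Suc by (auto simp: stoch_def intro!: sum_nonneg)
qed

text \<open>One bound serves all substochastic matrices, hence all powers of a stochastic matrix at
  once.\<close>

lemma mvec_bounded:
  obtains B :: real where "0 \<le> B" "\<And>M i. substoch S M \<Longrightarrow> i < S \<Longrightarrow> \<bar>mvec S M v i\<bar> \<le> B"
proof
  show "0 \<le> (\<Sum>j<S. \<bar>v j\<bar>)" by (intro sum_nonneg) auto
  show "\<bar>mvec S M v i\<bar> \<le> (\<Sum>j<S. \<bar>v j\<bar>)" if "substoch S M" "i < S" for M i
    using that(1,2) by (rule mvec_abs_le) (auto intro: member_le_sum)
qed

lemma linear_dependence:
  fixes w :: "'a \<Rightarrow> nat \<Rightarrow> real"
  assumes "finite J" "S < card J"
  shows "\<exists>c. (\<exists>j\<in>J. c j \<noteq> 0) \<and> (\<forall>i<S. (\<Sum>j\<in>J. c j * w j i) = 0)"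
  using assms
proof (induction S arbitrary: J w)
  case 0
  then have "J \<noteq> {}" by auto
  then show ?case by (intro exI[of _ "\<lambda>_. 1"]) auto
next
  case (Suc S)
  show ?case
  proof (cases "\<forall>j\<in>J. w j S = 0")
    case True
    obtain c where "\<exists>j\<in>J. c j \<noteq> 0" "\<forall>i<S. (\<Sum>j\<in>J. c j * w j i) = 0"
      using Suc.IH[of J w] Suc.prems by auto
    then show ?thesis using True by (intro exI[of _ c]) (auto simp: less_Suc_eq)
  next
    case False
    then obtain p where p: "p \<in> J" "w p S \<noteq> 0" by auto
    have "S < card (J - {p})" using Suc.prems p by simp
    from Suc.IH[OF _ this, of "\<lambda>j i. w j i - w j S / w p S * w p i"] Suc.prems
    obtain c where c: "\<exists>j\<in>J-{p}. c j \<noteq> 0"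
      "\<And>i. i < S \<Longrightarrow> (\<Sum>j\<in>J-{p}. c j * (w j i - w j S / w p S * w p i)) = 0"
      by auto
    \<comment> \<open>Coordinate \<open>S\<close> was eliminated with the pivot \<open>p\<close>;
      the coefficient of \<open>p\<close> is now chosen to cancel that coordinate.\<close>
    define d where "d = c(p := - (\<Sum>j\<in>J-{p}. c j * w j S) / w p S)"
    have eq: "(\<Sum>j\<in>J. d j * w j i) = (\<Sum>j\<in>J-{p}. c j * (w j i - w j S / w p S * w p i))" for i
    proof -
      have "(\<Sum>j\<in>J. d j * w j i) = d p * w p i + (\<Sum>j\<in>J-{p}. d j * w j i)"
        using Suc.prems p by (simp add: sum.remove)
      also have "(\<Sum>j\<in>J-{p}. d j * w j i) = (\<Sum>j\<in>J-{p}. c j * w j i)"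
        by (intro sum.cong) (auto simp: d_def)
      also have "d p * w p i = - (\<Sum>j\<in>J-{p}. c j * (w j S / w p S * w p i))"
        by (simp add: d_def sum_distrib_left sum_distrib_right sum_divide_distrib mult_ac)
      finally show ?thesis by (simp add: algebra_simps sum_subtractf)
    qed
    have "(\<Sum>j\<in>J. d j * w j i) = 0" if "i < Suc S" for i
    proof (cases "i = S")
      case True
      show ?thesis unfolding eq using p True by simp
    next
      case False
      then show ?thesis unfolding eq using that c(2)[of i] by simp
    qed
    moreover have "\<exists>j\<in>J. d j \<noteq> 0" using c(1) by (auto simp: d_def)
    ultimately show ?thesis by blast
  qed
qed

text \<open>The powers of a stochastic matrix are bounded, so \<open>I - M\<close> has no nontrivial Jordan block
  for the eigenvalue 0.\<close>

lemma kernel_range_trivial: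
  assumes M: "stoch S M"
    and y: "\<And>i. i < S \<Longrightarrow> y i = x i - mvec S M x i" "\<And>i. i < S \<Longrightarrow> mvec S M y i = y i"
    and i: "i < S"
  shows "y i = 0"
proof (rule ccontr)
  assume ne: "y i \<noteq> 0"
  have tele: "i < S \<Longrightarrow> x i - mvec S (matpow S M T) x i = real T * y i" for T i
  proof (induction T arbitrary: i)
    case 0
    then show ?case by (simp add: mvec_matpow_0 del: matpow.simps)
  next
    case (Suc T)
    have "mvec S (matpow S M (Suc T)) x i = mvec S M (\<lambda>j. x j - real T * y j) i"
      unfolding mvec_matpow_Suc using Suc.IH by (intro mvec_cong) (simp add: algebra_simps)
    also have "\<dots> = mvec S M x i - real T * y i"
      using y(2)[OF Suc.prems] by (simp add: mvec_diff mvec_cmult)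
    also have "\<dots> = x i - real (Suc T) * y i"
      using y(1)[OF Suc.prems] by (simp add: algebra_simps)
    finally show ?case by (simp add: algebra_simps del: matpow.simps)
  qed
  obtain B where B: "\<And>M i. substoch S M \<Longrightarrow> i < S \<Longrightarrow> \<bar>mvec S M x i\<bar> \<le> B"
    using mvec_bounded[of S x] by metis
  obtain T where T: "(B + \<bar>x i\<bar>) / \<bar>y i\<bar> < real T" using reals_Archimedean2 by blast
  have "real T * \<bar>y i\<bar> = \<bar>x i - mvec S (matpow S M T) x i\<bar>"
    using tele[OF i, of T] by (simp add: abs_mult)
  also have "\<dots> \<le> \<bar>x i\<bar> + B"
    using B[OF stoch_substoch[OF stoch_matpow[OF M, of T]] i] by linarith
  finally show False using T ne by (simp add: field_simps)
qed

text \<open>Splits \<open>v\<close> along the kernel and the range of \<open>F = I - M\<close>. The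
  \<open>S + 1\<close> iterates \<open>F^j v\<close> are dependent; after cancelling a power of
  \<open>F\<close> from the relation, its lowest term is a multiple of \<open>v\<close>, all other
  terms lie in the range of \<open>F\<close>, and their sum is harmonic.\<close>

lemma stoch_decomposition:
  assumes M: "stoch S M"
  obtains k u where "\<And>i. i < S \<Longrightarrow> mvec S M k i = k i"
    "\<And>i. i < S \<Longrightarrow> v i = k i + (u i - mvec S M u i)"
proof -
  define F where "F = (\<lambda>x i. x i - mvec S M x i)"
  define w where "w j = (F ^^ j) v" for j
  have Fc: "F x i = F y i" if "\<And>j. j < S \<Longrightarrow> x j = y j" "i < S" for x y i
    unfolding F_def using that by (auto intro: mvec_cong)
  have wS: "F (w j) = w (Suc j)" for j by (simp add: w_def)
  obtain c where c: "\<exists>j\<le>S. c j \<noteq> 0" "\<And>i. i < S \<Longrightarrow> (\<Sum>j\<le>S. c j * w j i) = 0"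
    using linear_dependence[of "{..S}" S w] by auto
  define m where "m = (LEAST j. c j \<noteq> 0)"
  have m: "c m \<noteq> 0" "m \<le> S" "\<And>j. j < m \<Longrightarrow> c j = 0"
  proof -
    obtain j where j: "j \<le> S" "c j \<noteq> 0" using c(1) by blast
    show "c m \<noteq> 0" unfolding m_def by (rule LeastI[of "\<lambda>j. c j \<noteq> 0", OF j(2)])
    show "m \<le> S" unfolding m_def using Least_le[of "\<lambda>j. c j \<noteq> 0", OF j(2)] j(1) by linarith
    show "c j = 0" if "j < m" for j using not_less_Least[OF that[unfolded m_def]] by blast
  qed
  \<comment> \<open>The relation divided by \<open>F^m\<close>, so that it begins with
    \<open>c m * v\<close> and satisfies \<open>F^m z = 0\<close>.\<close>
  define z where "z i = (\<Sum>j\<in>{m..S}. c j * w (j - m) i)" for i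
  have Fpow: "(F ^^ k) z i = (\<Sum>j\<in>{m..S}. c j * w (j - m + k) i)" for k i
  proof (induction k arbitrary: i)
    case 0
    then show ?case by (simp add: z_def)
  next
    case (Suc k)
    have IH: "(F ^^ k) z = (\<lambda>i. \<Sum>j\<in>{m..S}. c j * w (j - m + k) i)"
      by (rule ext) (rule Suc.IH)
    have "(F ^^ Suc k) z i = F (\<lambda>i. \<Sum>j\<in>{m..S}. c j * w (j - m + k) i) i"
      by (simp only: funpow.simps o_apply IH)
    also have "\<dots> = (\<Sum>j\<in>{m..S}. c j * F (w (j - m + k)) i)"
      unfolding F_def mvec_sum mvec_cmult sum_subtractf[symmetric] right_diff_distrib ..
    finally show ?case by (simp add: wS)
  qed
  have zero: "(F ^^ m) z i = 0" if "i < S" for i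
  proof -
    have "(F ^^ m) z i = (\<Sum>j\<in>{m..S}. c j * w j i)" unfolding Fpow by (intro sum.cong) auto
    also have "\<dots> = (\<Sum>j\<le>S. c j * w j i)" using m by (intro sum.mono_neutral_left) auto
    finally show ?thesis using c(2)[OF that] by simp
  qed
  have desc: "(\<forall>i<S. (F ^^ k) z i = 0) \<Longrightarrow> (\<forall>i<S. F z i = 0)" for k
  proof (induction k)
    case 0
    then have "F z i = F (\<lambda>_. 0) i" if "i < S" for i using that by (intro Fc) auto
    then show ?case by (simp add: F_def mvec_def)
  next
    case (Suc k)
    show ?case
    proof (cases k)
      case 0
      then show ?thesis using Suc.prems by simp
    next
      case (Suc k')
      \<comment> \<open>If \<open>F^(k+1) z\<close> vanishes, \<open>F^k z\<close> lies in the
        kernel of \<open>F\<close> and, as \<open>k\<close> is positive, in its range; so it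
        vanishes too. The descent stops at \<open>F z = 0\<close>.\<close>
      have "\<forall>i<S. (F ^^ k) z i = 0"
      proof (intro allI impI)
        fix i assume i: "i < S"
        show "(F ^^ k) z i = 0"
        proof (rule kernel_range_trivial[OF M _ _ i])
          fix i assume "i < S"
          show "(F ^^ k) z i = (F ^^ k') z i - mvec S M ((F ^^ k') z) i"
            by (simp add: Suc F_def)
          show "mvec S M ((F ^^ k) z) i = (F ^^ k) z i"
            using Suc.prems \<open>i < S\<close> by (simp add: F_def)
        qed
      qed
      then show ?thesis by (rule Suc.IH)
    qed
  qed
  have Fz: "F z i = 0" if "i < S" for i using desc[of m] zero that by auto
  define k where "k = (\<lambda>i. 1 / c m * z i)"
  \<comment> \<open>The terms of \<open>z\<close> above the lowest one, with one application of
    \<open>F\<close> removed and scaled by \<open>-1 / c m\<close>.\<close>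
  define u where "u = (\<lambda>i. \<Sum>j\<in>{Suc m..S}. - (c j / c m) * w (j - Suc m) i)"
  have "mvec S M k i = k i" if "i < S" for i
    using Fz[OF that] unfolding k_def mvec_cmult by (simp add: F_def)
  moreover have "v i = k i + (u i - mvec S M u i)" if "i < S" for i
  proof -
    have "F u i = (\<Sum>j\<in>{Suc m..S}. - (c j / c m) * F (w (j - Suc m)) i)"
      unfolding F_def u_def mvec_sum mvec_cmult sum_subtractf[symmetric] right_diff_distrib ..
    also have "\<dots> = - (\<Sum>j\<in>{Suc m..S}. c j * w (j - m) i) / c m"
      unfolding wS sum_divide_distrib sum_negf[symmetric]
      by (rule sum.cong[OF refl]) (simp add: Suc_diff_Suc[symmetric])
    also have "(\<Sum>j\<in>{Suc m..S}. c j * w (j - m) i) = z i - c m * v i"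
      using m(2) by (simp add: z_def sum.atLeast_Suc_atMost w_def)
    finally have "F u i = v i - k i" using m(1) by (simp add: k_def field_simps)
    then show ?thesis by (simp add: F_def)
  qed
  ultimately show ?thesis by (rule that[of k u])
qed

declare matpow.simps [simp del]

lemma mvec_matpow_harmonic:
  assumes "\<And>i. i < S \<Longrightarrow> mvec S M k i = k i" "i < S"
  shows "mvec S (matpow S M t) k i = k i"
  using assms(2)
proof (induction t arbitrary: i)
  case 0
  then show ?case by (rule mvec_matpow_0)
next
  case (Suc t)
  have "mvec S (matpow S M (Suc t)) k i = mvec S M k i"
    unfolding mvec_matpow_Suc by (rule mvec_cong) (rule Suc.IH)
  then show ?case using assms(1)[OF Suc.prems] by simp
qed

text \<open>The Poisson equation: \<open>k\<close> is the gain, but \<open>u\<close> is the bias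
  only up to a harmonic function. This freedom lets a discounted value, or a shifted bias, take the
  place of \<open>u\<close>.\<close>

locale decomposed =
  fixes S :: nat and M :: "nat \<Rightarrow> nat \<Rightarrow> real" and v k u :: "nat \<Rightarrow> real"
  assumes M: "stoch S M"
    and harm: "\<And>i. i < S \<Longrightarrow> mvec S M k i = k i"
    and v: "\<And>i. i < S \<Longrightarrow> v i = k i + (u i - mvec S M u i)"
begin

lemma pow_v: "i < S \<Longrightarrow> mvec S (matpow S M t) v i
    = k i + (mvec S (matpow S M t) u i - mvec S (matpow S M (Suc t)) u i)"
proof -
  assume i: "i < S"
  have "mvec S (matpow S M t) v i = mvec S (matpow S M t) (\<lambda>i. k i + (u i - mvec S M u i)) i"
    by (rule mvec_cong) (rule v)
  then show ?thesis
    using i mvec_matpow_harmonic[OF harm i, where t=t]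
    by (simp only: mvec_add mvec_diff mvec_matpow_shift)
qed

lemma sum_pow_v: "i < S \<Longrightarrow> (\<Sum>t<T. mvec S (matpow S M t) v i)
    = real T * k i + (u i - mvec S (matpow S M T) u i)"
proof (induction T)
  case 0
  then show ?case by (simp add: mvec_matpow_0)
next
  case (Suc T)
  then show ?case by (simp add: pow_v algebra_simps)
qed

lemma pow_bounded: "i < S \<Longrightarrow> (\<lambda>T. mvec S (matpow S M T) u i / real T) \<longlonglongrightarrow> 0"
proof -
  assume i: "i < S"
  obtain B where B: "\<And>M i. substoch S M \<Longrightarrow> i < S \<Longrightarrow> \<bar>mvec S M u i\<bar> \<le> B"
    using mvec_bounded[of S u] by metis
  show ?thesis
  proof (rule Lim_null_comparison)
    show "\<forall>\<^sub>F T in sequentially. norm (mvec S (matpow S M T) u i / real T) \<le> B / real T"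
      using B[OF stoch_substoch[OF stoch_matpow[OF M]] i]
      by (auto intro!: always_eventually divide_right_mono)
    show "(\<lambda>T. B / real T) \<longlonglongrightarrow> 0" by (rule lim_const_over_n)
  qed
qed

lemma average_LIMSEQ: "i < S \<Longrightarrow> (\<lambda>T. (\<Sum>t<T. mvec S (matpow S M t) v i) / real T) \<longlonglongrightarrow> k i"
proof -
  assume i: "i < S"
  have "(\<lambda>T. k i + (u i / real T - mvec S (matpow S M T) u i / real T)) \<longlonglongrightarrow> k i + (0 - 0)"
    by (intro tendsto_intros pow_bounded i lim_const_over_n)
  moreover have "\<forall>\<^sub>F T in sequentially. k i + (u i / real T - mvec S (matpow S M T) u i / real T)
      = (\<Sum>t<T. mvec S (matpow S M t) v i) / real T"
    using eventually_gt_at_top[of 0] by eventually_elim (simp add: sum_pow_v[OF i] field_simps)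
  ultimately show ?thesis by (simp add: tendsto_cong)
qed

lemma gain_eq: "i < S \<Longrightarrow> gain S M v i = k i"
  unfolding gain_def cesaro_def by (rule limI) (rule average_LIMSEQ)

end

lemma decomposed_exists:
  assumes "stoch S M"
  obtains k u where "decomposed S M v k u"
  using stoch_decomposition[OF assms, of v] assms unfolding decomposed_def by metis

lemma gain_LIMSEQ:
  assumes "stoch S M" "i < S"
  shows "(\<lambda>T. (\<Sum>t<T. mvec S (matpow S M t) v i) / real T) \<longlonglongrightarrow> gain S M v i"
proof -
  obtain k u where "decomposed S M v k u" using decomposed_exists[OF assms(1)] .
  then interpret decomposed S M v k u .
  show ?thesis using average_LIMSEQ gain_eq assms(2) by simp
qed

lemma gain_harmonic:
  assumes "stoch S M" "i < S"
  shows "mvec S M (gain S M v) i = gain S M v i"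
proof -
  obtain k u where "decomposed S M v k u" using decomposed_exists[OF assms(1)] .
  then interpret decomposed S M v k u .
  have "mvec S M (gain S M v) i = mvec S M k i" by (rule mvec_cong) (rule gain_eq)
  then show ?thesis using gain_eq harm assms(2) by simp
qed

text \<open>The centred partial sums telescope to \<open>u - M^T u\<close>, and the Cesaro mean of
  \<open>M^T u\<close> is the gain of \<open>u\<close>.\<close>

lemma (in decomposed) bias_eq:
  assumes i: "i < S"
  shows "bias S M v i = u i - gain S M u i"
proof -
  have *: "(\<Sum>t<T. mvec S (matpow S M t) v i - gain S M v i) = u i - mvec S (matpow S M T) u i" for T
    using sum_pow_v[OF i, of T] gain_eq[OF i] by (simp add: sum_subtractf)
  have "(\<lambda>N. u i - (\<Sum>T<N. mvec S (matpow S M T) u i) / real N) \<longlonglongrightarrow> u i - gain S M u i"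
    by (intro tendsto_intros gain_LIMSEQ M i)
  moreover have "\<forall>\<^sub>F N in sequentially. u i - (\<Sum>T<N. mvec S (matpow S M T) u i) / real N
      = (\<Sum>T<N. u i - mvec S (matpow S M T) u i) / real N"
    using eventually_gt_at_top[of 0]
    by eventually_elim (simp add: sum_subtractf diff_divide_distrib)
  ultimately have "(\<lambda>N. (\<Sum>T<N. u i - mvec S (matpow S M T) u i) / real N) \<longlonglongrightarrow> u i - gain S M u i"
    by (simp add: tendsto_cong)
  then show ?thesis unfolding bias_def cesaro_def * by (rule limI)
qed

lemma gain_bias_decomposed:
  assumes M: "stoch S M"
  shows "decomposed S M v (gain S M v) (bias S M v)"
proof -
  obtain k u where "decomposed S M v k u" using decomposed_exists[OF assms(1)] .
  then interpret decomposed S M v k u .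
  show ?thesis
  proof
    fix i assume i: "i < S"
    have "mvec S M (bias S M v) i = mvec S M (\<lambda>j. u j - gain S M u j) i"
      by (rule mvec_cong) (rule bias_eq)
    then show "v i = gain S M v i + (bias S M v i - mvec S M (bias S M v) i)"
      using v[OF i] by (simp add: mvec_diff gain_harmonic[OF M i] gain_eq[OF i] bias_eq[OF i])
  qed (rule M, rule gain_harmonic[OF M])
qed

lemma gain_ge:
  assumes "stoch S M" "i < S" "\<And>j. j < S \<Longrightarrow> a \<le> v j"
  shows "a \<le> gain S M v i"
proof (rule LIMSEQ_le_const[OF gain_LIMSEQ[OF assms(1,2)]], intro exI[of _ 1] allI impI)
  fix T :: nat assume "1 \<le> T"
  have "(\<Sum>t<T. a) \<le> (\<Sum>t<T. mvec S (matpow S M t) v i)"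
    by (intro sum_mono mvec_ge_const' stoch_matpow assms)
  then show "a \<le> (\<Sum>t<T. mvec S (matpow S M t) v i) / real T"
    using \<open>1 \<le> T\<close> by (simp add: field_simps)
qed

lemma gain_le:
  assumes "stoch S M" "i < S" "\<And>j. j < S \<Longrightarrow> v j \<le> a"
  shows "gain S M v i \<le> a"
proof (rule LIMSEQ_le_const2[OF gain_LIMSEQ[OF assms(1,2)]], intro exI[of _ 1] allI impI)
  fix T :: nat assume "1 \<le> T"
  have "(\<Sum>t<T. mvec S (matpow S M t) v i) \<le> (\<Sum>t<T. a)"
    by (intro sum_mono mvec_le_const' stoch_matpow assms)
  then show "(\<Sum>t<T. mvec S (matpow S M t) v i) / real T \<le> a"
    using \<open>1 \<le> T\<close> by (simp add: field_simps)
qed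

text \<open>Under the Cesaro limit \<open>M\<close> drops out of
  \<open>V = v + \<gamma> M V\<close>. Concretely,
  \<open>v = (1 - \<gamma>) V + \<gamma> (V - M V)\<close>, so a Poisson solution for
  \<open>V\<close> yields one for \<open>v\<close>.\<close>

lemma gain_resolvent:
  assumes M: "stoch S M" and V: "\<And>i. i < S \<Longrightarrow> V i = v i + \<gamma> * mvec S M V i" and i: "i < S"
  shows "gain S M v i = (1 - \<gamma>) * gain S M V i"
proof -
  obtain k u where "decomposed S M V k u" using decomposed_exists[OF assms(1)] .
  then interpret decomposed S M V k u .
  interpret d: decomposed S M v "\<lambda>i. (1 - \<gamma>) * k i" "\<lambda>i. (1 - \<gamma>) * u i + \<gamma> * V i"
  proof
    fix i assume i: "i < S"
    show "v i = (1 - \<gamma>) * k i + ((1 - \<gamma>) * u i + \<gamma> * V i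
        - mvec S M (\<lambda>i. (1 - \<gamma>) * u i + \<gamma> * V i) i)"
      using V[OF i] v[OF i] unfolding mvec_add mvec_cmult by algebra
  qed (simp_all add: M mvec_cmult harm)
  show ?thesis using d.gain_eq[OF i] gain_eq[OF i] by simp
qed

lemma decomposed_cong:
  assumes "decomposed S M v k u" "\<And>i. i < S \<Longrightarrow> M' i = M i" "\<And>i. i < S \<Longrightarrow> v' i = v i"
  shows "decomposed S M' v' k u"
proof -
  interpret decomposed S M v k u by fact
  have mv: "mvec S M' x i = mvec S M x i" if "i < S" for x i
    using assms(2)[OF that] by (simp add: mvec_def)
  show ?thesis
  proof
    show "stoch S M'" using M assms(2) by (simp add: stoch_def)
  qed (use harm v mv assms(3) in auto)
qed

lemma gain_cong:
  assumes "stoch S M" "\<And>i. i < S \<Longrightarrow> M' i = M i" "\<And>i. i < S \<Longrightarrow> v' i = v i" "s < S"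
  shows "gain S M' v' s = gain S M v s"
proof -
  obtain k u where d: "decomposed S M v k u" using decomposed_exists[OF assms(1)] .
  have "decomposed S M' v' k u" by (rule decomposed_cong[OF d assms(2,3)])
  then show ?thesis using d assms(4) by (simp add: decomposed.gain_eq)
qed

section \<open>Discounted values\<close>

lemma disc_summable:
  assumes "stoch S M" "0 \<le> \<gamma>" "\<gamma> < 1" "i < S"
  shows "summable (\<lambda>t. \<gamma> ^ t * mvec S (matpow S M t) v i)"
proof -
  obtain B where B: "\<And>M i. substoch S M \<Longrightarrow> i < S \<Longrightarrow> \<bar>mvec S M v i\<bar> \<le> B"
    using mvec_bounded[of S v] by metis
  show ?thesis
  proof (rule summable_comparison_test')
    show "summable (\<lambda>t. \<gamma> ^ t * B)" using assms by (intro summable_mult2 summable_geometric) auto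
    show "norm (\<gamma> ^ t * mvec S (matpow S M t) v i) \<le> \<gamma> ^ t * B" if "t \<ge> 0" for t
      using B[OF stoch_substoch[OF stoch_matpow[OF assms(1)]] assms(4)] assms(2)
      by (simp add: abs_mult mult_left_mono)
  qed
qed

lemma disc_bellman:
  assumes "stoch S M" "0 \<le> \<gamma>" "\<gamma> < 1" "i < S"
  shows "disc_value S M v \<gamma> i = v i + \<gamma> * mvec S M (disc_value S M v \<gamma>) i"
proof -
  note sm = disc_summable[OF assms(1-3), where v=v]
  have "disc_value S M v \<gamma> i = v i + (\<Sum>t. \<gamma> ^ Suc t * mvec S (matpow S M (Suc t)) v i)"
    unfolding disc_value_def using suminf_split_head[OF sm[OF assms(4)]]
    by (simp add: mvec_matpow_0[OF assms(4)])
  also have "(\<Sum>t. \<gamma> ^ Suc t * mvec S (matpow S M (Suc t)) v i)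
      = (\<Sum>t. \<gamma> * (\<Sum>j<S. M i j * (\<gamma> ^ t * mvec S (matpow S M t) v j)))"
    unfolding mvec_matpow_Suc mvec_def[of S M] sum_distrib_left by (simp add: mult_ac)
  also have "\<dots> = \<gamma> * (\<Sum>t. \<Sum>j<S. M i j * (\<gamma> ^ t * mvec S (matpow S M t) v j))"
    by (intro suminf_mult summable_sum summable_mult sm) auto
  also have "(\<Sum>t. \<Sum>j<S. M i j * (\<gamma> ^ t * mvec S (matpow S M t) v j))
      = (\<Sum>j<S. \<Sum>t. M i j * (\<gamma> ^ t * mvec S (matpow S M t) v j))"
    by (intro suminf_sum summable_mult sm) auto
  also have "\<dots> = mvec S M (disc_value S M v \<gamma>) i"
    unfolding mvec_def[of S M] disc_value_def by (intro sum.cong refl suminf_mult sm) auto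
  finally show ?thesis .
qed

lemma disc_unique:
  assumes "stoch S M" "0 \<le> \<gamma>" "\<gamma> < 1"
    and W: "\<And>i. i < S \<Longrightarrow> W i = v i + \<gamma> * mvec S M W i" and i: "i < S"
  shows "disc_value S M v \<gamma> i = W i"
proof -
  have "\<bar>disc_value S M v \<gamma> i - W i\<bar> \<le> 0 / (1 - \<gamma>)"
  proof (rule max_principle_abs[OF stoch_substoch[OF assms(1)] assms(2,3) _ i])
    fix i assume "i < S"
    then show "\<bar>disc_value S M v \<gamma> i - W i - \<gamma> * mvec S M (\<lambda>i. disc_value S M v \<gamma> i - W i) i\<bar> \<le> 0"
      using disc_bellman[OF assms(1-3), of i v] W[of i] by (simp add: mvec_diff algebra_simps)
  qed
  then show ?thesis by simp
qed

text \<open>Once \<open>k / (1 - \<gamma>) + u\<close> is subtracted from the discounted value, the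
  residual of the Bellman equation is only \<open>-(1 - \<gamma>) M u\<close>, whose small factor
  cancels the \<open>1 / (1 - \<gamma>)\<close> of the maximum principle.\<close>

lemma (in decomposed) disc_abel:
  assumes g: "0 \<le> \<gamma>" "\<gamma> < 1" and i: "i < S" and B: "\<And>j. j < S \<Longrightarrow> \<bar>u j\<bar> \<le> B"
  shows "\<bar>disc_value S M v \<gamma> i - k i / (1 - \<gamma>)\<bar> \<le> 2 * B"
proof -
  define y where "y = (\<lambda>j. disc_value S M v \<gamma> j - 1 / (1 - \<gamma>) * k j - u j)"
  have "\<bar>y i\<bar> \<le> ((1 - \<gamma>) * B) / (1 - \<gamma>)"
  proof (rule max_principle_abs[OF stoch_substoch[OF M] g _ i])
    fix i assume i: "i < S"
    have "y i - \<gamma> * mvec S M y i = - (1 - \<gamma>) * mvec S M u i"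
    proof -
      have "1 / (1 - \<gamma>) * k i = k i + \<gamma> * (1 / (1 - \<gamma>) * k i)" using g by (simp add: field_simps)
      then show ?thesis
        unfolding y_def mvec_diff mvec_cmult harm[OF i]
        using disc_bellman[OF M g i, of v] v[OF i] by algebra
    qed
    then show "\<bar>y i - \<gamma> * mvec S M y i\<bar> \<le> (1 - \<gamma>) * B"
      using mvec_abs_le[OF stoch_substoch[OF M] i B] g
      by (simp only: abs_mult abs_minus_cancel) (auto intro!: mult_left_mono)
  qed
  then have "\<bar>y i\<bar> \<le> B" using g by simp
  then show ?thesis using B[OF i] by (simp add: y_def)
qed

section \<open>Span seminorm\<close>

lemma span_diff_le: "i < S \<Longrightarrow> j < S \<Longrightarrow> x i - x j \<le> span S x"
  unfolding span_def by (intro diff_mono Max_ge Min_le) auto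

lemma span_nonneg: "0 < S \<Longrightarrow> 0 \<le> span S x"
  using span_diff_le[of 0 S 0 x] by simp

lemma span_le:
  assumes "0 < S" "\<And>i j. i < S \<Longrightarrow> j < S \<Longrightarrow> x i - x j \<le> c"
  shows "span S x \<le> c"
proof -
  have "Max (x ` {..<S}) \<in> x ` {..<S}" "Min (x ` {..<S}) \<in> x ` {..<S}"
    using assms by (auto intro!: Max_in Min_in)
  then obtain i j where "i < S" "Max (x ` {..<S}) = x i" "j < S" "Min (x ` {..<S}) = x j" by auto
  then show ?thesis using assms(2) by (simp add: span_def)
qed

lemma span_cong:
  assumes "\<And>i. i < S \<Longrightarrow> x i = y i - c"
  shows "span S x = span S y"
proof (cases "S = 0")
  case True
  then show ?thesis by (simp add: span_def)
next
  case False
  have d: "x i - x j = y i - y j" if "i < S" "j < S" for i j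
    using that by (simp add: assms)
  show ?thesis
  proof (intro antisym span_le)
    show "x i - x j \<le> span S y" if "i < S" "j < S" for i j
      unfolding d[OF that] by (rule span_diff_le[OF that])
    show "y i - y j \<le> span S x" if "i < S" "j < S" for i j
      unfolding d[OF that, symmetric] by (rule span_diff_le[OF that])
  qed (use False in auto)
qed

lemma span_range:
  assumes "0 < S"
  obtains m where "\<And>i. i < S \<Longrightarrow> m \<le> x i" "\<And>i. i < S \<Longrightarrow> x i \<le> m + span S x" "\<exists>i<S. m = x i"
proof
  have "Min (x ` {..<S}) \<in> x ` {..<S}" using assms by (intro Min_in) auto
  then show "\<exists>i<S. Min (x ` {..<S}) = x i" by auto
qed (auto simp: span_def)

section \<open>Anchoring\<close>

definition anchor_mat :: "real \<Rightarrow> nat \<Rightarrow> (nat \<Rightarrow> nat \<Rightarrow> real) \<Rightarrow> nat \<Rightarrow> nat \<Rightarrow> real" where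
  "anchor_mat \<eta> s0 M i j = (1 - \<eta>) * M i j + \<eta> * (if j = s0 then 1 else 0)"

lemma mvec_anchor_mat:
  "s0 < S \<Longrightarrow> mvec S (anchor_mat \<eta> s0 M) x i = (1 - \<eta>) * mvec S M x i + \<eta> * x s0"
proof -
  assume "s0 < S"
  then have "(\<Sum>j<S. (if j = s0 then 1 else 0) * x j) = x s0"
    by (simp add: if_distrib[where f="\<lambda>a. a * _"] cong: if_cong)
  then show ?thesis
    by (simp add: mvec_def anchor_mat_def algebra_simps sum.distrib sum_subtractf flip: sum_distrib_left)
qed

lemma stoch_anchor_mat:
  assumes "stoch S M" "0 \<le> \<eta>" "\<eta> \<le> 1" "s0 < S"
  shows "stoch S (anchor_mat \<eta> s0 M)"
proof -
  have "(\<Sum>j<S. anchor_mat \<eta> s0 M i j) = 1" if "i < S" for i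
    using mvec_anchor_mat[OF assms(4), of \<eta> M "\<lambda>_. 1" i] mvec_const[OF assms(1) that, of 1]
    by (simp add: mvec_def[of _ "anchor_mat \<eta> s0 M"])
  then show ?thesis using assms by (auto simp: stoch_def anchor_mat_def)
qed

text \<open>The reset adds \<open>\<eta> * V s0\<close> to the one-step mean of \<open>V\<close>,
  whatever the current state; this is the constant gain for which \<open>V\<close> solves the
  Poisson equation of the anchored chain.\<close>

lemma anchor_mat_decomposed:
  assumes M: "stoch S M" and e: "0 < \<eta>" "\<eta> \<le> 1" and s0: "s0 < S"
    and V: "\<And>i. i < S \<Longrightarrow> V i = v i + (1 - \<eta>) * mvec S M V i"
  shows "decomposed S (anchor_mat \<eta> s0 M) v (\<lambda>_. \<eta> * V s0) V"
proof
  show st: "stoch S (anchor_mat \<eta> s0 M)" using M e s0 by (intro stoch_anchor_mat) auto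
  show "mvec S (anchor_mat \<eta> s0 M) (\<lambda>_. \<eta> * V s0) i = \<eta> * V s0" if "i < S" for i
    by (rule mvec_const[OF st that])
  show "v i = \<eta> * V s0 + (V i - mvec S (anchor_mat \<eta> s0 M) V i)" if "i < S" for i
    using V[OF that] by (simp add: mvec_anchor_mat[OF s0])
qed

lemma span_bias_anchor:
  assumes M: "stoch S M" and e: "0 < \<eta>" "\<eta> \<le> 1" and s0: "s0 < S"
    and M': "\<And>i. i < S \<Longrightarrow> M' i = anchor_mat \<eta> s0 M i"
  shows "span S (bias S M' v) = span S (disc_value S M v (1 - \<eta>))"
proof -
  let ?D = "\<lambda>v. disc_value S M v (1 - \<eta>)"
  have D: "?D v i = v i + (1 - \<eta>) * mvec S M (?D v) i" if "i < S" for v i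
    using e that by (intro disc_bellman M) auto
  have dec: "decomposed S M' v (\<lambda>_. \<eta> * ?D v s0) (?D v)" for v
    by (rule decomposed_cong[OF anchor_mat_decomposed[OF M e s0 D] M']) auto
  \<comment> \<open>The bias is \<open>?D v\<close> minus its anchored gain. By \<open>dec\<close>
    for the reward \<open>?D v\<close> that gain is the constant
    \<open>\<eta> * ?D (?D v) s0\<close>, invisible to the span.\<close>
  show ?thesis
    by (rule span_cong[where c="\<eta> * ?D (?D v) s0"])
      (simp add: decomposed.bias_eq[OF dec] decomposed.gain_eq[OF dec])
qed

section \<open>Markov decision processes\<close>

definition qexp :: "nat \<Rightarrow> (nat \<Rightarrow> nat \<Rightarrow> nat \<Rightarrow> real) \<Rightarrow> (nat \<Rightarrow> real) \<Rightarrow> nat \<Rightarrow> nat \<Rightarrow> real" where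
  "qexp S Q x s a = mvec S (\<lambda>s. Q s a) x s"

definition stoch_kernel :: "nat \<Rightarrow> nat \<Rightarrow> (nat \<Rightarrow> nat \<Rightarrow> nat \<Rightarrow> real) \<Rightarrow> bool" where
  "stoch_kernel S A Q \<longleftrightarrow> (\<forall>a<A. stoch S (\<lambda>s. Q s a))"

definition pol_value :: "nat \<Rightarrow> nat \<Rightarrow> (nat \<Rightarrow> nat \<Rightarrow> nat \<Rightarrow> real) \<Rightarrow> (nat \<Rightarrow> nat \<Rightarrow> real) \<Rightarrow> real
    \<Rightarrow> (nat \<Rightarrow> nat) \<Rightarrow> nat \<Rightarrow> real" where
  "pol_value S A Q r \<gamma> \<pi> = disc_value S (Pmat A Q (det_pol \<pi>)) (rvec A r (det_pol \<pi>)) \<gamma>"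

lemma Pmat_det: "\<pi> s < A \<Longrightarrow> Pmat A Q (det_pol \<pi>) s s' = Q s (\<pi> s) s'"
  by (simp add: Pmat_def det_pol_def if_distrib[where f="\<lambda>x. x * _"] cong: if_cong)

lemma rvec_det: "\<pi> s < A \<Longrightarrow> rvec A r (det_pol \<pi>) s = r s (\<pi> s)"
  by (simp add: rvec_def det_pol_def if_distrib[where f="\<lambda>x. x * _"] cong: if_cong)

lemma mvec_Pmat_det: "\<pi> s < A \<Longrightarrow> mvec S (Pmat A Q (det_pol \<pi>)) x s = qexp S Q x s (\<pi> s)"
  by (simp add: qexp_def mvec_def Pmat_det)

lemma mvec_Pmat: "mvec S (Pmat A Q \<sigma>) x s = (\<Sum>a<A. \<sigma> s a * qexp S Q x s a)"
  unfolding qexp_def mvec_def Pmat_def sum_distrib_left sum_distrib_right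
  by (subst sum.swap) (simp add: mult_ac)

lemma policy_ok_det: "det_ok S A \<pi> \<Longrightarrow> policy_ok S A (det_pol \<pi>)"
  by (auto simp: policy_ok_def det_ok_def det_pol_def)

lemma stoch_Pmat:
  assumes "stoch_kernel S A Q" "policy_ok S A \<sigma>"
  shows "stoch S (Pmat A Q \<sigma>)"
proof -
  have "(\<Sum>j<S. Pmat A Q \<sigma> s j) = 1" if "s < S" for s
  proof -
    have "(\<Sum>j<S. Pmat A Q \<sigma> s j) = mvec S (Pmat A Q \<sigma>) (\<lambda>_. 1) s" by (simp add: mvec_def)
    also have "\<dots> = (\<Sum>a<A. \<sigma> s a * 1)"
      unfolding mvec_Pmat using assms(1) that
      by (intro sum.cong refl) (simp add: qexp_def stoch_kernel_def mvec_const)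
    finally show ?thesis using assms(2) that by (simp add: policy_ok_def)
  qed
  moreover have "0 \<le> Pmat A Q \<sigma> s j" if "s < S" "j < S" for s j
    unfolding Pmat_def using assms that
    by (intro sum_nonneg mult_nonneg_nonneg) (auto simp: policy_ok_def stoch_kernel_def stoch_def)
  ultimately show ?thesis by (simp add: stoch_def)
qed

lemma pol_value_bellman:
  assumes "stoch_kernel S A Q" "det_ok S A \<pi>" "0 \<le> \<gamma>" "\<gamma> < 1" "s < S"
  shows "pol_value S A Q r \<gamma> \<pi> s
    = r s (\<pi> s) + \<gamma> * qexp S Q (pol_value S A Q r \<gamma> \<pi>) s (\<pi> s)"
proof -
  have "\<pi> s < A" using assms by (simp add: det_ok_def)
  then show ?thesis
    using disc_bellman[OF stoch_Pmat[OF assms(1) policy_ok_det[OF assms(2)]] assms(3-5)]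
    by (simp add: pol_value_def rvec_det mvec_Pmat_det)
qed

lemma qexp_const: "stoch_kernel S A Q \<Longrightarrow> s < S \<Longrightarrow> a < A \<Longrightarrow> qexp S Q (\<lambda>_. c) s a = c"
  by (simp add: qexp_def stoch_kernel_def mvec_const)

lemma qexp_diff: "qexp S Q (\<lambda>s. x s - y s) s a = qexp S Q x s a - qexp S Q y s a"
  by (simp add: qexp_def mvec_diff)

lemma qexp_cmult: "qexp S Q (\<lambda>s. c * x s) s a = c * qexp S Q x s a"
  by (simp add: qexp_def mvec_cmult)

lemma qexp_add: "qexp S Q (\<lambda>s. x s + y s) s a = qexp S Q x s a + qexp S Q y s a"
  by (simp add: qexp_def mvec_add)

lemma qexp_minus: "qexp S Q (\<lambda>s. - x s) s a = - qexp S Q x s a"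
  by (simp add: qexp_def mvec_minus)

lemma qexp_cong: "(\<And>j. j < S \<Longrightarrow> x j = y j) \<Longrightarrow> qexp S Q x s a = qexp S Q y s a"
  unfolding qexp_def by (rule mvec_cong)

lemma qexp_abs_le:
  assumes "stoch_kernel S A Q" "s < S" "a < A" "\<And>j. j < S \<Longrightarrow> \<bar>x j\<bar> \<le> c"
  shows "\<bar>qexp S Q x s a\<bar> \<le> c"
  unfolding qexp_def using assms
  by (intro mvec_abs_le[OF stoch_substoch]) (auto simp: stoch_kernel_def)

lemma qexp_mono:
  assumes "stoch_kernel S A Q" "s < S" "a < A" "\<And>j. j < S \<Longrightarrow> x j \<le> y j"
  shows "qexp S Q x s a \<le> qexp S Q y s a"
  unfolding qexp_def using assms
  by (intro mvec_mono[OF stoch_substoch]) (auto simp: stoch_kernel_def)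

lemma pol_max_principle:
  assumes Q: "stoch_kernel S A Q" and p: "det_ok S A \<pi>" and g: "0 \<le> \<gamma>" "\<gamma> < 1" "0 \<le> c"
    and x: "\<And>i. i < S \<Longrightarrow> x i \<le> \<gamma> * qexp S Q x i (\<pi> i) + c"
    and i: "i < S"
  shows "x i \<le> c / (1 - \<gamma>)"
proof (rule max_principle[OF stoch_substoch[OF stoch_Pmat[OF Q policy_ok_det[OF p]]] g _ i])
  fix i assume "i < S"
  then show "x i \<le> \<gamma> * mvec S (Pmat A Q (det_pol \<pi>)) x i + c"
    using x[of i] p by (simp add: det_ok_def mvec_Pmat_det)
qed

lemma pol_max_principle_abs:
  assumes Q: "stoch_kernel S A Q" and p: "det_ok S A \<pi>" and g: "0 \<le> \<gamma>" "\<gamma> < 1"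
    and x: "\<And>i. i < S \<Longrightarrow> \<bar>x i - \<gamma> * qexp S Q x i (\<pi> i)\<bar> \<le> c"
    and i: "i < S"
  shows "\<bar>x i\<bar> \<le> c / (1 - \<gamma>)"
proof (rule max_principle_abs[OF stoch_substoch[OF stoch_Pmat[OF Q policy_ok_det[OF p]]] g _ i])
  fix i assume "i < S"
  then show "\<bar>x i - \<gamma> * mvec S (Pmat A Q (det_pol \<pi>)) x i\<bar> \<le> c"
    using x[of i] p by (simp add: det_ok_def mvec_Pmat_det)
qed

text \<open>Policy improvement: switching to a strictly better action at one state would improve the value.\<close>

lemma optimal_bellman:
  assumes Q: "stoch_kernel S A Q" and p: "det_ok S A \<pi>" and g: "0 \<le> \<gamma>" "\<gamma> < 1"
    and opt: "\<And>\<pi>' s. det_ok S A \<pi>' \<Longrightarrow> s < S \<Longrightarrow> pol_value S A Q r \<gamma> \<pi>' s \<le> pol_value S A Q r \<gamma> \<pi> s"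
    and s: "s < S" and a: "a < A"
  shows "r s a + \<gamma> * qexp S Q (pol_value S A Q r \<gamma> \<pi>) s a \<le> pol_value S A Q r \<gamma> \<pi> s"
proof (rule ccontr)
  assume contr: "\<not> ?thesis"
  define \<pi>' where "\<pi>' = \<pi>(s := a)"
  have p': "det_ok S A \<pi>'" using p a by (auto simp: \<pi>'_def det_ok_def)
  let ?V = "pol_value S A Q r \<gamma> \<pi>" and ?V' = "pol_value S A Q r \<gamma> \<pi>'"
  define x where "x = (\<lambda>i. ?V i - ?V' i)"
  have V': "?V' i = r i (\<pi>' i) + \<gamma> * qexp S Q ?V' i (\<pi>' i)" if "i < S" for i
    by (rule pol_value_bellman[OF Q p' g that])
  have V: "?V i \<le> r i (\<pi>' i) + \<gamma> * qexp S Q ?V i (\<pi>' i)" if "i < S" for i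
    using contr pol_value_bellman[OF Q p g that, of r] by (auto simp: \<pi>'_def)
  have xle: "x i \<le> 0 / (1 - \<gamma>)" if "i < S" for i
  proof (rule pol_max_principle[OF Q p' g _ _ that])
    show "x i \<le> \<gamma> * qexp S Q x i (\<pi>' i) + 0" if "i < S" for i
      using V[OF that] V'[OF that] by (simp add: x_def qexp_diff algebra_simps)
  qed simp
  \<comment> \<open>The modified policy is at least as good by the maximum principle and at most as
    good by optimality; equal values contradict the strict inequality at \<open>s\<close>.\<close>
  have x0: "x i = 0" if "i < S" for i
    using xle[OF that] opt[OF p' that] by (simp add: x_def)
  have "qexp S Q x s a = qexp S Q (\<lambda>_. 0) s a" unfolding qexp_def by (rule mvec_cong) (rule x0)
  then have "qexp S Q x s a = 0" by (simp add: qexp_const[OF Q s a])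
  moreover have "x s < \<gamma> * qexp S Q x s a"
    using contr V'[OF s] by (simp add: x_def qexp_diff \<pi>'_def algebra_simps)
  ultimately show False using x0[OF s] by simp
qed

section \<open>The gain of a Blackwell-optimal policy\<close>

lemma blackwell_bellman:
  assumes Q: "stoch_kernel S A Q" and b: "blackwell_opt S A Q r \<pi>"
  obtains \<gamma>0 where "0 \<le> \<gamma>0" "\<gamma>0 < 1" "\<And>\<gamma> s a. \<gamma>0 \<le> \<gamma> \<Longrightarrow> \<gamma> < 1 \<Longrightarrow> s < S \<Longrightarrow> a < A \<Longrightarrow>
    r s a + \<gamma> * qexp S Q (pol_value S A Q r \<gamma> \<pi>) s a \<le> pol_value S A Q r \<gamma> \<pi> s"
proof -
  obtain \<gamma>0 where g0: "0 \<le> \<gamma>0" "\<gamma>0 < 1"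
    and opt: "\<And>\<gamma> \<sigma> s. \<gamma>0 \<le> \<gamma> \<Longrightarrow> \<gamma> < 1 \<Longrightarrow> policy_ok S A \<sigma> \<Longrightarrow> s < S \<Longrightarrow>
      disc_value S (Pmat A Q \<sigma>) (rvec A r \<sigma>) \<gamma> s \<le> pol_value S A Q r \<gamma> \<pi> s"
    using b unfolding blackwell_opt_def pol_value_def by blast
  have p: "det_ok S A \<pi>" using b by (simp add: blackwell_opt_def)
  show ?thesis
  proof (rule that[OF g0])
    fix \<gamma> s a assume g: "\<gamma>0 \<le> \<gamma>" "\<gamma> < 1" and sa: "s < S" "a < A"
    show "r s a + \<gamma> * qexp S Q (pol_value S A Q r \<gamma> \<pi>) s a \<le> pol_value S A Q r \<gamma> \<pi> s"
    proof (rule optimal_bellman[OF Q p _ g(2) _ sa])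
      show "0 \<le> \<gamma>" using g g0 by linarith
      show "pol_value S A Q r \<gamma> \<pi>' s \<le> pol_value S A Q r \<gamma> \<pi> s"
        if "det_ok S A \<pi>'" "s < S" for \<pi>' s
        using opt[OF g policy_ok_det[OF that(1)] that(2)] by (simp add: pol_value_def)
    qed
  qed
qed

lemma le_if_le_small:
  fixes a b C x0 :: real
  assumes "0 < x0" "\<And>x. 0 < x \<Longrightarrow> x \<le> x0 \<Longrightarrow> a \<le> b + x * C"
  shows "a \<le> b"
proof (rule tendsto_lowerbound[where F="at_right 0" and f="\<lambda>x. b + x * C"])
  have "((\<lambda>x. b + x * C) \<longlongrightarrow> b + 0 * C) (at_right 0)" by (intro tendsto_intros)
  then show "((\<lambda>x. b + x * C) \<longlongrightarrow> b) (at_right 0)" by simp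
  show "\<forall>\<^sub>F x in at_right 0. a \<le> b + x * C"
    using assms by (auto simp: eventually_at_right_field intro!: exI[of _ x0])
qed simp

text \<open>Multiply the discounted Bellman inequality by \<open>x = 1 - \<gamma>\<close> and let
  \<open>x\<close> tend to 0: by \<open>disc_abel\<close>, \<open>x V\<close> is within
  \<open>2 * B * x\<close> of the gain.\<close>

lemma blackwell_gain_superharmonic:
  assumes Q: "stoch_kernel S A Q" and b: "blackwell_opt S A Q r \<pi>" and s: "s < S" and a: "a < A"
  shows "qexp S Q (gain S (Pmat A Q (det_pol \<pi>)) (rvec A r (det_pol \<pi>))) s a
    \<le> gain S (Pmat A Q (det_pol \<pi>)) (rvec A r (det_pol \<pi>)) s"
proof -
  let ?M = "Pmat A Q (det_pol \<pi>)" and ?v = "rvec A r (det_pol \<pi>)"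
  have p: "det_ok S A \<pi>" using b by (simp add: blackwell_opt_def)
  have M: "stoch S ?M" by (rule stoch_Pmat[OF Q policy_ok_det[OF p]])
  define k where "k = gain S ?M ?v"
  define u where "u = bias S ?M ?v"
  interpret decomposed S ?M ?v k u
    unfolding k_def u_def by (rule gain_bias_decomposed[OF M])
  define B where "B = (\<Sum>j<S. \<bar>u j\<bar>)"
  have B: "\<bar>u j\<bar> \<le> B" if "j < S" for j unfolding B_def using that by (auto intro: member_le_sum)
  obtain \<gamma>0 where g0: "0 \<le> \<gamma>0" "\<gamma>0 < 1" and opt: "\<And>\<gamma> s a. \<gamma>0 \<le> \<gamma> \<Longrightarrow> \<gamma> < 1 \<Longrightarrow> s < S \<Longrightarrow> a < A \<Longrightarrow>
    r s a + \<gamma> * qexp S Q (pol_value S A Q r \<gamma> \<pi>) s a \<le> pol_value S A Q r \<gamma> \<pi> s"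
    using blackwell_bellman[OF Q b] by metis
  have "qexp S Q k s a \<le> k s"
  proof (rule le_if_le_small)
    show "0 < 1 - \<gamma>0" using g0 by simp
    fix x :: real assume x: "0 < x" "x \<le> 1 - \<gamma>0"
    define \<gamma> where "\<gamma> = 1 - x"
    have g: "\<gamma>0 \<le> \<gamma>" "0 \<le> \<gamma>" "\<gamma> < 1" using x g0 by (auto simp: \<gamma>_def)
    define V where "V = pol_value S A Q r \<gamma> \<pi>"
    have VK: "\<bar>x * V i - k i\<bar> \<le> 2 * B * x" if "i < S" for i
      using disc_abel[OF g(2,3) that B] x
      unfolding V_def pol_value_def \<gamma>_def by (simp add: field_simps abs_le_iff)
    have "qexp S Q (\<lambda>i. k i - x * V i) s a \<le> 2 * B * x"
      using qexp_abs_le[OF Q s a, of "\<lambda>i. k i - x * V i" "2 * B * x"] VK by (simp add: abs_minus_commute)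
    then have "qexp S Q k s a - x * qexp S Q V s a \<le> 2 * B * x" by (simp add: qexp_diff qexp_cmult)
    moreover have "r s a + (1 - x) * qexp S Q V s a \<le> V s"
      using opt[OF g(1,3) s a] by (simp add: V_def \<gamma>_def)
    then have "x * (r s a + (1 - x) * qexp S Q V s a) \<le> x * V s" using x by (intro mult_left_mono) auto
    moreover have "x * qexp S Q V s a \<le> qexp S Q k s a + 2 * B * x"
      using qexp_abs_le[OF Q s a, of "\<lambda>i. x * V i - k i" "2 * B * x"] VK by (simp add: qexp_diff qexp_cmult)
    \<comment> \<open>The discount factor \<open>1 - x\<close> leaves a term of order
      \<open>x\<close>, for which a crude bound on \<open>x V\<close> suffices. It contributes the
      last of the three errors \<open>2 * B * x\<close> collected in \<open>6 * B\<close>.\<close>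
    then have "x * (x * qexp S Q V s a) \<le> x * (qexp S Q k s a + 2 * B)"
    proof (intro mult_left_mono)
      assume "x * qexp S Q V s a \<le> qexp S Q k s a + 2 * B * x"
      moreover have "2 * B * x \<le> 2 * B * 1"
        using x g0 B[OF s] by (intro mult_left_mono) auto
      ultimately show "x * qexp S Q V s a \<le> qexp S Q k s a + 2 * B" by simp
    qed (use x in auto)
    ultimately show "qexp S Q k s a \<le> k s + x * (6 * B + qexp S Q k s a - r s a)"
      using VK[OF s] by (simp add: algebra_simps abs_le_iff)
  qed
  then show ?thesis by (simp add: k_def)
qed

text \<open>Visits to \<open>j\<close> are most numerous when the chain starts there: from
  elsewhere, time is lost before the first visit. The horizon \<open>T\<close> stays fixed in the
  induction, so that one bound covers every first step.\<close>

lemma occupation_le_diag: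
  assumes M: "stoch S M" and j: "j < S"
  shows "i < S \<Longrightarrow> t \<le> T \<Longrightarrow> (\<Sum>\<tau><t. matpow S M \<tau> i j) \<le> (\<Sum>\<tau><T. matpow S M \<tau> j j)"
proof (induction t arbitrary: i)
  case 0
  then show ?case using stoch_matpow[OF M] j by (auto intro!: sum_nonneg simp: stoch_def)
next
  case (Suc t)
  show ?case
  proof (cases "i = j")
    case True
    then show ?thesis using stoch_matpow[OF M] j Suc.prems
      by (auto intro!: sum_mono2 simp: stoch_def simp del: sum.lessThan_Suc)
  next
    case False
    have "(\<Sum>\<tau><Suc t. matpow S M \<tau> i j) = (\<Sum>\<tau><t. matpow S M (Suc \<tau>) i j)"
      unfolding sum.lessThan_Suc_shift using False by (simp add: matpow.simps)
    also have "\<dots> = mvec S M (\<lambda>k. \<Sum>\<tau><t. matpow S M \<tau> k j) i"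
      unfolding mvec_sum by (simp add: mvec_def matpow.simps)
    also have "\<dots> \<le> (\<Sum>\<tau><T. matpow S M \<tau> j j)"
      using Suc by (intro mvec_le_const'[OF M]) auto
    finally show ?thesis .
  qed
qed

text \<open>From a closed set the expected number of visits to it in \<open>T\<close> steps is
  \<open>T\<close>, while transience of all its states would bound it by a finite sum of diagonal
  series.\<close>

lemma closed_set_recurrent:
  assumes M: "stoch S M" and B: "B \<subseteq> {..<S}" "B \<noteq> {}"
    and closed: "\<And>s s'. s \<in> B \<Longrightarrow> s' < S \<Longrightarrow> 0 < M s s' \<Longrightarrow> s' \<in> B"
  shows "\<exists>s\<in>B. \<not> transient_state S M s"
proof (rule ccontr)
  assume "\<not> ?thesis"
  then have tr: "summable (\<lambda>t. matpow S M t s s)" if "s \<in> B" for s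
    using that by (auto simp: transient_state_def)
  have finB: "finite B" using B by (meson finite_lessThan finite_subset)
  have stay: "s \<in> B \<Longrightarrow> (\<Sum>s'\<in>B. matpow S M t s s') = 1" for s t
  proof (induction t arbitrary: s)
    case 0
    then show ?case using finB by (simp add: matpow.simps)
  next
    case (Suc t)
    have s: "s < S" using Suc.prems B by auto
    have "(\<Sum>s'\<in>B. matpow S M (Suc t) s s') = (\<Sum>k<S. M s k * (\<Sum>s'\<in>B. matpow S M t k s'))"
      unfolding matpow.simps sum_distrib_left by (rule sum.swap)
    also have "\<dots> = (\<Sum>k<S. M s k)"
    proof (intro sum.cong refl)
      fix k assume k: "k \<in> {..<S}"
      show "M s k * (\<Sum>s'\<in>B. matpow S M t k s') = M s k"
      proof (cases "k \<in> B")
        case False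
        then have "M s k = 0"
          using closed[OF Suc.prems, of k] k M s by (force simp: stoch_def)
        then show ?thesis by simp
      qed (simp add: Suc.IH)
    qed
    finally show ?case using M s by (simp add: stoch_def)
  qed
  obtain s where s: "s \<in> B" using B by auto
  obtain T where T: "(\<Sum>s'\<in>B. \<Sum>t. matpow S M t s' s') < real T" using reals_Archimedean2 by blast
  have "real T = (\<Sum>t<T. \<Sum>s'\<in>B. matpow S M t s s')" by (simp add: stay[OF s])
  also have "\<dots> = (\<Sum>s'\<in>B. \<Sum>t<T. matpow S M t s s')" by (rule sum.swap)
  also have "\<dots> \<le> (\<Sum>s'\<in>B. \<Sum>t<T. matpow S M t s' s')"
    using s B by (intro sum_mono occupation_le_diag[OF M]) auto
  also have "\<dots> \<le> (\<Sum>s'\<in>B. \<Sum>t. matpow S M t s' s')"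
    using stoch_matpow[OF M] B by (intro sum_mono sum_le_suminf tr) (auto simp: stoch_def)
  finally show False using T by simp
qed

lemma attained_min_spreads:
  assumes M: "stoch S M" and s: "s < S" and le: "mvec S M k s \<le> m"
    and ge: "\<And>j. j < S \<Longrightarrow> m \<le> k j" and j: "j < S" "0 < M s j"
  shows "k j = m"
proof (rule ccontr)
  assume "k j \<noteq> m"
  then have "0 < M s j * (k j - m)" using ge[OF j(1)] j by (intro mult_pos_pos) auto
  also have "\<dots> \<le> (\<Sum>j<S. M s j * (k j - m))"
    using M s ge j by (intro member_le_sum) (auto simp: stoch_def)
  also have "\<dots> = mvec S M k s - m"
    using mvec_diff[of S M k "\<lambda>_. m" s] mvec_const[OF M s, of m] by (simp add: mvec_def)
  finally show False using le by simp
qed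

text \<open>The gain is harmonic for the chain of \<pi>, so its sets of minimisers and of maximisers
  are closed and each contains a state of \<open>C\<close>. Some policy leads from the minimiser to
  the maximiser in \<open>C\<close>, but under every policy the gain can only decrease on
  average.\<close>

lemma blackwell_gain_constant:
  assumes Q: "stoch_kernel S A Q" and wc: "weakly_communicating S A Q"
    and b: "blackwell_opt S A Q r \<pi>" and S: "0 < S"
  obtains \<rho> where "\<And>s. s < S \<Longrightarrow> gain S (Pmat A Q (det_pol \<pi>)) (rvec A r (det_pol \<pi>)) s = \<rho>"
proof -
  let ?M = "Pmat A Q (det_pol \<pi>)"
  define k where "k = gain S ?M (rvec A r (det_pol \<pi>))"
  have p: "det_ok S A \<pi>" using b by (simp add: blackwell_opt_def)
  have M: "stoch S ?M" by (rule stoch_Pmat[OF Q policy_ok_det[OF p]])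
  have kM: "mvec S ?M k s = k s" if "s < S" for s
    unfolding k_def by (rule gain_harmonic[OF M that])
  have ksup: "mvec S (Pmat A Q \<sigma>) k s \<le> k s" if "policy_ok S A \<sigma>" "s < S" for \<sigma> s
  proof -
    have "mvec S (Pmat A Q \<sigma>) k s \<le> (\<Sum>a<A. \<sigma> s a * k s)"
      unfolding mvec_Pmat using that blackwell_gain_superharmonic[OF Q b that(2)]
      by (intro sum_mono mult_left_mono) (auto simp: policy_ok_def k_def)
    also have "\<dots> = k s" using that by (simp add: policy_ok_def flip: sum_distrib_right)
    finally show ?thesis .
  qed
  have ksup_pow: "mvec S (matpow S (Pmat A Q \<sigma>) t) k s \<le> k s"
    if \<sigma>: "policy_ok S A \<sigma>" and "s < S" for \<sigma> t s
    using that(2)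
  proof (induction t arbitrary: s)
    case 0
    then show ?case by (simp add: mvec_matpow_0)
  next
    case (Suc t)
    have "mvec S (matpow S (Pmat A Q \<sigma>) (Suc t)) k s \<le> mvec S (Pmat A Q \<sigma>) k s"
      unfolding mvec_matpow_Suc
      by (rule mvec_mono[OF stoch_substoch[OF stoch_Pmat[OF Q \<sigma>]] Suc.prems Suc.IH])
    also have "\<dots> \<le> k s" by (rule ksup[OF \<sigma> Suc.prems])
    finally show ?case .
  qed
  obtain C where C: "C \<subseteq> {..<S}" "\<And>s s'. s \<in> C \<Longrightarrow> s' \<in> C \<Longrightarrow> reachable S A Q s s'"
    "\<And>s \<sigma>. s < S \<Longrightarrow> s \<notin> C \<Longrightarrow> policy_ok S A \<sigma> \<Longrightarrow> transient_state S (Pmat A Q \<sigma>) s"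
    using wc unfolding weakly_communicating_def by blast
  have meets: "\<exists>s\<in>B. s \<in> C" if "B \<subseteq> {..<S}" "B \<noteq> {}"
    "\<And>s s'. s \<in> B \<Longrightarrow> s' < S \<Longrightarrow> 0 < ?M s s' \<Longrightarrow> s' \<in> B" for B
  proof -
    have "\<exists>s\<in>B. \<not> transient_state S ?M s"
      by (rule closed_set_recurrent[OF M that(1,2)]) (rule that(3))
    then obtain s where s: "s \<in> B" "\<not> transient_state S ?M s" by blast
    then have "s \<in> C" using C(3)[OF _ _ policy_ok_det[OF p]] that(1) by blast
    then show ?thesis using s by blast
  qed
  obtain hi where hi: "hi < S" "\<And>j. j < S \<Longrightarrow> k j \<le> k hi" using finite_argmax[OF S] by metis
  obtain lo where lo: "lo < S" "\<And>j. j < S \<Longrightarrow> k lo \<le> k j"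
    using finite_argmax[OF S, of "\<lambda>i. - k i"] by (metis neg_le_iff_le)
  have "\<exists>s\<in>{s. s < S \<and> k s = k lo}. s \<in> C"
  proof (rule meets)
    fix s s' assume s: "s \<in> {s. s < S \<and> k s = k lo}" "s' < S" "0 < ?M s s'"
    then show "s' \<in> {s. s < S \<and> k s = k lo}"
      using attained_min_spreads[of S ?M s k "k lo" s'] M lo(2) kM by simp
  qed (use lo in auto)
  then obtain s1 where s1: "s1 \<in> C" "s1 < S" "k s1 = k lo" by auto
  have "\<exists>s\<in>{s. s < S \<and> k s = k hi}. s \<in> C"
  proof (rule meets)
    fix s s' assume s: "s \<in> {s. s < S \<and> k s = k hi}" "s' < S" "0 < ?M s s'"
    then show "s' \<in> {s. s < S \<and> k s = k hi}"
      using attained_min_spreads[of S ?M s "\<lambda>i. - k i" "- k hi" s'] M hi(2) kM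
      by (simp add: mvec_minus)
  qed (use hi in auto)
  then obtain s2 where s2: "s2 \<in> C" "s2 < S" "k s2 = k hi" by auto
  obtain \<sigma> t where st: "policy_ok S A \<sigma>" "0 < matpow S (Pmat A Q \<sigma>) t s1 s2"
    using C(2)[OF s1(1) s2(1)] by (auto simp: reachable_def)
  \<comment> \<open>The \<open>t\<close>-step average from a minimiser is at most the minimum, so
    every state reached with positive probability is a minimiser.\<close>
  have "k s2 = k lo"
    using attained_min_spreads[OF stoch_matpow[OF stoch_Pmat[OF Q st(1)]] s1(2), of t k "k lo" s2]
      ksup_pow[OF st(1) s1(2), of t] lo(2) s1(3) s2(2) st(2) by simp
  then have "k s = k lo" if "s < S" for s
    using hi(2)[OF that] lo(2)[OF that] s2(3) by simp
  then show ?thesis using that[of "k lo"] by (simp add: k_def)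
qed

section \<open>Blackwell optimality in the anchored kernel\<close>

lemma Pmat_anchor:
  assumes "det_ok S A \<pi>" "s < S"
  shows "Pmat A (anchor \<eta> s0 Q) (det_pol \<pi>) s = anchor_mat \<eta> s0 (Pmat A Q (det_pol \<pi>)) s"
  using assms by (simp add: fun_eq_iff Pmat_det det_ok_def anchor_def anchor_mat_def)

lemma qexp_anchor:
  assumes "s0 < S"
  shows "qexp S (anchor \<eta> s0 Q) x s a = (1 - \<eta>) * qexp S Q x s a + \<eta> * x s0"
  using mvec_anchor_mat[OF assms, of \<eta> "\<lambda>s. Q s a" x s]
  by (simp add: qexp_def anchor_mat_def anchor_def mvec_def)

lemma stoch_kernel_anchor:
  assumes "stoch_kernel S A Q" "0 \<le> \<eta>" "\<eta> \<le> 1" "s0 < S"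
  shows "stoch_kernel S A (anchor \<eta> s0 Q)"
  unfolding stoch_kernel_def
proof (intro allI impI)
  fix a assume "a < A"
  then have "stoch S (anchor_mat \<eta> s0 (\<lambda>s. Q s a))"
    using assms by (intro stoch_anchor_mat) (auto simp: stoch_kernel_def)
  then show "stoch S (\<lambda>s. anchor \<eta> s0 Q s a)" by (simp add: stoch_def anchor_mat_def anchor_def)
qed

text \<open>Up to an additive constant the discounted anchored values are the values of the original
  kernel with discount \<open>\<gamma>' (1 - \<eta>)\<close>; let \<open>\<gamma>'\<close> tend to 1.\<close>

lemma blackwell_anchor_bellman:
  assumes Q: "stoch_kernel S A Q" and e: "0 < \<eta>" "\<eta> \<le> 1" and s0: "s0 < S"
    and b: "blackwell_opt S A (anchor \<eta> s0 Q) r \<pi>" and s: "s < S" and a: "a < A"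
  shows "r s a + (1 - \<eta>) * qexp S Q (pol_value S A Q r (1 - \<eta>) \<pi>) s a
    \<le> pol_value S A Q r (1 - \<eta>) \<pi> s"
proof -
  let ?Q = "anchor \<eta> s0 Q"
  define \<gamma> where "\<gamma> = 1 - \<eta>"
  define V where "V = pol_value S A Q r \<gamma> \<pi>"
  have Q': "stoch_kernel S A ?Q" using Q e s0 by (intro stoch_kernel_anchor) auto
  have p: "det_ok S A \<pi>" using b by (simp add: blackwell_opt_def)
  have g: "0 \<le> \<gamma>" "\<gamma> < 1" using e by (auto simp: \<gamma>_def)
  obtain \<gamma>0 where g0: "0 \<le> \<gamma>0" "\<gamma>0 < 1" and opt: "\<And>\<gamma> s a. \<gamma>0 \<le> \<gamma> \<Longrightarrow> \<gamma> < 1 \<Longrightarrow> s < S \<Longrightarrow> a < A \<Longrightarrow>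
    r s a + \<gamma> * qexp S ?Q (pol_value S A ?Q r \<gamma> \<pi>) s a \<le> pol_value S A ?Q r \<gamma> \<pi> s"
    using blackwell_bellman[OF Q' b] by metis
  define R where "R = (\<Sum>s<S. \<bar>r s (\<pi> s)\<bar>)"
  have R: "\<bar>r i (\<pi> i)\<bar> \<le> R" if "i < S" for i
    unfolding R_def using that by (auto intro: member_le_sum[where f="\<lambda>s. \<bar>r s (\<pi> s)\<bar>"])
  have R0: "0 \<le> R" using R[OF s] by linarith
  have "r s a + \<gamma> * qexp S Q V s a \<le> V s"
  proof (rule le_if_le_small)
    show "0 < 1 - \<gamma>0" using g0 by simp
    fix x :: real assume x: "0 < x" "x \<le> 1 - \<gamma>0"
    define \<gamma>' where "\<gamma>' = 1 - x"
    have g': "\<gamma>0 \<le> \<gamma>'" "0 \<le> \<gamma>'" "\<gamma>' < 1" using x g0 by (auto simp: \<gamma>'_def)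
    define \<beta> where "\<beta> = \<gamma>' * \<gamma>"
    have "\<gamma>' * \<gamma> \<le> 1 * \<gamma>" using g g' by (intro mult_right_mono) auto
    then have \<beta>: "0 \<le> \<beta>" "\<beta> < 1" "\<eta> \<le> 1 - \<beta>" using g g' e by (auto simp: \<beta>_def \<gamma>_def)
    define W where "W = pol_value S A ?Q r \<gamma>' \<pi>"
    \<comment> \<open>The solution of \<open>c = \<beta> * c + \<gamma>' * \<eta> * W s0\<close>:
      subtracting it from the anchored value absorbs the reset term and leaves a Bellman equation
      for \<open>Q\<close> with discount \<beta>.\<close>
    define c where "c = \<gamma>' * \<eta> * W s0 / (1 - \<beta>)"
    define U where "U = (\<lambda>i. W i - c)"
    have c: "c = \<beta> * c + \<gamma>' * \<eta> * W s0" using \<beta> by (simp add: c_def field_simps)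
    have qW: "\<gamma>' * qexp S ?Q W i a = \<beta> * qexp S Q U i a + c" if "i < S" "a < A" for i a
      unfolding qexp_anchor[OF s0] U_def qexp_diff qexp_const[OF Q that]
      using c by (simp add: \<beta>_def \<gamma>_def algebra_simps)
    have U: "U i = r i (\<pi> i) + \<beta> * qexp S Q U i (\<pi> i)" if "i < S" for i
      using pol_value_bellman[OF Q' p g'(2,3) that, of r] qW[OF that, of "\<pi> i"] p that
      unfolding W_def[symmetric] by (simp add: U_def det_ok_def)
    have Us: "r s a + \<beta> * qexp S Q U s a \<le> U s"
      using opt[OF g'(1,3) s a] qW[OF s a] unfolding W_def[symmetric] by (simp add: U_def)
    \<comment> \<open>Uniform in \<open>x\<close>, since \<open>1 - \<beta>\<close> is at least
      \<eta>.\<close>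
    have Ub: "\<bar>U i\<bar> \<le> R / \<eta>" if "i < S" for i
    proof -
      have "\<bar>U i\<bar> \<le> R / (1 - \<beta>)"
      proof (rule pol_max_principle_abs[OF Q p \<beta>(1,2) _ that])
        show "\<bar>U i - \<beta> * qexp S Q U i (\<pi> i)\<bar> \<le> R" if "i < S" for i
          using U[OF that] R[OF that] by simp
      qed
      also have "\<dots> \<le> R / \<eta>" using R0 e \<beta> by (intro divide_left_mono mult_pos_pos) auto
      finally show ?thesis .
    qed
    have qU: "\<bar>qexp S Q U i a\<bar> \<le> R / \<eta>" if "i < S" "a < A" for i a
      by (rule qexp_abs_le[OF Q that Ub])
    have UV: "\<bar>U i - V i\<bar> \<le> x * (R / \<eta>) / (1 - \<gamma>)" if "i < S" for i
    proof (rule pol_max_principle_abs[OF Q p g _ that, where x="\<lambda>i. U i - V i"])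
      fix i assume i: "i < S"
      have pi: "\<pi> i < A" using p i by (simp add: det_ok_def)
      have "U i - V i - \<gamma> * qexp S Q (\<lambda>i. U i - V i) i (\<pi> i) = - x * (\<gamma> * qexp S Q U i (\<pi> i))"
        using U[OF i] pol_value_bellman[OF Q p g i, of r] unfolding V_def[symmetric]
        by (simp add: qexp_diff \<beta>_def \<gamma>'_def algebra_simps)
      moreover have "\<bar>\<gamma> * qexp S Q U i (\<pi> i)\<bar> \<le> 1 * (R / \<eta>)"
        unfolding abs_mult using g qU[OF i pi] by (intro mult_mono) auto
      then have "x * \<bar>\<gamma> * qexp S Q U i (\<pi> i)\<bar> \<le> x * (R / \<eta>)"
        using x by (intro mult_left_mono) auto
      ultimately show "\<bar>U i - V i - \<gamma> * qexp S Q (\<lambda>i. U i - V i) i (\<pi> i)\<bar> \<le> x * (R / \<eta>)"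
        using x by (simp add: abs_mult)
    qed
    define D where "D = R / \<eta> / \<eta>"
    have UV': "\<bar>U i - V i\<bar> \<le> x * D" if "i < S" for i
      using UV[OF that] by (simp add: D_def \<gamma>_def)
    have D0: "0 \<le> D" using R0 e by (simp add: D_def)
    have "qexp S Q (\<lambda>i. V i - U i) s a \<le> x * D"
      using qexp_abs_le[OF Q s a, of "\<lambda>i. V i - U i" "x * D"] UV' by (simp add: abs_minus_commute)
    then have "\<gamma> * (qexp S Q V s a - qexp S Q U s a) \<le> 1 * (x * D)"
      using g x D0 by (intro order_trans[OF mult_left_mono mult_right_mono]) (auto simp: qexp_diff)
    moreover have "\<gamma> * qexp S Q U s a - \<beta> * qexp S Q U s a \<le> x * (R / \<eta>)"
    proof -
      have "\<gamma> * qexp S Q U s a - \<beta> * qexp S Q U s a = x * (\<gamma> * qexp S Q U s a)"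
        by (simp add: \<beta>_def \<gamma>'_def algebra_simps)
      also have "\<bar>\<gamma> * qexp S Q U s a\<bar> \<le> 1 * (R / \<eta>)"
        unfolding abs_mult using g qU[OF s a] by (intro mult_mono) auto
      then have "x * (\<gamma> * qexp S Q U s a) \<le> x * (R / \<eta>)" using x by (intro mult_left_mono) auto
      finally show ?thesis .
    qed
    ultimately show "r s a + \<gamma> * qexp S Q V s a \<le> V s + x * (2 * D + R / \<eta>)"
      using Us UV'[OF s] by (simp add: algebra_simps abs_le_iff)
  qed
  then show ?thesis by (simp add: V_def \<gamma>_def)
qed

section \<open>Error propagation along a fixed policy\<close>

lemma qexp_sq_dev:
  assumes "stoch_kernel S A Q" "s < S" "a < A"
  shows "qexp S Q (\<lambda>j. (x j - c)\<^sup>2) s a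
    = qexp S Q (\<lambda>j. (x j)\<^sup>2) s a - 2 * c * qexp S Q x s a + c\<^sup>2"
proof -
  have "qexp S Q (\<lambda>j. (x j - c)\<^sup>2) s a = qexp S Q (\<lambda>j. ((x j)\<^sup>2 - (2 * c) * x j) + c\<^sup>2) s a"
    by (rule qexp_cong) (simp add: power2_diff mult_ac)
  then show ?thesis unfolding qexp_add qexp_diff qexp_cmult qexp_const[OF assms] .
qed

lemma pol_value_nonneg:
  assumes Q: "stoch_kernel S A Q" and p: "det_ok S A \<pi>" and g: "0 \<le> \<gamma>" "\<gamma> < 1"
    and r: "\<And>s. s < S \<Longrightarrow> 0 \<le> r s (\<pi> s)" and s: "s < S"
  shows "0 \<le> pol_value S A Q r \<gamma> \<pi> s"
proof -
  have "- pol_value S A Q r \<gamma> \<pi> s \<le> 0 / (1 - \<gamma>)"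
  proof (rule pol_max_principle[OF Q p g _ _ s])
    fix i assume "i < S"
    then show "- pol_value S A Q r \<gamma> \<pi> i \<le> \<gamma> * qexp S Q (\<lambda>s. - pol_value S A Q r \<gamma> \<pi> s) i (\<pi> i) + 0"
      using pol_value_bellman[OF Q p g, of i r] r[of i] by (simp add: qexp_minus)
  qed simp
  then show ?thesis by simp
qed

lemma pol_value_le:
  assumes Q: "stoch_kernel S A Q" and p: "det_ok S A \<pi>" and g: "0 \<le> \<gamma>" "\<gamma> < 1" and c: "0 \<le> c"
    and r: "\<And>s. s < S \<Longrightarrow> r s (\<pi> s) \<le> c" and s: "s < S"
  shows "pol_value S A Q r \<gamma> \<pi> s \<le> c / (1 - \<gamma>)"
proof (rule pol_max_principle[OF Q p g c _ s])
  fix i assume "i < S"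
  then show "pol_value S A Q r \<gamma> \<pi> i \<le> \<gamma> * qexp S Q (pol_value S A Q r \<gamma> \<pi>) i (\<pi> i) + c"
    using pol_value_bellman[OF Q p g, of i r] r[of i] by simp
qed

text \<open>Bellman's equation turns the empirical second moment of \<open>V - \<mu>\<close> into
  \<open>\<gamma> P f\<^sup>2 - f\<^sup>2\<close> plus a constant, with \<open>f = V - min V\<close>. Thus \<open>4 \<kappa> f\<^sup>2\<close> is a
  Lyapunov function which absorbs the deviations along a trajectory; no variance has to be summed.\<close>

lemma value_error:
  fixes S A :: nat and Q Qh :: "nat \<Rightarrow> nat \<Rightarrow> nat \<Rightarrow> real"
    and r rh :: "nat \<Rightarrow> nat \<Rightarrow> real" and \<pi> :: "nat \<Rightarrow> nat" and \<gamma> \<xi> \<kappa> \<epsilon> :: real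
  defines "V \<equiv> pol_value S A Q r \<gamma> \<pi>" and "Vh \<equiv> pol_value S A Qh rh \<gamma> \<pi>"
  defines "H \<equiv> span S V"
  assumes Q: "stoch_kernel S A Q" and Qh: "stoch_kernel S A Qh" and p: "det_ok S A \<pi>"
    and g: "1 / 2 \<le> \<gamma>" "\<gamma> < 1"
    and r: "\<And>s. s < S \<Longrightarrow> 0 \<le> r s (\<pi> s) \<and> r s (\<pi> s) \<le> 1"
    and rh: "\<And>s. s < S \<Longrightarrow> \<bar>rh s (\<pi> s) - r s (\<pi> s)\<bar> \<le> \<xi>"
    and lam: "0 < \<kappa>" "\<kappa> * H \<le> 1 / 8" and eps: "0 \<le> \<epsilon>"
    and dev: "\<And>s. s < S \<Longrightarrow> \<kappa> * \<bar>qexp S Qh V s (\<pi> s) - qexp S Q V s (\<pi> s)\<bar>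
      \<le> \<kappa>\<^sup>2 * qexp S Qh (\<lambda>j. (V j - qexp S Q V s (\<pi> s))\<^sup>2) s (\<pi> s) + \<epsilon>"
    and s: "s < S"
  shows "\<bar>Vh s - V s\<bar> \<le> (\<xi> + 8 * \<kappa> * H + 8 * H * \<epsilon> + \<epsilon> / \<kappa>) / (1 - \<gamma>)"
proof -
  have g0: "0 \<le> \<gamma>" using g by simp
  have S0: "0 < S" using s by simp
  obtain m where m: "\<And>i. i < S \<Longrightarrow> m \<le> V i" "\<And>i. i < S \<Longrightarrow> V i \<le> m + H" "\<exists>i<S. m = V i"
    using span_range[OF S0, of V] unfolding H_def by metis
  have m0: "0 \<le> m" using m(3) pol_value_nonneg[OF Q p g0 g(2), of r] r unfolding V_def by auto
  have H0: "0 \<le> H" unfolding H_def by (rule span_nonneg[OF S0])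
  define f where "f = (\<lambda>i. V i - m)"
  have f: "0 \<le> f i" "f i \<le> H" if "i < S" for i using m that[THEN m(1)] that[THEN m(2)] by (auto simp: f_def)
  define K where "K = 8 * \<kappa> * H + 8 * H * \<epsilon> + \<epsilon> / \<kappa>"
  define d where "d i = qexp S Qh V i (\<pi> i) - qexp S Q V i (\<pi> i)" for i
  have key: "\<bar>d i\<bar> \<le> 4 * \<kappa> * (\<gamma> * qexp S Qh (\<lambda>j. (f j)\<^sup>2) i (\<pi> i) - (f i)\<^sup>2) + K" if i: "i < S" for i
  proof -
    have pi: "\<pi> i < A" using p i by (simp add: det_ok_def)
    define \<nu> where "\<nu> = qexp S Q f i (\<pi> i)"
    define w where "w = qexp S Qh (\<lambda>j. (f j - \<nu>)\<^sup>2) i (\<pi> i)"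
    have mu: "qexp S Q V i (\<pi> i) = \<nu> + m"
      by (simp add: \<nu>_def f_def qexp_diff qexp_const[OF Q i pi])
    have mh: "qexp S Qh f i (\<pi> i) = \<nu> + d i"
      by (simp add: f_def qexp_diff qexp_const[OF Qh i pi] d_def mu)
    have \<nu>: "0 \<le> \<nu>" "\<nu> \<le> H"
      using qexp_mono[OF Q i pi, of "\<lambda>_. 0" f] qexp_mono[OF Q i pi, of f "\<lambda>_. H"] f
      by (simp_all add: \<nu>_def qexp_const[OF Q i pi])
    have w0: "0 \<le> w"
      using qexp_mono[OF Qh i pi, of "\<lambda>_. 0" "\<lambda>j. (f j - \<nu>)\<^sup>2"]
      by (simp add: w_def qexp_const[OF Qh i pi])
    have "w = qexp S Qh (\<lambda>j. (V j - qexp S Q V i (\<pi> i))\<^sup>2) i (\<pi> i)"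
      unfolding w_def mu f_def by (simp add: algebra_simps)
    with dev[OF i] have "\<kappa> * \<bar>d i\<bar> \<le> \<kappa>\<^sup>2 * w + \<epsilon>" by (simp add: d_def)
    then have "\<kappa> * \<bar>d i\<bar> / \<kappa> \<le> (\<kappa>\<^sup>2 * w + \<epsilon>) / \<kappa>" using lam by (intro divide_right_mono) auto
    then have dw: "\<bar>d i\<bar> \<le> \<kappa> * w + \<epsilon> / \<kappa>" using lam by (simp add: power2_eq_square add_divide_distrib)
    have weq: "w = qexp S Qh (\<lambda>j. (f j)\<^sup>2) i (\<pi> i) - \<nu>\<^sup>2 - 2 * \<nu> * d i"
      unfolding w_def qexp_sq_dev[OF Qh i pi] mh by (simp add: power2_eq_square algebra_simps)
    \<comment> \<open>Shifting by the minimum leaves the constant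
      \<open>-(1 - \<gamma>) * m\<close>, which has a favourable sign because values are
      nonnegative. Hence one step lowers \<open>f\<close> by at most 1 on average.\<close>
    have "f i = r i (\<pi> i) - (1 - \<gamma>) * m + \<gamma> * \<nu>"
      using pol_value_bellman[OF Q p g0 g(2) i, of r] mu unfolding V_def[symmetric]
      by (simp add: f_def algebra_simps)
    moreover have "0 \<le> (1 - \<gamma>) * m" using g m0 by simp
    ultimately have fle: "f i - 1 \<le> \<gamma> * \<nu>" using r[OF i] by linarith
    have "(f i)\<^sup>2 - 2 * f i \<le> (\<gamma> * \<nu>)\<^sup>2"
    proof (cases "f i \<le> 1")
      case True
      have "f i * f i \<le> 2 * f i" using True f(1)[OF i] by (intro mult_right_mono) auto
      then show ?thesis by (simp add: power2_eq_square) (metis diff_le_0_iff_le order_trans zero_le_square)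
    next
      case False
      then have "(f i - 1)\<^sup>2 \<le> (\<gamma> * \<nu>)\<^sup>2" using fle by (intro power_mono) auto
      moreover have "(f i)\<^sup>2 - 2 * f i \<le> (f i - 1)\<^sup>2" by (simp add: power2_eq_square algebra_simps)
      ultimately show ?thesis by linarith
    qed
    \<comment> \<open>Only one factor \<gamma> is given up; the other matches the term
      \<open>\<gamma> * \<nu>\<^sup>2\<close> in the expansion of
      \<open>\<gamma> * w\<close>.\<close>
    also have "(\<gamma> * \<nu>)\<^sup>2 = \<gamma> * (\<gamma> * \<nu>\<^sup>2)" by (simp add: power2_eq_square)
    also have "\<dots> \<le> 1 * (\<gamma> * \<nu>\<^sup>2)" using g by (intro mult_right_mono) auto
    finally have q: "(f i)\<^sup>2 - 2 * H \<le> \<gamma> * \<nu>\<^sup>2" using f(2)[OF i] by linarith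
    have "- (\<gamma> * \<nu> * d i) \<le> \<bar>\<gamma> * \<nu> * d i\<bar>" by linarith
    also have "\<dots> = (\<gamma> * \<nu>) * \<bar>d i\<bar>" using g0 \<nu> by (simp add: abs_mult)
    also have "\<dots> \<le> (1 * H) * \<bar>d i\<bar>" using g g0 \<nu> by (intro mult_right_mono mult_mono) auto
    also have "\<dots> \<le> H * (\<kappa> * w + \<epsilon> / \<kappa>)" using dw H0 by (simp add: mult_left_mono)
    also have "\<dots> = (\<kappa> * H) * w + H * \<epsilon> / \<kappa>" by (simp add: algebra_simps)
    also have "\<dots> \<le> (1 / 8) * w + H * \<epsilon> / \<kappa>" using lam w0 by (intro add_right_mono mult_right_mono) auto
    finally have cross: "- (\<gamma> * \<nu> * d i) \<le> w / 8 + H * \<epsilon> / \<kappa>" by simp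
    \<comment> \<open>Twice the cross term consumes \<open>w / 4\<close> of this
      \<open>w / 2\<close>. The remaining quarter explains the factor 4 in
      \<open>4 * \<kappa> * f\<^sup>2\<close>.\<close>
    have "1 / 2 * w \<le> \<gamma> * w" using g w0 by (intro mult_right_mono) auto
    also have "\<gamma> * w = \<gamma> * qexp S Qh (\<lambda>j. (f j)\<^sup>2) i (\<pi> i) - \<gamma> * \<nu>\<^sup>2 - 2 * (\<gamma> * \<nu> * d i)"
      unfolding weq by (simp add: algebra_simps)
    finally have "w / 4 \<le> \<gamma> * qexp S Qh (\<lambda>j. (f j)\<^sup>2) i (\<pi> i) - (f i)\<^sup>2 + 2 * H + 2 * (H * \<epsilon> / \<kappa>)"
      using q cross by linarith
    then have "4 * \<kappa> * (w / 4) \<le> 4 * \<kappa> * (\<gamma> * qexp S Qh (\<lambda>j. (f j)\<^sup>2) i (\<pi> i) - (f i)\<^sup>2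
        + 2 * H + 2 * (H * \<epsilon> / \<kappa>))"
      using lam by (intro mult_left_mono) auto
    also have "\<dots> = 4 * \<kappa> * (\<gamma> * qexp S Qh (\<lambda>j. (f j)\<^sup>2) i (\<pi> i) - (f i)\<^sup>2) + 8 * \<kappa> * H + 8 * H * \<epsilon>"
      using lam by (simp add: field_simps)
    finally show ?thesis using dw by (simp add: K_def)
  qed
  have xi: "0 \<le> \<xi>" using rh[OF s] by linarith
  have K0: "0 \<le> K" using lam H0 eps by (simp add: K_def)
  have E: "Vh i - V i = (rh i (\<pi> i) - r i (\<pi> i)) + \<gamma> * qexp S Qh (\<lambda>i. Vh i - V i) i (\<pi> i) + \<gamma> * d i"
    if "i < S" for i
    using pol_value_bellman[OF Q p g0 g(2) that, of r] pol_value_bellman[OF Qh p g0 g(2) that, of rh]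
    unfolding V_def[symmetric] Vh_def[symmetric] by (simp add: qexp_diff d_def algebra_simps)
  have gd: "\<bar>\<gamma> * d i\<bar> \<le> \<bar>d i\<bar>" for i
    using g g0 by (simp add: abs_mult mult_left_le_one_le)
  \<comment> \<open>With the Lyapunov term added, \<open>key\<close> cancels the deviation
    \<open>d\<close> exactly up to \<open>K\<close>. The same works for the opposite sign, and the
    term is dropped at the end since it is nonnegative.\<close>
  have "(Vh s - V s) + 4 * \<kappa> * (f s)\<^sup>2 \<le> (\<xi> + K) / (1 - \<gamma>)"
  proof (rule pol_max_principle[OF Qh p g0 g(2) _ _ s])
    fix i assume i: "i < S"
    show "Vh i - V i + 4 * \<kappa> * (f i)\<^sup>2
      \<le> \<gamma> * qexp S Qh (\<lambda>i. (Vh i - V i) + 4 * \<kappa> * (f i)\<^sup>2) i (\<pi> i) + (\<xi> + K)"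
      unfolding qexp_add qexp_cmult
      using E[OF i] key[OF i] gd[of i] rh[OF i] by (simp add: algebra_simps abs_le_iff)
  qed (use xi K0 in simp)
  moreover have "- (Vh s - V s) + 4 * \<kappa> * (f s)\<^sup>2 \<le> (\<xi> + K) / (1 - \<gamma>)"
  proof (rule pol_max_principle[OF Qh p g0 g(2) _ _ s])
    fix i assume i: "i < S"
    show "- (Vh i - V i) + 4 * \<kappa> * (f i)\<^sup>2
      \<le> \<gamma> * qexp S Qh (\<lambda>i. - (Vh i - V i) + 4 * \<kappa> * (f i)\<^sup>2) i (\<pi> i) + (\<xi> + K)"
      unfolding qexp_add qexp_cmult qexp_minus
      using E[OF i] key[OF i] gd[of i] rh[OF i] by (simp add: algebra_simps abs_le_iff)
  qed (use xi K0 in simp)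
  moreover have "0 \<le> 4 * \<kappa> * (f s)\<^sup>2" using lam by simp
  ultimately show ?thesis by (simp add: K_def abs_le_iff add.assoc)
qed

section \<open>Bellman fixed points\<close>

text \<open>Mass may be lost: a pair whose action terminates has a zero row, and an empirical row is
  deficient when samples fall outside the states.\<close>

definition substoch_kernel :: "nat \<Rightarrow> nat \<Rightarrow> (nat \<Rightarrow> nat \<Rightarrow> nat \<Rightarrow> real) \<Rightarrow> bool" where
  "substoch_kernel S A K \<longleftrightarrow> (\<forall>a<A. substoch S (\<lambda>s. K s a))"

definition qval :: "nat \<Rightarrow> real \<Rightarrow> (nat \<Rightarrow> nat \<Rightarrow> real) \<Rightarrow> (nat \<Rightarrow> nat \<Rightarrow> nat \<Rightarrow> real)
    \<Rightarrow> (nat \<Rightarrow> real) \<Rightarrow> nat \<Rightarrow> nat \<Rightarrow> real" where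
  "qval S \<gamma> R K V s a = R s a + \<gamma> * qexp S K V s a"

definition bellman_fix :: "nat \<Rightarrow> nat \<Rightarrow> real \<Rightarrow> (nat \<Rightarrow> nat \<Rightarrow> real) \<Rightarrow> (nat \<Rightarrow> nat \<Rightarrow> nat \<Rightarrow> real)
    \<Rightarrow> (nat \<Rightarrow> real) \<Rightarrow> bool" where
  "bellman_fix S A \<gamma> R K V \<longleftrightarrow>
    (\<forall>s<S. (\<forall>a<A. qval S \<gamma> R K V s a \<le> V s) \<and> (\<exists>a<A. V s = qval S \<gamma> R K V s a))"

text \<open>The error is an alternative rather than a summand, so it does not accumulate to
  \<open>c / (1 - \<gamma>)\<close>: at a maximiser above \<open>c\<close> only the second
  alternative remains, and \<open>\<gamma> < 1\<close> refutes it.\<close>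

lemma max_principle_cap:
  assumes M: "substoch S M" and g: "0 \<le> \<gamma>" "\<gamma> < 1" and c: "0 \<le> c"
    and x: "\<And>i. i < S \<Longrightarrow> x i \<le> c \<or> x i \<le> \<gamma> * mvec S M x i"
    and i: "i < S"
  shows "x i \<le> c"
proof -
  obtain m where m: "m < S" "\<And>j. j < S \<Longrightarrow> x j \<le> x m"
    using finite_argmax[of S x] i by auto
  have "x m \<le> c"
  proof (rule ccontr)
    assume ne: "\<not> x m \<le> c"
    then have "x m \<le> \<gamma> * mvec S M x m" using x[OF m(1)] by blast
    also have "\<dots> \<le> \<gamma> * x m"
      using mvec_le_const[OF M m(1) m(2)] ne g c by (intro mult_left_mono) auto
    finally have "(1 - \<gamma>) * x m \<le> 0" by (simp add: algebra_simps)
    then show False using g c ne by (simp add: mult_le_0_iff)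
  qed
  then show ?thesis using m(2)[OF i] by linarith
qed

text \<open>Follow actions attaining \<open>V\<close>: there \<open>V'\<close> dominates its own
  action value, so differences of action values control the difference of the fixed points.\<close>

lemma bellman_fix_compare:
  assumes K: "substoch_kernel S A K" and g: "0 \<le> \<gamma>" "\<gamma> < 1" and c: "0 \<le> c"
    and V: "bellman_fix S A \<gamma> R K V" and V': "bellman_fix S A \<gamma> R' K' V'"
    and cmp: "\<And>s a. s < S \<Longrightarrow> a < A \<Longrightarrow>
      qval S \<gamma> R K V s a - qval S \<gamma> R' K' V' s a \<le> c \<or>
      qval S \<gamma> R K V s a - qval S \<gamma> R' K' V' s a \<le> \<gamma> * qexp S K (\<lambda>i. V i - V' i) s a"
    and s: "s < S"
  shows "V s - V' s \<le> c"
proof -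
  obtain f where f: "\<And>s. s < S \<Longrightarrow> f s < A \<and> V s = qval S \<gamma> R K V s (f s)"
    using V unfolding bellman_fix_def by metis
  show ?thesis
  proof (rule max_principle_cap[OF _ g c _ s, where M="\<lambda>i. K i (f i)"])
    show "substoch S (\<lambda>i. K i (f i))"
      using K f by (auto simp: substoch_kernel_def substoch_def)
    fix i assume i: "i < S"
    have "V i - V' i \<le> qval S \<gamma> R K V i (f i) - qval S \<gamma> R' K' V' i (f i)"
      using f[OF i] V' i unfolding bellman_fix_def by auto
    then show "V i - V' i \<le> c \<or> V i - V' i \<le> \<gamma> * mvec S (\<lambda>i. K i (f i)) (\<lambda>i. V i - V' i) i"
      using cmp[OF i, of "f i"] f[OF i] by (auto simp: qexp_def mvec_def)
  qed
qed

lemma bellman_fix_unique: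
  assumes K: "substoch_kernel S A K" and g: "0 \<le> \<gamma>" "\<gamma> < 1"
    and V: "bellman_fix S A \<gamma> R K V" and V': "bellman_fix S A \<gamma> R K V'" and s: "s < S"
  shows "V s = V' s"
proof (rule antisym)
  have "V s - V' s \<le> 0"
    by (rule bellman_fix_compare[OF K g _ V V' _ s]) (auto simp: qval_def qexp_diff algebra_simps)
  then show "V s \<le> V' s" by simp
  have "V' s - V s \<le> 0"
    by (rule bellman_fix_compare[OF K g _ V' V _ s]) (auto simp: qval_def qexp_diff algebra_simps)
  then show "V' s \<le> V s" by simp
qed

lemma qexp_substoch_abs_le:
  assumes "substoch_kernel S A K" "s < S" "a < A" "\<And>j. j < S \<Longrightarrow> \<bar>x j\<bar> \<le> c"
  shows "\<bar>qexp S K x s a\<bar> \<le> c"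
  unfolding qexp_def using assms by (intro mvec_abs_le) (auto simp: substoch_kernel_def)

section \<open>Separation of action values under a perturbation of one reward\<close>

text \<open>The raise \<open>t\<close> affects other states only after discounting, so the increase
  \<open>D\<close> of the optimal value is largest at \<open>s\<close>. The competing action gains
  at most a discounted \<open>D s\<close>, which leaves it behind by at least
  \<open>(1 - \<gamma>) * t\<close>.\<close>

lemma qval_gap_expands:
  assumes K: "substoch_kernel S A K" and g: "0 \<le> \<gamma>" "\<gamma> < 1"
    and V: "bellman_fix S A \<gamma> R K V" and V': "bellman_fix S A \<gamma> R' K V'"
    and R': "\<And>i b. i < S \<Longrightarrow> b < A \<Longrightarrow> R' i b = R i b + (if i = s \<and> b = a then t else 0)"
    and t: "0 \<le> t" and s: "s < S" and a: "a < A" "a' < A" "a' \<noteq> a"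
  shows "(1 - \<gamma>) * t \<le> (qval S \<gamma> R' K V' s a - qval S \<gamma> R' K V' s a')
    - (qval S \<gamma> R K V s a - qval S \<gamma> R K V s a')"
proof -
  define D where "D = (\<lambda>i. V' i - V i)"
  define q where "q = qexp S K D s"
  have dq: "qval S \<gamma> R' K V' i b - qval S \<gamma> R K V i b
      = \<gamma> * qexp S K D i b + (if i = s \<and> b = a then t else 0)" if "i < S" "b < A" for i b
    using R'[OF that] by (simp add: qval_def D_def qexp_diff algebra_simps)
  have D0: "0 \<le> D i" if "i < S" for i
  proof -
    have "V i - V' i \<le> 0"
    proof (rule bellman_fix_compare[OF K g _ V V' _ that])
      fix i b assume "i < S" "b < A"
      then show "qval S \<gamma> R K V i b - qval S \<gamma> R' K V' i b \<le> 0
        \<or> qval S \<gamma> R K V i b - qval S \<gamma> R' K V' i b \<le> \<gamma> * qexp S K (\<lambda>i. V i - V' i) i b"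
        using R' t by (auto simp: qval_def qexp_diff algebra_simps)
    qed simp
    then show ?thesis by (simp add: D_def)
  qed
  have Ds: "D i \<le> D s" if "i < S" for i
  proof -
    obtain f where f: "\<And>s. s < S \<Longrightarrow> f s < A \<and> V' s = qval S \<gamma> R' K V' s (f s)"
      using V' unfolding bellman_fix_def by metis
    show ?thesis
    proof (rule max_principle_cap[OF _ g D0[OF s] _ that, where M="\<lambda>i. K i (f i)"])
      show "substoch S (\<lambda>i. K i (f i))"
        using K f by (auto simp: substoch_kernel_def substoch_def)
      fix i assume i: "i < S"
      have "D i \<le> qval S \<gamma> R' K V' i (f i) - qval S \<gamma> R K V i (f i)"
        using f[OF i] V i unfolding bellman_fix_def D_def by auto
      then show "D i \<le> D s \<or> D i \<le> \<gamma> * mvec S (\<lambda>i. K i (f i)) D i"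
        using dq[OF i, of "f i"] f[OF i] by (cases "i = s") (auto simp: qexp_def mvec_def)
    qed
  qed
  have q: "0 \<le> q b" "q b \<le> D s" if "b < A" for b
  proof -
    have "mvec S (\<lambda>s. K s b) (\<lambda>_. 0) s \<le> q b"
      unfolding q_def qexp_def using K that s D0
      by (intro mvec_mono) (auto simp: substoch_kernel_def)
    then show "0 \<le> q b" by (simp add: mvec_def)
    show "q b \<le> D s"
      unfolding q_def qexp_def using K that s D0 Ds
      by (intro mvec_le_const) (auto simp: substoch_kernel_def)
  qed
  obtain b where b: "b < A" "V' s = qval S \<gamma> R' K V' s b"
    using V' s unfolding bellman_fix_def by blast
  have "D s \<le> qval S \<gamma> R' K V' s b - qval S \<gamma> R K V s b"
    using V s b unfolding bellman_fix_def D_def by auto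
  then have Db: "D s \<le> \<gamma> * q b + (if b = a then t else 0)" using dq[OF s b(1)] by (simp add: q_def)
  \<comment> \<open>If the raised action is chosen at \<open>s\<close> after the raise,
    \<open>D s\<close> is bounded by its increase. Otherwise
    \<open>D s \<le> \<gamma> * D s\<close>, and the optimal value has not changed at all.\<close>
  have "(1 - \<gamma>) * t \<le> (\<gamma> * q a + t) - \<gamma> * q a'"
  proof (cases "b = a")
    case True
    have "\<gamma> * q a' \<le> \<gamma> * (\<gamma> * q a + t)"
      using q(2)[OF a(2)] Db True g by (intro mult_left_mono) auto
    moreover have "\<gamma> * (\<gamma> * q a + t) \<le> \<gamma> * q a + \<gamma> * t"
      using g q(1)[OF a(1)] by (simp add: distrib_left mult_left_mono mult_left_le_one_le)
    ultimately show ?thesis by (simp add: algebra_simps)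
  next
    case False
    then have "D s \<le> \<gamma> * D s" using Db q(2)[OF b(1)] g by (simp add: mult_left_mono order_trans)
    then have "(1 - \<gamma>) * D s \<le> 0" by (simp add: algebra_simps)
    then have "D s \<le> 0" using g by (simp add: mult_le_0_iff)
    then have "q a' \<le> 0" using q(2)[OF a(2)] by simp
    then have "\<gamma> * q a' \<le> 0" using g by (simp add: mult_nonneg_nonpos)
    moreover have "0 \<le> \<gamma> * t" "0 \<le> \<gamma> * q a" using g t q(1)[OF a(1)] by auto
    ultimately show ?thesis by (simp add: algebra_simps)
  qed
  then show ?thesis using dq[OF s a(1)] dq[OF s a(2)] a(3) by (simp add: q_def)
qed

section \<open>Leaving one state-action pair out\<close>

text \<open>In the cut model, action \<open>a0\<close> in state \<open>s0\<close> ends the process with payoff \<open>u\<close>.\<close>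

definition cut_kernel :: "nat \<Rightarrow> nat \<Rightarrow> (nat \<Rightarrow> nat \<Rightarrow> nat \<Rightarrow> real) \<Rightarrow> nat \<Rightarrow> nat \<Rightarrow> nat \<Rightarrow> real" where
  "cut_kernel s0 a0 K s a s' = (if s = s0 \<and> a = a0 then 0 else K s a s')"

definition cut_reward :: "nat \<Rightarrow> nat \<Rightarrow> real \<Rightarrow> (nat \<Rightarrow> nat \<Rightarrow> real) \<Rightarrow> nat \<Rightarrow> nat \<Rightarrow> real" where
  "cut_reward s0 a0 u R s a = (if s = s0 \<and> a = a0 then u else R s a)"

lemma qval_cut: "qval S \<gamma> (cut_reward s0 a0 u R) (cut_kernel s0 a0 K) V s a
    = (if s = s0 \<and> a = a0 then u else qval S \<gamma> R K V s a)"
  by (auto simp: qval_def qexp_def mvec_def cut_kernel_def cut_reward_def)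

lemma substoch_cut_kernel:
  assumes "substoch_kernel S A K"
  shows "substoch_kernel S A (cut_kernel s0 a0 K)"
  unfolding substoch_kernel_def substoch_def
proof (intro allI impI)
  fix a i assume "a < A" "i < S"
  then show "(\<forall>j<S. 0 \<le> cut_kernel s0 a0 K i a j) \<and> (\<Sum>j<S. cut_kernel s0 a0 K i a j) \<le> 1"
    using assms by (cases "i = s0 \<and> a = a0") (auto simp: cut_kernel_def substoch_kernel_def substoch_def)
qed

text \<open>Cutting with the exact action value as payoff leaves the optimal value unchanged. What
  remains is a change of a terminal payoff, which propagates without amplification.\<close>

lemma qval_cut_close:
  assumes K: "substoch_kernel S A K" and g: "0 \<le> \<gamma>" "\<gamma> < 1"
    and V: "bellman_fix S A \<gamma> R K V"
    and U: "bellman_fix S A \<gamma> (cut_reward s0 a0 u R) (cut_kernel s0 a0 K) U"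
    and s: "s < S" and a: "a < A"
  shows "\<bar>qval S \<gamma> (cut_reward s0 a0 u R) (cut_kernel s0 a0 K) U s a - qval S \<gamma> R K V s a\<bar>
    \<le> \<bar>u - qval S \<gamma> R K V s0 a0\<bar>"
proof -
  let ?K = "cut_kernel s0 a0 K"
  define c where "c = \<bar>u - qval S \<gamma> R K V s0 a0\<bar>"
  define q where "q = qval S \<gamma> R K V s0 a0"
  have K': "substoch_kernel S A ?K" by (rule substoch_cut_kernel[OF K])
  have V': "bellman_fix S A \<gamma> (cut_reward s0 a0 q R) ?K V"
    using V unfolding bellman_fix_def qval_cut by (auto simp: q_def)
  have diff: "qval S \<gamma> (cut_reward s0 a0 u1 R) ?K V1 s a - qval S \<gamma> (cut_reward s0 a0 u2 R) ?K V2 s a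
      = (if s = s0 \<and> a = a0 then u1 - u2 else \<gamma> * qexp S ?K (\<lambda>i. V1 i - V2 i) s a)" for u1 u2 V1 V2 s a
    by (auto simp: qval_def qexp_def mvec_def cut_reward_def cut_kernel_def
        right_diff_distrib sum_subtractf)
  have "U i - V i \<le> c" if "i < S" for i
    by (rule bellman_fix_compare[OF K' g _ U V' _ that]) (auto simp: diff c_def q_def)
  moreover have "V i - U i \<le> c" if "i < S" for i
    by (rule bellman_fix_compare[OF K' g _ V' U _ that]) (auto simp: diff c_def q_def)
  ultimately have UV: "\<bar>U i - V i\<bar> \<le> c" if "i < S" for i using that by (simp add: abs_le_iff)
  have "\<bar>\<gamma> * qexp S ?K (\<lambda>i. U i - V i) s a\<bar> \<le> 1 * c"
    unfolding abs_mult using g qexp_substoch_abs_le[OF K' s a UV] by (intro mult_mono) auto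
  then have "\<bar>qval S \<gamma> (cut_reward s0 a0 u R) ?K U s a - qval S \<gamma> (cut_reward s0 a0 q R) ?K V s a\<bar> \<le> c"
    unfolding diff by (auto simp: c_def q_def)
  moreover have "qval S \<gamma> (cut_reward s0 a0 q R) ?K V s a = qval S \<gamma> R K V s a"
    by (simp add: qval_cut q_def)
  ultimately show ?thesis by (simp add: c_def)
qed

section \<open>Value iteration\<close>

definition opt_step :: "nat \<Rightarrow> nat \<Rightarrow> real \<Rightarrow> (nat \<Rightarrow> nat \<Rightarrow> real) \<Rightarrow> (nat \<Rightarrow> nat \<Rightarrow> nat \<Rightarrow> real)
    \<Rightarrow> (nat \<Rightarrow> real) \<Rightarrow> nat \<Rightarrow> real" where
  "opt_step S A \<gamma> R K V s = Max ((\<lambda>a. qval S \<gamma> R K V s a) ` {..<A})"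

primrec opt_iter :: "nat \<Rightarrow> nat \<Rightarrow> real \<Rightarrow> (nat \<Rightarrow> nat \<Rightarrow> real) \<Rightarrow> (nat \<Rightarrow> nat \<Rightarrow> nat \<Rightarrow> real)
    \<Rightarrow> nat \<Rightarrow> nat \<Rightarrow> real" where
  "opt_iter S A \<gamma> R K 0 = (\<lambda>_. 0)"
| "opt_iter S A \<gamma> R K (Suc k) = opt_step S A \<gamma> R K (opt_iter S A \<gamma> R K k)"

text \<open>Defined through explicit iterates rather than by a choice of fixed point, so that
  measurability in the random rewards passes to the limit.\<close>

definition opt_value :: "nat \<Rightarrow> nat \<Rightarrow> real \<Rightarrow> (nat \<Rightarrow> nat \<Rightarrow> real) \<Rightarrow> (nat \<Rightarrow> nat \<Rightarrow> nat \<Rightarrow> real)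
    \<Rightarrow> nat \<Rightarrow> real" where
  "opt_value S A \<gamma> R K s = lim (\<lambda>k. opt_iter S A \<gamma> R K k s)"

lemma opt_step_ge: "a < A \<Longrightarrow> qval S \<gamma> R K V s a \<le> opt_step S A \<gamma> R K V s"
  unfolding opt_step_def by (intro Max_ge) auto

lemma opt_step_attained:
  assumes "0 < A"
  obtains a where "a < A" "opt_step S A \<gamma> R K V s = qval S \<gamma> R K V s a"
proof -
  have "opt_step S A \<gamma> R K V s \<in> (\<lambda>a. qval S \<gamma> R K V s a) ` {..<A}"
    unfolding opt_step_def using assms by (intro Max_in) auto
  then show ?thesis using that by auto
qed

lemma opt_step_contraction:
  assumes K: "substoch_kernel S A K" and g: "0 \<le> \<gamma>" and A: "0 < A"
    and c: "\<And>j. j < S \<Longrightarrow> \<bar>V j - W j\<bar> \<le> c" and s: "s < S"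
  shows "\<bar>opt_step S A \<gamma> R K V s - opt_step S A \<gamma> R K W s\<bar> \<le> \<gamma> * c"
proof -
  have *: "opt_step S A \<gamma> R K V s - opt_step S A \<gamma> R K W s \<le> \<gamma> * c"
    if c: "\<And>j. j < S \<Longrightarrow> \<bar>V j - W j\<bar> \<le> c" for V W
  proof -
    obtain a where a: "a < A" "opt_step S A \<gamma> R K V s = qval S \<gamma> R K V s a"
      by (rule opt_step_attained[OF A])
    have "opt_step S A \<gamma> R K V s - opt_step S A \<gamma> R K W s \<le> \<gamma> * qexp S K (\<lambda>i. V i - W i) s a"
      using a(2) opt_step_ge[OF a(1), where S=S and V=W and s=s and R=R and K=K and \<gamma>=\<gamma>] by (simp add: qval_def qexp_diff algebra_simps)
    also have "\<bar>qexp S K (\<lambda>i. V i - W i) s a\<bar> \<le> c"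
      by (rule qexp_substoch_abs_le[OF K s a(1)]) (rule c)
    then have "\<gamma> * qexp S K (\<lambda>i. V i - W i) s a \<le> \<gamma> * c" using g by (intro mult_left_mono) auto
    finally show ?thesis .
  qed
  show ?thesis using *[of V W] *[of W V] c by (simp add: abs_le_iff abs_minus_commute)
qed

lemma opt_value_LIMSEQ:
  assumes K: "substoch_kernel S A K" and g: "0 \<le> \<gamma>" "\<gamma> < 1" and A: "0 < A" and s: "s < S"
  shows "(\<lambda>k. opt_iter S A \<gamma> R K k s) \<longlonglongrightarrow> opt_value S A \<gamma> R K s"
proof -
  let ?f = "opt_iter S A \<gamma> R K"
  define c where "c = (\<Sum>j<S. \<bar>?f 1 j\<bar>)"
  have step: "\<bar>?f (Suc k) j - ?f k j\<bar> \<le> \<gamma> ^ k * c" if "j < S" for k j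
    using that
  proof (induction k arbitrary: j)
    case 0
    have "\<bar>?f 1 j\<bar> \<le> c" unfolding c_def using 0 by (intro member_le_sum) auto
    then show ?case by simp
  next
    case (Suc k)
    show ?case
      using opt_step_contraction[OF K g(1) A Suc.IH Suc.prems, where R=R] by (simp add: mult_ac)
  qed
  have "summable (\<lambda>k. ?f (Suc k) s - ?f k s)"
  proof (rule summable_comparison_test')
    show "summable (\<lambda>k. \<gamma> ^ k * c)" using g by (intro summable_mult2 summable_geometric) auto
    show "norm (?f (Suc k) s - ?f k s) \<le> \<gamma> ^ k * c" if "k \<ge> 0" for k using step[OF s] by simp
  qed
  then have "convergent (\<lambda>n. \<Sum>k<n. ?f (Suc k) s - ?f k s)" by (simp add: summable_iff_convergent)
  then have "convergent (\<lambda>n. ?f n s)"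
    using sum_lessThan_telescope[of "\<lambda>k. ?f k s"] by (simp del: opt_iter.simps(2))
  then show ?thesis unfolding opt_value_def by (simp add: convergent_LIMSEQ_iff)
qed

lemma opt_value_fix:
  assumes K: "substoch_kernel S A K" and g: "0 \<le> \<gamma>" "\<gamma> < 1" and A: "0 < A"
  shows "bellman_fix S A \<gamma> R K (opt_value S A \<gamma> R K)"
proof -
  let ?f = "opt_iter S A \<gamma> R K" and ?V = "opt_value S A \<gamma> R K"
  have eq: "?V s = opt_step S A \<gamma> R K ?V s" if s: "s < S" for s
  proof -
    have lim: "(\<lambda>k. opt_step S A \<gamma> R K (?f k) s - opt_step S A \<gamma> R K ?V s) \<longlonglongrightarrow> 0"
    proof (rule Lim_null_comparison)
      show "(\<lambda>k. \<gamma> * (\<Sum>j<S. \<bar>?f k j - ?V j\<bar>)) \<longlonglongrightarrow> 0"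
      proof (rule tendsto_mult_right_zero, rule tendsto_null_sum)
        fix j assume "j \<in> {..<S}"
        then show "(\<lambda>k. \<bar>?f k j - ?V j\<bar>) \<longlonglongrightarrow> 0"
          using opt_value_LIMSEQ[OF K g A, where s=j and R=R] by (intro tendsto_rabs_zero) (simp add: LIM_zero)
      qed
      show "\<forall>\<^sub>F k in sequentially. norm (opt_step S A \<gamma> R K (?f k) s - opt_step S A \<gamma> R K ?V s)
          \<le> \<gamma> * (\<Sum>j<S. \<bar>?f k j - ?V j\<bar>)"
        unfolding real_norm_def
        by (intro always_eventually allI opt_step_contraction[OF K g(1) A _ s])
          (intro member_le_sum, auto)
    qed
    have "(\<lambda>k. opt_step S A \<gamma> R K (?f k) s) \<longlonglongrightarrow> ?V s"
      using LIMSEQ_Suc[OF opt_value_LIMSEQ[OF K g A s, where R=R]] by simp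
    then show ?thesis using LIM_zero_cancel[OF lim] by (rule LIMSEQ_unique)
  qed
  show ?thesis
    unfolding bellman_fix_def
  proof (intro allI impI conjI)
    fix s assume s: "s < S"
    show "qval S \<gamma> R K ?V s a \<le> ?V s" if "a < A" for a
      using opt_step_ge[OF that, where S=S and V="?V" and s=s and R=R and K=K and \<gamma>=\<gamma>] eq[OF s] by simp
    obtain a where "a < A" "opt_step S A \<gamma> R K ?V s = qval S \<gamma> R K ?V s a"
      by (rule opt_step_attained[OF A])
    then show "\<exists>a<A. ?V s = qval S \<gamma> R K ?V s a" using eq[OF s] by auto
  qed
qed

lemma opt_value_measurable:
  assumes K: "substoch_kernel S A K" and g: "0 \<le> \<gamma>" "\<gamma> < 1" and A: "0 < A" and s: "s < S"
    and R: "\<And>s a. s < S \<Longrightarrow> a < A \<Longrightarrow> (\<lambda>x. R x s a) \<in> borel_measurable M"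
  shows "(\<lambda>x. opt_value S A \<gamma> (R x) K s) \<in> borel_measurable M"
proof (rule borel_measurable_LIMSEQ_real)
  show "(\<lambda>k. opt_iter S A \<gamma> (R x) K k s) \<longlonglongrightarrow> opt_value S A \<gamma> (R x) K s" for x
    by (rule opt_value_LIMSEQ[OF K g A s])
  show "(\<lambda>x. opt_iter S A \<gamma> (R x) K k s) \<in> borel_measurable M" for k
    using s
  proof (induction k arbitrary: s)
    case (Suc k)
    then show ?case
      unfolding opt_iter.simps opt_step_def qval_def qexp_def mvec_def
      by (intro borel_measurable_Max borel_measurable_add borel_measurable_times borel_measurable_sum R) auto
  qed simp
qed

lemma qval_opt_value_measurable:
  assumes "substoch_kernel S A K" "0 \<le> \<gamma>" "\<gamma> < 1" "0 < A" "s < S" "a < A"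
    and "\<And>s a. s < S \<Longrightarrow> a < A \<Longrightarrow> (\<lambda>x. R x s a) \<in> borel_measurable M"
  shows "(\<lambda>x. qval S \<gamma> (R x) K (opt_value S A \<gamma> (R x) K) s a) \<in> borel_measurable M"
  unfolding qval_def qexp_def mvec_def using assms
  by (intro borel_measurable_add borel_measurable_times borel_measurable_sum
      opt_value_measurable[OF assms(1-4)]) auto

section \<open>Comparison of discounted values and gains\<close>

lemma pol_value_cong:
  assumes Q: "stoch_kernel S A Q" and p: "det_ok S A \<pi>" "det_ok S A \<pi>'" and g: "0 \<le> \<gamma>" "\<gamma> < 1"
    and eq: "\<And>s. s < S \<Longrightarrow> \<pi> s = \<pi>' s" and s: "s < S"
  shows "pol_value S A Q r \<gamma> \<pi> s = pol_value S A Q r \<gamma> \<pi>' s"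
  unfolding pol_value_def[of S A Q r \<gamma> \<pi>]
proof (rule disc_unique[OF stoch_Pmat[OF Q policy_ok_det[OF p(1)]] g _ s])
  fix i assume i: "i < S"
  have "\<pi> i < A" using p(1) i by (simp add: det_ok_def)
  then show "pol_value S A Q r \<gamma> \<pi>' i = rvec A r (det_pol \<pi>) i
      + \<gamma> * mvec S (Pmat A Q (det_pol \<pi>)) (pol_value S A Q r \<gamma> \<pi>') i"
    using pol_value_bellman[OF Q p(2) g i, of r] eq[OF i] by (simp add: rvec_det mvec_Pmat_det)
qed

text \<open>The gain of a policy is the Cesaro average of \<open>1 - \<gamma>\<close> times its
  discounted values. The bias of the policy, and hence its span, does not enter.\<close>

lemma gain_ge_disc:
  assumes Q: "stoch_kernel S A Q" and p: "det_ok S A \<pi>" and g: "0 \<le> \<gamma>" "\<gamma> < 1"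
    and c: "\<And>s. s < S \<Longrightarrow> c \<le> pol_value S A Q r \<gamma> \<pi> s" and s: "s < S"
  shows "(1 - \<gamma>) * c \<le> gain S (Pmat A Q (det_pol \<pi>)) (rvec A r (det_pol \<pi>)) s"
proof -
  let ?M = "Pmat A Q (det_pol \<pi>)" and ?v = "rvec A r (det_pol \<pi>)"
  have M: "stoch S ?M" by (rule stoch_Pmat[OF Q policy_ok_det[OF p]])
  have "gain S ?M ?v s = (1 - \<gamma>) * gain S ?M (disc_value S ?M ?v \<gamma>) s"
    by (rule gain_resolvent[OF M disc_bellman[OF M g] s])
  moreover have "c \<le> gain S ?M (disc_value S ?M ?v \<gamma>) s"
    using c by (intro gain_ge[OF M s]) (simp add: pol_value_def)
  ultimately show ?thesis using g by (simp add: mult_left_mono)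
qed

text \<open>The Poisson solution may be shifted: centring the bias at the midpoint of its range
  halves the sup norm, which pays for the factor 2 of \<open>disc_abel\<close>.\<close>

lemma disc_near_gain:
  assumes Q: "stoch_kernel S A Q" and p: "det_ok S A \<pi>" and g: "0 \<le> \<gamma>" "\<gamma> < 1" and s: "s < S"
  shows "\<bar>pol_value S A Q r \<gamma> \<pi> s - gain S (Pmat A Q (det_pol \<pi>)) (rvec A r (det_pol \<pi>)) s / (1 - \<gamma>)\<bar>
    \<le> span S (bias S (Pmat A Q (det_pol \<pi>)) (rvec A r (det_pol \<pi>)))"
proof -
  let ?M = "Pmat A Q (det_pol \<pi>)" and ?v = "rvec A r (det_pol \<pi>)"
  let ?h = "bias S ?M ?v"
  have M: "stoch S ?M" by (rule stoch_Pmat[OF Q policy_ok_det[OF p]])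
  have S: "0 < S" using s by simp
  obtain m where m: "\<And>i. i < S \<Longrightarrow> m \<le> ?h i" "\<And>i. i < S \<Longrightarrow> ?h i \<le> m + span S ?h"
    using span_range[OF S, of ?h] by metis
  define c where "c = m + span S ?h / 2"
  interpret d: decomposed S ?M ?v "gain S ?M ?v" ?h by (rule gain_bias_decomposed[OF M])
  interpret d': decomposed S ?M ?v "gain S ?M ?v" "\<lambda>i. ?h i - c"
  proof
    fix i assume i: "i < S"
    show "?v i = gain S ?M ?v i + (?h i - c - mvec S ?M (\<lambda>i. ?h i - c) i)"
      using d.v[OF i] by (simp add: mvec_diff mvec_const[OF M i])
  qed (fact M, fact d.harm)
  have "\<bar>?h j - c\<bar> \<le> span S ?h / 2" if "j < S" for j
    using m(1)[OF that] m(2)[OF that] unfolding c_def by (simp add: abs_le_iff field_simps)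
  from d'.disc_abel[OF g s this] show ?thesis by (simp add: pol_value_def)
qed

lemma pol_value_le_bellman:
  assumes Q: "stoch_kernel S A Q" and p: "det_ok S A \<pi>" and g: "0 \<le> \<gamma>" "\<gamma> < 1"
    and W: "\<And>s a. s < S \<Longrightarrow> a < A \<Longrightarrow> r s a + \<gamma> * qexp S Q W s a \<le> W s" and s: "s < S"
  shows "pol_value S A Q r \<gamma> \<pi> s \<le> W s"
proof -
  have "pol_value S A Q r \<gamma> \<pi> s - W s \<le> 0 / (1 - \<gamma>)"
  proof (rule pol_max_principle[OF Q p g _ _ s, where x="\<lambda>i. pol_value S A Q r \<gamma> \<pi> i - W i"])
    fix i assume i: "i < S"
    have "\<pi> i < A" using p i by (simp add: det_ok_def)
    then show "pol_value S A Q r \<gamma> \<pi> i - W i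
        \<le> \<gamma> * qexp S Q (\<lambda>i. pol_value S A Q r \<gamma> \<pi> i - W i) i (\<pi> i) + 0"
      using pol_value_bellman[OF Q p g i, of r] W[OF i, of "\<pi> i"] by (simp add: qexp_diff algebra_simps)
  qed simp
  then show ?thesis by simp
qed

section \<open>Sections of product measures\<close>

lemma emeasure_PiM_insert_le:
  assumes M: "\<And>i. prob_space (M i)" and I: "finite I" "i \<notin> I"
    and B: "B \<in> sets (PiM (insert i I) M)"
    and le: "\<And>x. x \<in> space (PiM I M) \<Longrightarrow> emeasure (M i) {y\<in>space (M i). x(i := y) \<in> B} \<le> e"
  shows "emeasure (PiM (insert i I) M) B \<le> e"
proof -
  interpret product_prob_space M I by (simp add: product_prob_spaceI M)
  have "emeasure (PiM (insert i I) M) B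
      = (\<integral>\<^sup>+ x. (\<integral>\<^sup>+ y. indicator B (x(i := y)) \<partial>M i) \<partial>PiM I M)"
    using B I by (subst product_nn_integral_insert[symmetric]) auto
  also have "\<dots> \<le> (\<integral>\<^sup>+ x. e \<partial>PiM I M)"
  proof (rule nn_integral_mono)
    fix x assume x: "x \<in> space (PiM I M)"
    have m: "{y\<in>space (M i). x(i := y) \<in> B} \<in> sets (M i)"
      using measurable_sets[OF measurable_component_update[OF x I(2)] B]
      by (simp add: vimage_def Int_def conj_commute)
    have "(\<integral>\<^sup>+ y. indicator B (x(i := y)) \<partial>M i)
        = (\<integral>\<^sup>+ y. indicator {y\<in>space (M i). x(i := y) \<in> B} y \<partial>M i)"
      by (intro nn_integral_cong) (auto simp: indicator_def)
    also have "\<dots> = emeasure (M i) {y\<in>space (M i). x(i := y) \<in> B}"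
      by (rule nn_integral_indicator[OF m])
    finally show "(\<integral>\<^sup>+ y. indicator B (x(i := y)) \<partial>M i) \<le> e" using le[OF x] by simp
  qed
  also have "\<dots> = e"
    using prob_space.emeasure_space_1[OF prob_space_PiM[OF M], of I] by simp
  finally show ?thesis .
qed

lemma emeasure_PiM_merge_le:
  assumes M: "\<And>i. prob_space (M i)" and IJ: "finite I" "finite J" "I \<inter> J = {}"
    and B: "B \<in> sets (PiM (I \<union> J) M)"
    and le: "\<And>x. x \<in> space (PiM I M) \<Longrightarrow>
      emeasure (PiM J M) {y\<in>space (PiM J M). merge I J (x, y) \<in> B} \<le> e"
  shows "emeasure (PiM (I \<union> J) M) B \<le> e"
proof -
  interpret product_prob_space M I by (simp add: product_prob_spaceI M)
  have "emeasure (PiM (I \<union> J) M) B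
      = (\<integral>\<^sup>+ x. (\<integral>\<^sup>+ y. indicator B (merge I J (x, y)) \<partial>PiM J M) \<partial>PiM I M)"
    using B IJ by (subst product_nn_integral_fold[symmetric]) auto
  also have "\<dots> \<le> (\<integral>\<^sup>+ x. e \<partial>PiM I M)"
  proof (rule nn_integral_mono)
    fix x assume x: "x \<in> space (PiM I M)"
    have m: "{y\<in>space (PiM J M). merge I J (x, y) \<in> B} \<in> sets (PiM J M)"
      using measurable_sets[OF measurable_compose[OF measurable_Pair1'[OF x] measurable_merge] B]
      by (simp add: vimage_def Int_def conj_commute)
    have "(\<integral>\<^sup>+ y. indicator B (merge I J (x, y)) \<partial>PiM J M)
        = (\<integral>\<^sup>+ y. indicator {y\<in>space (PiM J M). merge I J (x, y) \<in> B} y \<partial>PiM J M)"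
      by (intro nn_integral_cong) (auto simp: indicator_def)
    also have "\<dots> = emeasure (PiM J M) {y\<in>space (PiM J M). merge I J (x, y) \<in> B}"
      by (rule nn_integral_indicator[OF m])
    finally show "(\<integral>\<^sup>+ y. indicator B (merge I J (x, y)) \<partial>PiM J M) \<le> e" using le[OF x] by simp
  qed
  also have "\<dots> = e"
    using prob_space.emeasure_space_1[OF prob_space_PiM[OF M], of I] by simp
  finally show ?thesis .
qed

lemma emeasure_pair_section1_le:
  assumes "prob_space M1" "prob_space M2" and B: "B \<in> sets (M1 \<Otimes>\<^sub>M M2)"
    and le: "\<And>x. x \<in> space M1 \<Longrightarrow> emeasure M2 (Pair x -` B) \<le> e"
  shows "emeasure (M1 \<Otimes>\<^sub>M M2) B \<le> e"
proof -
  interpret M1: prob_space M1 by fact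
  interpret M2: prob_space M2 by fact
  have "emeasure (M1 \<Otimes>\<^sub>M M2) B = (\<integral>\<^sup>+ x. emeasure M2 (Pair x -` B) \<partial>M1)"
    by (rule M2.emeasure_pair_measure_alt[OF B])
  also have "\<dots> \<le> (\<integral>\<^sup>+ x. e \<partial>M1)" by (rule nn_integral_mono) (rule le)
  finally show ?thesis by (simp add: M1.emeasure_space_1)
qed

lemma emeasure_pair_section2_le:
  assumes "prob_space M1" "prob_space M2" and B: "B \<in> sets (M1 \<Otimes>\<^sub>M M2)"
    and le: "\<And>y. y \<in> space M2 \<Longrightarrow> emeasure M1 ((\<lambda>x. (x, y)) -` B) \<le> e"
  shows "emeasure (M1 \<Otimes>\<^sub>M M2) B \<le> e"
proof -
  interpret M1: prob_space M1 by fact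
  interpret M2: prob_space M2 by fact
  interpret P: pair_prob_space M1 M2 ..
  have "emeasure (M1 \<Otimes>\<^sub>M M2) B = (\<integral>\<^sup>+ y. emeasure M1 ((\<lambda>x. (x, y)) -` B) \<partial>M2)"
    by (rule P.emeasure_pair_measure_alt2[OF B])
  also have "\<dots> \<le> (\<integral>\<^sup>+ y. e \<partial>M2)" by (rule nn_integral_mono) (rule le)
  finally show ?thesis by (simp add: M2.emeasure_space_1)
qed

lemma measure_UN_le_card:
  assumes "prob_space M" "finite I" "\<And>i. i \<in> I \<Longrightarrow> B i \<in> sets M"
    "\<And>i. i \<in> I \<Longrightarrow> emeasure M (B i) \<le> ennreal e" "0 \<le> e"
  shows "measure M (\<Union>i\<in>I. B i) \<le> real (card I) * e"
proof -
  interpret prob_space M by fact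
  have "measure M (\<Union>i\<in>I. B i) \<le> (\<Sum>i\<in>I. measure M (B i))"
    using assms by (intro measure_UNION_le) auto
  also have "\<dots> \<le> (\<Sum>i\<in>I. e)"
    using assms(4,5) by (intro sum_mono) (simp add: emeasure_eq_measure)
  finally show ?thesis by simp
qed

section \<open>A self-normalised exponential inequality\<close>

text \<open>For centred \<open>y\<close> it gives \<open>exp (y - y\<^sup>2)\<close> mean at most 1,
  with the compensator \<open>y\<^sup>2\<close> observed instead of a variance. On the negative side
  the derivative of \<open>ln (1 + x) - x + x\<^sup>2\<close> is
  \<open>x (1 + 2x) / (1 + x)\<close>, whose sign changes at \<open>-1/2\<close>.\<close>

lemma exp_diff_square_le:
  fixes y :: real
  assumes "\<bar>y\<bar> \<le> 1 / 2"
  shows "exp (y - y\<^sup>2) \<le> 1 + y"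
proof -
  have "y - y\<^sup>2 \<le> ln (1 + y)"
  proof (cases "0 \<le> y")
    case True
    then show ?thesis using assms by (intro ln_one_plus_pos_lower_bound) auto
  next
    case False
    define g where "g = (\<lambda>x::real. ln (1 + x) - x + x\<^sup>2)"
    have "g 0 \<le> g y"
    proof (rule DERIV_nonpos_imp_nonincreasing[where f=g])
      show "y \<le> 0" using False by simp
      fix x assume x: "y \<le> x" "x \<le> 0"
      then have "0 < 1 + x" using assms by (simp add: abs_le_iff)
      then have "(g has_real_derivative (1 / (1 + x) - 1 + 2 * x)) (at x)"
        unfolding g_def by (auto intro!: derivative_eq_intros)
      moreover have "1 / (1 + x) - 1 + 2 * x = x * (1 + 2 * x) / (1 + x)"
        using \<open>0 < 1 + x\<close> by (simp add: field_simps)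
      moreover have "x * (1 + 2 * x) / (1 + x) \<le> 0"
        using x assms \<open>0 < 1 + x\<close> by (intro divide_nonpos_pos mult_nonpos_nonneg) (auto simp: abs_le_iff)
      ultimately show "\<exists>d. (g has_real_derivative d) (at x) \<and> d \<le> 0" by auto
    qed
    then show ?thesis by (simp add: g_def)
  qed
  then have "exp (y - y\<^sup>2) \<le> exp (ln (1 + y))" by simp
  then show ?thesis using assms by (simp add: abs_le_iff)
qed

text \<open>Markov's inequality for the product of the exponentials, whose integral
  factorises.\<close>

lemma chernoff_PiM:
  assumes M: "\<And>i. prob_space (M i)" and J: "finite J"
    and g: "\<And>j. j \<in> J \<Longrightarrow> g j \<in> borel_measurable (M j)"
    and mgf: "\<And>j. j \<in> J \<Longrightarrow> (\<integral>\<^sup>+ x. ennreal (exp (g j x)) \<partial>M j) \<le> 1"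
  shows "emeasure (PiM J M) {z\<in>space (PiM J M). l \<le> (\<Sum>j\<in>J. g j (z j))} \<le> ennreal (exp (- l))"
proof -
  interpret product_prob_space M J by (simp add: product_prob_spaceI M)
  let ?u = "\<lambda>z. \<Prod>j\<in>J. ennreal (exp (g j (z j)))"
  have u: "?u \<in> borel_measurable (PiM J M)"
    using g by measurable
  have "{z\<in>space (PiM J M). l \<le> (\<Sum>j\<in>J. g j (z j))}
      = {z\<in>space (PiM J M). 1 \<le> ennreal (exp (- l)) * ?u z}"
    using J by (simp add: prod_ennreal exp_sum[symmetric] ennreal_mult[symmetric] exp_add[symmetric])
  also have "emeasure (PiM J M) \<dots>
      \<le> ennreal (exp (- l)) * (\<integral>\<^sup>+ z. ?u z * indicator (space (PiM J M)) z \<partial>PiM J M)"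
    using u by (intro nn_integral_Markov_inequality) auto
  also have "(\<integral>\<^sup>+ z. ?u z * indicator (space (PiM J M)) z \<partial>PiM J M) = (\<integral>\<^sup>+ z. ?u z \<partial>PiM J M)"
    by (intro nn_integral_cong) simp
  also have "\<dots> = (\<Prod>j\<in>J. \<integral>\<^sup>+ x. ennreal (exp (g j x)) \<partial>M j)"
    using J g by (intro product_nn_integral_prod) auto
  also have "ennreal (exp (- l)) * \<dots> \<le> ennreal (exp (- l)) * 1"
    using mgf by (intro mult_left_mono prod_le_1) auto
  finally show ?thesis by simp
qed

lemma pmf_mgf_le_1:
  fixes p :: "'a pmf" and f :: "'a \<Rightarrow> real"
  assumes fin: "finite (set_pmf p)"
    and b: "\<And>x. x \<in> set_pmf p \<Longrightarrow> \<bar>\<kappa> * (f x - measure_pmf.expectation p f)\<bar> \<le> 1 / 2"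
  shows "(\<integral>\<^sup>+ x. ennreal (exp (\<kappa> * (f x - measure_pmf.expectation p f)
    - (\<kappa> * (f x - measure_pmf.expectation p f))\<^sup>2)) \<partial>measure_pmf p) \<le> 1"
proof -
  let ?m = "measure_pmf.expectation p f"
  have i: "integrable (measure_pmf p) h" for h :: "'a \<Rightarrow> real"
    by (rule integrable_measure_pmf_finite[OF fin])
  have "(\<integral>\<^sup>+ x. ennreal (exp (\<kappa> * (f x - ?m) - (\<kappa> * (f x - ?m))\<^sup>2)) \<partial>measure_pmf p)
      \<le> (\<integral>\<^sup>+ x. ennreal (1 + \<kappa> * (f x - ?m)) \<partial>measure_pmf p)"
    using b by (intro nn_integral_mono_AE) (auto simp: AE_measure_pmf_iff intro!: ennreal_leI exp_diff_square_le)
  also have "\<dots> = ennreal (\<integral>x. 1 + \<kappa> * (f x - ?m) \<partial>measure_pmf p)"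
    using b by (intro nn_integral_eq_integral i) (fastforce simp: AE_measure_pmf_iff abs_le_iff)
  also have "(\<integral>x. 1 + \<kappa> * (f x - ?m) \<partial>measure_pmf p) = 1"
    by (simp add: i)
  finally show ?thesis by simp
qed

section \<open>The samples\<close>

definition smp_measure :: "nat \<Rightarrow> nat \<Rightarrow> (nat \<Rightarrow> nat \<Rightarrow> nat pmf) \<Rightarrow> nat \<Rightarrow> (nat \<times> nat \<times> nat \<Rightarrow> nat) measure" where
  "smp_measure S A P n = PiM ({..<S} \<times> {..<A} \<times> {..<n}) (\<lambda>(s, a, i). measure_pmf (P s a))"

text \<open>Finitely many discrete coordinates make every set of samples an event, however a policy
  is selected from the samples.\<close>

lemma sets_PiM_pmf:
  fixes P :: "'a \<Rightarrow> nat pmf"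
  assumes "finite I"
  shows "sets (PiM I (\<lambda>j. measure_pmf (P j))) = Pow (PiE I (\<lambda>_. UNIV))"
proof -
  have "sets (PiM I (\<lambda>j. measure_pmf (P j))) = sets (PiM I (\<lambda>j. count_space (UNIV :: nat set)))"
    by (rule sets_PiM_cong) auto
  also have "\<dots> = Pow (PiE I (\<lambda>_. UNIV))"
    by (subst count_space_PiM_finite[OF assms]) auto
  finally show ?thesis .
qed

lemma smp_measure_alt:
  "smp_measure S A P n = PiM ({..<S} \<times> {..<A} \<times> {..<n}) (\<lambda>j. measure_pmf (case j of (s, a, i) \<Rightarrow> P s a))"
  unfolding smp_measure_def by (intro arg_cong2[where f=PiM] refl ext) (simp add: split_beta)

lemma sets_smp_measure: "sets (smp_measure S A P n) = Pow (PiE ({..<S} \<times> {..<A} \<times> {..<n}) (\<lambda>_. UNIV))"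
  unfolding smp_measure_alt by (rule sets_PiM_pmf) simp

lemma space_smp_measure: "space (smp_measure S A P n) = PiE ({..<S} \<times> {..<A} \<times> {..<n}) (\<lambda>_. UNIV)"
  by (simp add: smp_measure_alt space_PiM)

lemma prob_space_smp_measure: "prob_space (smp_measure S A P n)"
  unfolding smp_measure_alt by (intro prob_space_PiM prob_space_measure_pmf)

text \<open>The tested function may depend on the data through a label which is determined by the
  samples of the other state-action pairs.\<close>

lemma leave_out_deviation:
  fixes \<kappa> :: "'p \<Rightarrow> real" and f :: "'p \<Rightarrow> nat \<Rightarrow> real" and sel :: "'p \<Rightarrow> (nat \<times> nat \<times> nat \<Rightarrow> nat) \<Rightarrow> bool"
  assumes s: "s < S" and a: "a < A" and fin: "finite (set_pmf (P s a))"
    and uniq: "\<And>x p p'. p \<in> F \<Longrightarrow> p' \<in> F \<Longrightarrow> sel p x \<Longrightarrow> sel p' x \<Longrightarrow> p = p'"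
    and dep: "\<And>x x' p. (\<And>s' a' i. (s', a') \<noteq> (s, a) \<Longrightarrow> s' < S \<Longrightarrow> a' < A \<Longrightarrow> i < n \<Longrightarrow>
      x (s', a', i) = x' (s', a', i)) \<Longrightarrow> p \<in> F \<Longrightarrow> sel p x = sel p x'"
    and m: "\<And>p. p \<in> F \<Longrightarrow> m p = measure_pmf.expectation (P s a) (f p)"
    and b: "\<And>p y. p \<in> F \<Longrightarrow> y \<in> set_pmf (P s a) \<Longrightarrow> \<bar>\<kappa> p * (f p y - m p)\<bar> \<le> 1 / 2"
  shows "emeasure (smp_measure S A P n) {x\<in>space (smp_measure S A P n). \<exists>p\<in>F. sel p x \<and>
    l \<le> (\<Sum>i<n. \<kappa> p * (f p (x (s, a, i)) - m p) - (\<kappa> p * (f p (x (s, a, i)) - m p))\<^sup>2)} \<le> ennreal (exp (- l))"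
    (is "emeasure ?M ?B \<le> _")
proof -
  let ?N = "\<lambda>j. measure_pmf (case j of (s, a, i) \<Rightarrow> P s a)"
  let ?J = "{s} \<times> {a} \<times> {..<n}"
  define I where "I = ({..<S} \<times> {..<A} \<times> {..<n}) - ?J"
  have un: "I \<union> ?J = {..<S} \<times> {..<A} \<times> {..<n}" using s a by (auto simp: I_def)
  have M: "?M = PiM (I \<union> ?J) ?N" unfolding un by (rule smp_measure_alt)
  define g where "g p y = \<kappa> p * (f p y - m p) - (\<kappa> p * (f p y - m p))\<^sup>2" for p y
  have "emeasure (PiM (I \<union> ?J) ?N) ?B \<le> ennreal (exp (- l))"
  proof (rule emeasure_PiM_merge_le)
    show "?B \<in> sets (PiM (I \<union> ?J) ?N)"
      unfolding M[symmetric] sets_smp_measure space_smp_measure by auto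
    fix x assume x: "x \<in> space (PiM I ?N)"
    let ?mg = "\<lambda>z. merge I ?J (x, z)"
    let ?C = "{z\<in>space (PiM ?J ?N). ?mg z \<in> ?B}"
    have sums: "(\<Sum>i<n. g p (?mg z (s, a, i))) = (\<Sum>j\<in>?J. g p (z j))" for p z
    proof -
      have "(\<Sum>j\<in>?J. g p (z j)) = (\<Sum>i<n. g p (z (s, a, i)))"
        by (rule sum.reindex_bij_witness[where j="\<lambda>(_, _, i). i" and i="\<lambda>i. (s, a, i)"]) auto
      then show ?thesis by (simp add: merge_def I_def)
    qed
    have selx: "sel p (?mg z) = sel p x" if "p \<in> F" for p z
      by (rule dep[OF _ that]) (auto simp: merge_def I_def)
    show "emeasure (PiM ?J ?N) ?C \<le> ennreal (exp (- l))"
    proof (cases "\<exists>p\<in>F. sel p x")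
      case False
      then have "\<not> sel p (?mg z)" if "p \<in> F" for p z using selx[OF that] that by blast
      then have C: "?C = {}" by blast
      show ?thesis unfolding C by simp
    next
      case True
      then obtain p where p: "p \<in> F" "sel p x" by auto
      have "?C \<subseteq> {z\<in>space (PiM ?J ?N). l \<le> (\<Sum>j\<in>?J. g p (z j))}"
      proof
        fix z assume z: "z \<in> ?C"
        then obtain p' where p': "p' \<in> F" "sel p' (?mg z)" "l \<le> (\<Sum>i<n. g p' (?mg z (s, a, i)))"
          by (auto simp: g_def)
        \<comment> \<open>With the other samples frozen, the label is a constant. The existential
          over \<open>F\<close> thus concerns a single test function and costs no union
          bound.\<close>
        then have "p' = p" using uniq[OF p'(1) p(1)] p(2) selx[OF p'(1)] by blast
        then show "z \<in> {z\<in>space (PiM ?J ?N). l \<le> (\<Sum>j\<in>?J. g p (z j))}"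
          using z p'(3) unfolding sums by auto
      qed
      moreover have "{z\<in>space (PiM ?J ?N). l \<le> (\<Sum>j\<in>?J. g p (z j))} \<in> sets (PiM ?J ?N)"
        by (subst sets_PiM_pmf) (auto simp: space_PiM)
      ultimately have "emeasure (PiM ?J ?N) ?C
          \<le> emeasure (PiM ?J ?N) {z\<in>space (PiM ?J ?N). l \<le> (\<Sum>j\<in>?J. g p (z j))}"
        by (rule emeasure_mono)
      also have "\<dots> \<le> ennreal (exp (- l))"
      proof (rule chernoff_PiM)
        fix j assume "j \<in> ?J"
        then have j: "(case j of (s, a, i) \<Rightarrow> P s a) = P s a" by auto
        show "(\<integral>\<^sup>+ y. ennreal (exp (g p y)) \<partial>?N j) \<le> 1"
          unfolding j g_def m[OF p(1)]
          by (rule pmf_mgf_le_1[OF fin]) (use b[OF p(1)] m[OF p(1)] in auto)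
      qed (auto simp: prob_space_measure_pmf)
      finally show ?thesis .
    qed
  qed (auto simp: I_def prob_space_measure_pmf)
  then show ?thesis unfolding M .
qed

lemma smp_in_range:
  assumes "\<And>s a. s < S \<Longrightarrow> a < A \<Longrightarrow> set_pmf (P s a) \<subseteq> {..<S}"
  shows "AE x in smp_measure S A P n. \<forall>s<S. \<forall>a<A. \<forall>i<n. x (s, a, i) < S"
proof -
  have "AE x in smp_measure S A P n. \<forall>j\<in>{..<S} \<times> {..<A} \<times> {..<n}. x j < S"
    unfolding smp_measure_alt
  proof (intro AE_finite_allI)
    fix j assume "j \<in> {..<S} \<times> {..<A} \<times> {..<n}"
    then show "AE x in PiM ({..<S} \<times> {..<A} \<times> {..<n}) (\<lambda>j. measure_pmf (case j of (s, a, i) \<Rightarrow> P s a)). x j < S"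
      using assms by (intro AE_PiM_component prob_space_measure_pmf) (auto simp: AE_measure_pmf_iff)
  qed auto
  then show ?thesis by eventually_elim auto
qed

lemma emp_kern_nonneg: "0 \<le> emp_kern n X s a s'"
  by (simp add: emp_kern_def)

lemma qexp_emp_kern:
  assumes "\<And>i. i < n \<Longrightarrow> X (s, a, i) < S"
  shows "qexp S (emp_kern n X) f s a = (\<Sum>i<n. f (X (s, a, i))) / real n"
proof -
  have "(\<Sum>i<n. f (X (s, a, i))) = (\<Sum>s'<S. \<Sum>i\<in>{i. i < n \<and> X (s, a, i) = s'}. f (X (s, a, i)))"
    using assms by (subst sum.group[symmetric, where T="{..<S}" and g="\<lambda>i. X (s, a, i)"])
      (auto intro!: sum.cong)
  also have "\<dots> = (\<Sum>s'<S. real (card {i. i < n \<and> X (s, a, i) = s'}) * f s')"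
    by (intro sum.cong refl) simp
  finally show ?thesis
    by (simp add: qexp_def mvec_def emp_kern_def sum_divide_distrib)
qed

lemma stoch_kernel_emp_kern:
  assumes "0 < n" "\<And>s a i. s < S \<Longrightarrow> a < A \<Longrightarrow> i < n \<Longrightarrow> X (s, a, i) < S"
  shows "stoch_kernel S A (emp_kern n X)"
proof -
  have "(\<Sum>s'<S. emp_kern n X s a s') = 1" if "s < S" "a < A" for s a
    using qexp_emp_kern[of n X s a S "\<lambda>_. 1"] assms that by (simp add: qexp_def mvec_def)
  then show ?thesis by (auto simp: stoch_kernel_def stoch_def emp_kern_nonneg)
qed

lemma substoch_kernel_emp_kern: "substoch_kernel S A (emp_kern n X)"
proof -
  have "(\<Sum>s'<S. emp_kern n X s a s') \<le> 1" for s a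
  proof -
    have "(\<Sum>s'<S. card {i. i < n \<and> X (s, a, i) = s'}) = card (\<Union>s'<S. {i. i < n \<and> X (s, a, i) = s'})"
      by (rule card_UN_disjoint[symmetric]) auto
    also have "\<dots> \<le> card {..<n}" by (intro card_mono) auto
    finally have "(\<Sum>s'<S. real (card {i. i < n \<and> X (s, a, i) = s'})) \<le> real n"
      by (simp flip: of_nat_sum)
    then show ?thesis
      by (cases "n = 0") (simp_all add: emp_kern_def flip: sum_divide_distrib)
  qed
  then show ?thesis by (auto simp: substoch_kernel_def substoch_def emp_kern_nonneg)
qed

lemma qexp_kern:
  assumes "set_pmf (P s a) \<subseteq> {..<S}"
  shows "qexp S (kern P) f s a = measure_pmf.expectation (P s a) f"
  by (subst integral_measure_pmf[of "{..<S}"]) (use assms in \<open>auto simp: qexp_def mvec_def kern_def\<close>)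

lemma stoch_kernel_kern:
  assumes "\<And>s a. s < S \<Longrightarrow> a < A \<Longrightarrow> set_pmf (P s a) \<subseteq> {..<S}"
  shows "stoch_kernel S A (kern P)"
  using assms unfolding stoch_kernel_def stoch_def kern_def by (auto intro!: sum_pmf_eq_1)

section \<open>The reward perturbation\<close>

definition prt_measure :: "nat \<Rightarrow> nat \<Rightarrow> real \<Rightarrow> (nat \<times> nat \<Rightarrow> real) measure" where
  "prt_measure S A \<xi> = PiM ({..<S} \<times> {..<A}) (\<lambda>_. uniform_measure lborel {0..\<xi>})"

lemma prob_space_unif: "0 < \<xi> \<Longrightarrow> prob_space (uniform_measure lborel {0..\<xi>::real})"
  by (rule prob_space_uniform_measure) auto

lemma prob_space_prt_measure: "0 < \<xi> \<Longrightarrow> prob_space (prt_measure S A \<xi>)"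
  unfolding prt_measure_def by (intro prob_space_PiM prob_space_unif)

lemma prt_component_measurable:
  "s < S \<Longrightarrow> a < A \<Longrightarrow> (\<lambda>\<Delta>. \<Delta> (s, a)) \<in> borel_measurable (prt_measure S A \<xi>)"
  unfolding prt_measure_def
  using measurable_component_singleton[of "(s, a)" "{..<S} \<times> {..<A}" "\<lambda>_. uniform_measure lborel {0..\<xi>}"]
  by simp

lemma prt_in_range:
  assumes "0 < \<xi>"
  shows "AE \<Delta> in prt_measure S A \<xi>. \<forall>s<S. \<forall>a<A. 0 \<le> \<Delta> (s, a) \<and> \<Delta> (s, a) \<le> \<xi>"
proof -
  have "AE \<Delta> in prt_measure S A \<xi>. \<forall>j\<in>{..<S} \<times> {..<A}. 0 \<le> \<Delta> j \<and> \<Delta> j \<le> \<xi>"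
    unfolding prt_measure_def
  proof (intro AE_finite_allI)
    fix j assume "j \<in> {..<S} \<times> {..<A}"
    then show "AE \<Delta> in PiM ({..<S} \<times> {..<A}) (\<lambda>_. uniform_measure lborel {0..\<xi>}). 0 \<le> \<Delta> j \<and> \<Delta> j \<le> \<xi>"
      by (intro AE_PiM_component[where P="\<lambda>y. 0 \<le> y \<and> y \<le> \<xi>"] prob_space_unif assms AE_uniform_measureI) auto
  qed auto
  then show ?thesis by eventually_elim auto
qed

text \<open>Any point of \<open>T\<close> is the centre of an interval of length
  \<open>2 * c\<close> containing \<open>T\<close>; the factor 2 replaces an argument with the
  extreme points of \<open>T\<close>.\<close>

lemma unif_ball_le:
  assumes "0 < \<xi>" "0 \<le> c" "T \<in> sets borel" and T: "\<And>x y. x \<in> T \<Longrightarrow> y \<in> T \<Longrightarrow> \<bar>x - y\<bar> \<le> c"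
  shows "emeasure (uniform_measure lborel {0..\<xi>}) T \<le> ennreal (2 * c / \<xi>)"
proof (cases "T = {}")
  case True
  then show ?thesis by simp
next
  case False
  then obtain p where p: "p \<in> T" by auto
  have "emeasure lborel ({0..\<xi>} \<inter> T) \<le> emeasure lborel {p - c..p + c}"
  proof (rule emeasure_mono)
    show "{0..\<xi>} \<inter> T \<subseteq> {p - c..p + c}"
    proof
      fix x assume "x \<in> {0..\<xi>} \<inter> T"
      then have "\<bar>x - p\<bar> \<le> c" using T p by blast
      then show "x \<in> {p - c..p + c}" by (simp add: abs_le_iff)
    qed
  qed simp
  also have "\<dots> = ennreal (2 * c)" using assms by simp
  finally have "emeasure lborel ({0..\<xi>} \<inter> T) / ennreal \<xi> \<le> ennreal (2 * c) / ennreal \<xi>"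
    by (rule divide_right_mono_ennreal)
  then show ?thesis using assms by (simp add: divide_ennreal)
qed

definition qopt :: "nat \<Rightarrow> nat \<Rightarrow> real \<Rightarrow> (nat \<Rightarrow> nat \<Rightarrow> real) \<Rightarrow> (nat \<Rightarrow> nat \<Rightarrow> nat \<Rightarrow> real)
    \<Rightarrow> nat \<Rightarrow> nat \<Rightarrow> real" where
  "qopt S A \<gamma> R K = qval S \<gamma> R K (opt_value S A \<gamma> R K)"

definition pert :: "(nat \<Rightarrow> nat \<Rightarrow> real) \<Rightarrow> (nat \<times> nat \<Rightarrow> real) \<Rightarrow> nat \<Rightarrow> nat \<Rightarrow> real" where
  "pert r \<Delta> s a = r s a + \<Delta> (s, a)"

lemma pert_measurable:
  "s < S \<Longrightarrow> a < A \<Longrightarrow> (\<lambda>\<Delta>. pert r \<Delta> s a) \<in> borel_measurable (prt_measure S A \<xi>)"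
  unfolding pert_def by (intro borel_measurable_add prt_component_measurable) auto

lemma qopt_pert_measurable:
  assumes "substoch_kernel S A K" "0 \<le> \<gamma>" "\<gamma> < 1" "0 < A" "s < S" "a < A"
  shows "(\<lambda>\<Delta>. qopt S A \<gamma> (pert r \<Delta>) K s a) \<in> borel_measurable (prt_measure S A \<xi>)"
  unfolding qopt_def by (rule qval_opt_value_measurable[OF assms pert_measurable])

lemma qopt_cut_measurable:
  assumes "substoch_kernel S A K" "0 \<le> \<gamma>" "\<gamma> < 1" "0 < A" "s < S" "a < A"
  shows "(\<lambda>\<Delta>. qopt S A \<gamma> (cut_reward s0 a0 u (pert r \<Delta>)) K s a) \<in> borel_measurable (prt_measure S A \<xi>)"
  unfolding qopt_def
proof (rule qval_opt_value_measurable[OF assms])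
  show "(\<lambda>\<Delta>. cut_reward s0 a0 u (pert r \<Delta>) s a) \<in> borel_measurable (prt_measure S A \<xi>)"
    if "s < S" "a < A" for s a
    using pert_measurable[OF that] by (cases "s = s0 \<and> a = a0") (auto simp: cut_reward_def)
qed

text \<open>With all other perturbations fixed, the gap increases in the perturbation of
  \<open>(s, a)\<close> with slope at least \<open>1 - \<gamma>\<close>. It therefore stays within
  \<omega> of zero only on a set of diameter at most
  \<open>2 * \<omega> / (1 - \<gamma>)\<close>.\<close>

lemma gap_probability:
  assumes K: "substoch_kernel S A K" and g: "0 \<le> \<gamma>" "\<gamma> < 1" and A: "0 < A" and xi: "0 < \<xi>"
    and om: "0 \<le> \<omega>" and s: "s < S" and a: "a < A" "a' < A" "a' \<noteq> a"
  shows "emeasure (prt_measure S A \<xi>) {\<Delta>\<in>space (prt_measure S A \<xi>).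
    \<bar>qopt S A \<gamma> (pert r \<Delta>) K s a - qopt S A \<gamma> (pert r \<Delta>) K s a'\<bar> \<le> \<omega>}
    \<le> ennreal (4 * \<omega> / (1 - \<gamma>) / \<xi>)" (is "emeasure _ ?B \<le> _")
proof -
  let ?N = "\<lambda>_::nat \<times> nat. uniform_measure lborel {0..\<xi>}"
  define I where "I = {..<S} \<times> {..<A} - {(s, a)}"
  have ins: "insert (s, a) I = {..<S} \<times> {..<A}" using s a by (auto simp: I_def)
  have M: "prt_measure S A \<xi> = PiM (insert (s, a) I) ?N" unfolding ins prt_measure_def ..
  have "emeasure (PiM (insert (s, a) I) ?N) ?B \<le> ennreal (4 * \<omega> / (1 - \<gamma>) / \<xi>)"
  proof (rule emeasure_PiM_insert_le)
    show B: "?B \<in> sets (PiM (insert (s, a) I) ?N)"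
      unfolding M[symmetric]
      using qopt_pert_measurable[OF K g A s a(1), of r \<xi>] qopt_pert_measurable[OF K g A s a(2), of r \<xi>]
      by measurable
    fix x assume x: "x \<in> space (PiM I ?N)"
    let ?T = "{y\<in>space (?N (s, a)). x((s, a) := y) \<in> ?B}"
    define h where "h y = qopt S A \<gamma> (pert r (x((s, a) := y))) K s a
      - qopt S A \<gamma> (pert r (x((s, a) := y))) K s a'" for y
    have expand: "(1 - \<gamma>) * (y' - y) \<le> h y' - h y" if "y \<le> y'" for y y'
      unfolding h_def qopt_def
      by (rule qval_gap_expands[OF K g opt_value_fix[OF K g A] opt_value_fix[OF K g A] _ _ s a])
        (use that in \<open>auto simp: pert_def\<close>)
    have T: "\<bar>h y\<bar> \<le> \<omega>" if "y \<in> ?T" for y using that by (simp add: h_def)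
    have close: "y' - y \<le> 2 * \<omega> / (1 - \<gamma>)" if "y \<in> ?T" "y' \<in> ?T" for y y'
    proof (cases "y \<le> y'")
      case True
      have "(1 - \<gamma>) * (y' - y) \<le> 2 * \<omega>"
        using expand[OF True] T[OF that(1)] T[OF that(2)] by (simp add: abs_le_iff)
      then show ?thesis using g by (simp add: field_simps)
    next
      case False
      have "0 \<le> 2 * \<omega> / (1 - \<gamma>)" using g om by simp
      then show ?thesis using False by linarith
    qed
    have "?T \<in> sets borel"
    proof -
      have "(\<lambda>y. x((s, a) := y)) \<in> measurable (?N (s, a)) (PiM (insert (s, a) I) ?N)"
        by (rule measurable_component_update[OF x]) (simp add: I_def)
      from measurable_sets[OF this B] show ?thesis
        by (simp add: vimage_def Int_def conj_commute)
    qed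
    then have "emeasure (?N (s, a)) ?T \<le> ennreal (2 * (2 * \<omega> / (1 - \<gamma>)) / \<xi>)"
    proof (rule unif_ball_le[OF xi, rotated])
      show "\<bar>y - y'\<bar> \<le> 2 * \<omega> / (1 - \<gamma>)" if "y \<in> ?T" "y' \<in> ?T" for y y'
        using close[OF that] close[OF that(2,1)] by (simp add: abs_le_iff)
      show "0 \<le> 2 * \<omega> / (1 - \<gamma>)" using g om by simp
    qed
    then show "emeasure (?N (s, a)) ?T \<le> ennreal (4 * \<omega> / (1 - \<gamma>) / \<xi>)" by simp
  qed (auto simp: I_def intro: prob_space_unif[OF xi])
  then show ?thesis unfolding M .
qed

text \<open>The sample space is countable, so the event is a countable union of rectangles and only
  its reward sections have to be measurable.\<close>

lemma sets_smp_pair: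
  assumes "\<And>x. x \<in> space (smp_measure S A P n) \<Longrightarrow> {y\<in>space N. \<phi> x y} \<in> sets N"
  shows "{\<omega>\<in>space (smp_measure S A P n \<Otimes>\<^sub>M N). \<phi> (fst \<omega>) (snd \<omega>)} \<in> sets (smp_measure S A P n \<Otimes>\<^sub>M N)"
proof -
  let ?M = "smp_measure S A P n"
  have c: "countable (space ?M)"
    unfolding space_smp_measure by (rule countable_PiE) auto
  have "{\<omega>\<in>space (?M \<Otimes>\<^sub>M N). \<phi> (fst \<omega>) (snd \<omega>)} = (\<Union>x\<in>space ?M. {x} \<times> {y\<in>space N. \<phi> x y})"
    by (auto simp: space_pair_measure)
  also have "\<dots> \<in> sets (?M \<Otimes>\<^sub>M N)"
    using assms by (intro sets.countable_UN''[OF c] pair_measureI)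
      (auto simp: sets_smp_measure space_smp_measure)
  finally show ?thesis .
qed

lemma qopt_cong:
  assumes K: "substoch_kernel S A K" "substoch_kernel S A K'" and g: "0 \<le> \<gamma>" "\<gamma> < 1" and A: "0 < A"
    and eq: "\<And>s a s'. s < S \<Longrightarrow> a < A \<Longrightarrow> K s a s' = K' s a s'" and s: "s < S" and a: "a < A"
  shows "qopt S A \<gamma> R K s a = qopt S A \<gamma> R K' s a"
proof -
  have qv: "qval S \<gamma> R K V s a = qval S \<gamma> R K' V s a" if "s < S" "a < A" for V s a
    using eq[OF that] by (simp add: qval_def qexp_def mvec_def)
  have "bellman_fix S A \<gamma> R K' (opt_value S A \<gamma> R K)"
    using opt_value_fix[OF K(1) g A, of R] unfolding bellman_fix_def using qv by (metis (no_types, lifting))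
  then have V: "opt_value S A \<gamma> R K j = opt_value S A \<gamma> R K' j" if "j < S" for j
    by (rule bellman_fix_unique[OF K(2) g _ opt_value_fix[OF K(2) g A] that])
  have "qexp S K' (opt_value S A \<gamma> R K) s a = qexp S K' (opt_value S A \<gamma> R K') s a"
    by (rule qexp_cong) (rule V)
  then show ?thesis unfolding qopt_def by (simp add: qv[OF s a]) (simp add: qval_def)
qed

section \<open>The good event\<close>

text \<open>\<open>\<pi>0\<close> is the policy compared against. The assumption
  \<open>2 \<le> S * A\<close> gives \<open>2 \<le> T\<close>, which keeps \<open>ln T\<close> away
  from 0.\<close>

locale plug_in =
  fixes S A n :: nat and P :: "nat \<Rightarrow> nat \<Rightarrow> nat pmf" and r :: "nat \<Rightarrow> nat \<Rightarrow> real"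
    and \<xi> \<delta> :: real and \<pi>0 :: "nat \<Rightarrow> nat"
  assumes S: "0 < S" and A: "0 < A" and n: "0 < n"
    and supp: "\<And>s a. s < S \<Longrightarrow> a < A \<Longrightarrow> set_pmf (P s a) \<subseteq> {..<S}"
    and r01: "\<And>s a. s < S \<Longrightarrow> a < A \<Longrightarrow> 0 \<le> r s a \<and> r s a \<le> 1"
    and xi: "0 < \<xi>" "\<xi> \<le> 1 / real n" and del: "0 < \<delta>" "\<delta> < 1"
    and SA: "2 \<le> S * A" and p0: "det_ok S A \<pi>0"
begin

definition T :: real where "T = real S * real A * real n / (\<delta> * \<xi>)"
text \<open>Makes \<open>exp (- L)\<close> equal to \<open>1 / T^12\<close>. Given only
  \<open>2 \<le> T\<close>, 12 is the least integer exponent that brings the \<open>66 * T^3\<close>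
  deviation events below \<open>1 / (2 * T)\<close>: this needs \<open>132 \<le> T^8\<close>, and
  \<open>2^7\<close> is still below 132.\<close>

definition L :: real where "L = 12 * ln T"
definition \<gamma> :: real where "\<gamma> = 1 - 1 / real n"
text \<open>A pair of actions is closer than this with probability at most
  \<open>4 * om * n / \<xi>\<close>; there are at most \<open>S * A\<^sup>2\<close> pairs, and their
  total is \<open>\<delta> / 2\<close>.\<close>

definition om :: real where "om = \<delta> * \<xi> / (8 * real n * real S * (real A)\<^sup>2)"
text \<open>Perturbed rewards are at most 2, so action values lie in \<open>[0, 2 * n]\<close>;
  payoffs \<open>k * om / 2\<close> with \<open>k \<le> N\<close> cover this interval.\<close>

definition N :: nat where "N = nat \<lfloor>4 * real n / om\<rfloor>"
definition val :: "(nat \<Rightarrow> nat) \<Rightarrow> nat \<Rightarrow> real" where "val p = pol_value S A (kern P) r \<gamma> p"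
definition H1 :: "(nat \<Rightarrow> nat) \<Rightarrow> real" where "H1 p = span S (val p) + 1"
text \<open>Equals \<open>sqrt (L / (H1 p * n)) / 8\<close>, which balances the terms
  \<open>kap p * H1 p * n\<close> and \<open>L / kap p\<close>. The summand 1 in \<open>H1\<close>
  keeps it defined for constant values.\<close>

definition kap :: "(nat \<Rightarrow> nat) \<Rightarrow> real" where "kap p = sqrt (L * H1 p * n) / (8 * H1 p * n)"
text \<open>Ensures \<open>kap p * H1 p \<le> 1 / 8\<close>, as required both for exponents within
  \<open>1 / 2\<close> and for absorbing the cross term in \<open>value_error\<close>.\<close>

definition adm :: "(nat \<Rightarrow> nat) \<Rightarrow> bool" where "adm p \<longleftrightarrow> L * H1 p \<le> n"
definition mean :: "(nat \<Rightarrow> nat) \<Rightarrow> nat \<Rightarrow> nat \<Rightarrow> real" where "mean p s a = qexp S (kern P) (val p) s a"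
definition dev :: "real \<Rightarrow> (nat \<Rightarrow> nat) \<Rightarrow> (nat \<times> nat \<times> nat \<Rightarrow> nat) \<Rightarrow> nat \<Rightarrow> nat \<Rightarrow> bool" where
  "dev \<sigma> p x s a \<longleftrightarrow> L \<le> (\<Sum>i<n. \<sigma> * kap p * (val p (x (s, a, i)) - mean p s a)
    - (\<sigma> * kap p * (val p (x (s, a, i)) - mean p s a))\<^sup>2)"
definition Qopt :: "(nat \<times> nat \<times> nat \<Rightarrow> nat) \<Rightarrow> (nat \<times> nat \<Rightarrow> real) \<Rightarrow> nat \<Rightarrow> nat \<Rightarrow> real" where
  "Qopt x \<Delta> = qopt S A \<gamma> (pert r \<Delta>) (emp_kern n x)"
definition Qcut :: "(nat \<times> nat \<times> nat \<Rightarrow> nat) \<Rightarrow> (nat \<times> nat \<Rightarrow> real) \<Rightarrow> nat \<Rightarrow> nat \<Rightarrow> nat \<Rightarrow> nat \<Rightarrow> nat \<Rightarrow> real" where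
  "Qcut x \<Delta> s a k = qopt S A \<gamma> (cut_reward s a (real k * om / 2) (pert r \<Delta>)) (cut_kernel s a (emp_kern n x))"
text \<open>Extensional functions: the set is finite, and policies that agree on the states are
  equal.\<close>

definition Pol :: "(nat \<Rightarrow> nat) set" where "Pol = PiE {..<S} (\<lambda>_. {..<A})"
definition greedy :: "(nat \<Rightarrow> nat) \<Rightarrow> (nat \<times> nat \<times> nat \<Rightarrow> nat) \<Rightarrow> (nat \<times> nat \<Rightarrow> real) \<Rightarrow> nat \<Rightarrow> nat \<Rightarrow> nat \<Rightarrow> bool" where
  "greedy p x \<Delta> s a k \<longleftrightarrow> (\<forall>s'<S. \<forall>a'<A. a' \<noteq> p s' \<longrightarrow> Qcut x \<Delta> s a k s' a' < Qcut x \<Delta> s a k s' (p s'))"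

abbreviation smp where "smp \<equiv> smp_measure S A P n"
abbreviation prt where "prt \<equiv> prt_measure S A \<xi>"
abbreviation \<Omega> where "\<Omega> \<equiv> smp \<Otimes>\<^sub>M prt"

definition bad1 where "bad1 \<sigma> s a = {w\<in>space \<Omega>. adm \<pi>0 \<and> dev \<sigma> \<pi>0 (fst w) s a}"
text \<open>The existential over policies stays inside the event: at most one policy is strictly
  greedy for a given \<open>k\<close>, so only signs, pairs and grid indices are counted.\<close>

definition bad2 where "bad2 \<sigma> s a k = {w\<in>space \<Omega>. \<exists>p\<in>Pol. adm p \<and> greedy p (fst w) (snd w) s a k \<and> dev \<sigma> p (fst w) s a}"
definition bad3 where "bad3 s a a' = {w\<in>space \<Omega>. \<bar>Qopt (fst w) (snd w) s a - Qopt (fst w) (snd w) s a'\<bar> \<le> om}"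
definition in_range :: "(nat \<times> nat \<times> nat \<Rightarrow> nat) \<Rightarrow> (nat \<times> nat \<Rightarrow> real) \<Rightarrow> bool" where
  "in_range x \<Delta> \<longleftrightarrow> (\<forall>s<S. \<forall>a<A. (\<forall>i<n. x (s, a, i) < S) \<and> 0 \<le> \<Delta> (s, a) \<and> \<Delta> (s, a) \<le> \<xi>)"
definition bad4 where "bad4 = {w\<in>space \<Omega>. \<not> in_range (fst w) (snd w)}"

lemma sample_space_eq: "sample_space S A P n \<xi> = \<Omega>"
  by (simp add: sample_space_def smp_measure_def prt_measure_def)

lemma om0: "0 < om"
  unfolding om_def using xi del S A n by simp

lemma T_ge: "2 \<le> T" "1 / \<delta> \<le> T" "real S * real A \<le> T" "(real n)\<^sup>2 * real S * (real A)\<^sup>2 / (\<delta> * \<xi>) \<le> T\<^sup>2"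
proof -
  have n1: "1 \<le> real n" and S1: "1 \<le> real S" and A1: "1 \<le> real A" using S A n by auto
  have "1 / real n \<le> 1" using n1 by simp
  then have x1: "\<xi> \<le> 1" using xi by linarith
  have dx: "0 < \<delta> * \<xi>" "\<delta> * \<xi> \<le> \<delta>" "\<delta> * \<xi> \<le> 1" using del xi x1 by (auto simp: mult_le_one mult_left_le)
  have "real (S * A) * 1 \<le> real (S * A) * real n" using n1 by (intro mult_left_mono) auto
  then have SAn: "real S * real A \<le> real S * real A * real n" by simp
  have SA2: "2 \<le> real S * real A" using SA by (metis of_nat_le_iff of_nat_mult of_nat_numeral)
  have "real S * real A * real n * 1 \<le> real S * real A * real n * (1 / (\<delta> * \<xi>))"
    using dx by (intro mult_left_mono) auto
  then have *: "real S * real A * real n \<le> T" by (simp add: T_def)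
  show "real S * real A \<le> T" using * SAn by linarith
  then show "2 \<le> T" using SA2 by linarith
  have "1 * (1 / \<delta>) \<le> real S * real A * real n * (1 / (\<delta> * \<xi>))"
    using SAn SA2 dx del by (intro mult_mono divide_left_mono) auto
  then show "1 / \<delta> \<le> T" by (simp add: T_def)
  have "(real n)\<^sup>2 * real S * (real A)\<^sup>2 * 1 * (1 / (\<delta> * \<xi>))
      \<le> (real n)\<^sup>2 * real S * (real A)\<^sup>2 * real S * (1 / (\<delta> * \<xi>)\<^sup>2)"
  proof (intro mult_mono)
    have "(\<delta> * \<xi>)\<^sup>2 \<le> \<delta> * \<xi>" using dx by (simp add: power2_eq_square mult_left_le)
    then show "1 / (\<delta> * \<xi>) \<le> 1 / (\<delta> * \<xi>)\<^sup>2" using dx del xi by (intro divide_left_mono mult_pos_pos zero_less_power) auto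
  qed (use S1 dx in auto)
  then show "(real n)\<^sup>2 * real S * (real A)\<^sup>2 / (\<delta> * \<xi>) \<le> T\<^sup>2"
    by (simp add: T_def power_divide power_mult_distrib mult_ac) (simp add: power2_eq_square mult_ac)
qed

lemma L_pos: "0 < L"
  using T_ge(1) by (simp add: L_def)

lemma exp_L: "exp (- L) = 1 / T ^ 12"
proof -
  have "exp (12 * ln T) = exp (ln T) ^ 12" by (subst exp_of_nat_mult[symmetric]) simp
  then show ?thesis using T_ge(1) by (simp add: L_def exp_minus inverse_eq_divide)
qed

lemma gam: "0 \<le> \<gamma>" "\<gamma> < 1" "1 - \<gamma> = 1 / real n"
  using n by (auto simp: \<gamma>_def)

lemma H1_ge: "1 \<le> H1 p"
  unfolding H1_def using span_nonneg[OF S, of "val p"] by simp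

lemma kap_pos: "0 < kap p"
  unfolding kap_def using H1_ge[of p] L_pos n by (intro divide_pos_pos) (auto simp: zero_less_mult_iff)

lemma kap_H1: "adm p \<Longrightarrow> kap p * H1 p \<le> 1 / 8"
proof -
  assume "adm p"
  then have "L * H1 p * real n \<le> real n * real n" unfolding adm_def by (intro mult_right_mono) auto
  then have "sqrt (L * H1 p * n) \<le> n" by (intro real_le_lsqrt) (auto simp: power2_eq_square)
  then show ?thesis using H1_ge[of p] n by (simp add: kap_def field_simps)
qed

lemma stoch_P: "stoch_kernel S A (kern P)"
  by (rule stoch_kernel_kern) (rule supp)

lemma val_dev_bound:
  assumes "adm p" "s < S" "a < A" "y < S" "\<bar>\<sigma>\<bar> = 1"
  shows "\<bar>\<sigma> * kap p * (val p y - mean p s a)\<bar> \<le> 1 / 2"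
proof -
  obtain m where m: "\<And>i. i < S \<Longrightarrow> m \<le> val p i" "\<And>i. i < S \<Longrightarrow> val p i \<le> m + span S (val p)"
    using span_range[OF S, of "val p"] by metis
  have "m \<le> mean p s a" "mean p s a \<le> m + span S (val p)"
    using qexp_mono[OF stoch_P assms(2,3), of "\<lambda>_. m" "val p"]
      qexp_mono[OF stoch_P assms(2,3), of "val p" "\<lambda>_. m + span S (val p)"] m
    by (simp_all add: mean_def qexp_const[OF stoch_P assms(2,3)])
  then have "\<bar>val p y - mean p s a\<bar> \<le> H1 p"
    using m(1)[OF assms(4)] m(2)[OF assms(4)] by (simp add: H1_def abs_le_iff)
  then have "kap p * \<bar>val p y - mean p s a\<bar> \<le> kap p * H1 p"
    using kap_pos[of p] by (intro mult_left_mono) auto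
  also have "\<dots> \<le> 1 / 8" by (rule kap_H1[OF assms(1)])
  finally show ?thesis using kap_pos[of p] assms(5) by (simp add: abs_mult)
qed

section \<open>Measurability and probability of the bad events\<close>

lemma dev_probability:
  assumes "s < S" "a < A" "\<bar>\<sigma>\<bar> = 1" and F: "\<And>p. p \<in> F \<Longrightarrow> adm p"
    and uniq: "\<And>x p p'. p \<in> F \<Longrightarrow> p' \<in> F \<Longrightarrow> sel p x \<Longrightarrow> sel p' x \<Longrightarrow> p = p'"
    and dep: "\<And>x x' p. (\<And>s' a' i. (s', a') \<noteq> (s, a) \<Longrightarrow> s' < S \<Longrightarrow> a' < A \<Longrightarrow> i < n \<Longrightarrow>
      x (s', a', i) = x' (s', a', i)) \<Longrightarrow> p \<in> F \<Longrightarrow> sel p x = sel p x'"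
  shows "emeasure smp {x\<in>space smp. \<exists>p\<in>F. sel p x \<and> dev \<sigma> p x s a} \<le> ennreal (exp (- L))"
  unfolding dev_def
proof (rule leave_out_deviation[OF assms(1,2)])
  show "finite (set_pmf (P s a))" using supp[OF assms(1,2)] finite_subset by blast
  show "mean p s a = measure_pmf.expectation (P s a) (val p)" for p
    unfolding mean_def by (rule qexp_kern[where P=P and s=s and a=a, OF supp[OF assms(1,2)]])
  show "\<bar>\<sigma> * kap p * (val p y - mean p s a)\<bar> \<le> 1 / 2" if "p \<in> F" "y \<in> set_pmf (P s a)" for p y
    using val_dev_bound[OF F[OF that(1)] assms(1,2) _ assms(3), of y] supp[OF assms(1,2)] that(2) by blast
qed (fact uniq, fact dep)

lemma prob_smp: "prob_space smp" by (rule prob_space_smp_measure)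
lemma prob_prt: "prob_space prt" by (rule prob_space_prt_measure[OF xi(1)])
lemma prob_\<Omega>: "prob_space \<Omega>"
proof -
  interpret a: prob_space smp by (rule prob_smp)
  interpret b: prob_space prt by (rule prob_prt)
  interpret pair_prob_space smp prt ..
  show ?thesis by unfold_locales
qed

lemma bad1_sets: "bad1 \<sigma> s a \<in> sets \<Omega>"
  unfolding bad1_def by (rule sets_smp_pair) simp

lemma bad1_le:
  assumes "s < S" "a < A" "\<bar>\<sigma>\<bar> = 1"
  shows "emeasure \<Omega> (bad1 \<sigma> s a) \<le> ennreal (exp (- L))"
proof (rule emeasure_pair_section2_le[OF prob_smp prob_prt bad1_sets])
  fix y assume y: "y \<in> space prt"
  \<comment> \<open>A policy fixed in advance is the degenerate family with one label that is always
    selected.\<close>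
  have "(\<lambda>x. (x, y)) -` bad1 \<sigma> s a = {x\<in>space smp. \<exists>p\<in>{p. p = \<pi>0 \<and> adm p}. True \<and> dev \<sigma> p x s a}"
    using y by (auto simp: bad1_def space_pair_measure)
  also have "emeasure smp \<dots> \<le> ennreal (exp (- L))"
    by (rule dev_probability[OF assms]) auto
  finally show "emeasure smp ((\<lambda>x. (x, y)) -` bad1 \<sigma> s a) \<le> ennreal (exp (- L))" .
qed

lemma Qcut_measurable:
  assumes "s' < S" "a' < A"
  shows "(\<lambda>\<Delta>. Qcut x \<Delta> s a k s' a') \<in> borel_measurable prt"
  unfolding Qcut_def
  by (rule qopt_cut_measurable[OF substoch_cut_kernel[OF substoch_kernel_emp_kern] gam(1,2) A assms])

lemma Pol_det: "p \<in> Pol \<Longrightarrow> s < S \<Longrightarrow> p s < A"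
  by (auto simp: Pol_def)

lemma bad2_sets: "bad2 \<sigma> s a k \<in> sets \<Omega>"
  unfolding bad2_def
proof (rule sets_smp_pair)
  fix x
  have "{y\<in>space prt. greedy p x y s a k} \<in> sets prt" if p: "p \<in> Pol" for p
  proof -
    have "{y\<in>space prt. greedy p x y s a k}
        = {y\<in>space prt. \<forall>s'\<in>{..<S}. \<forall>a'\<in>{..<A} - {p s'}. Qcut x y s a k s' a' < Qcut x y s a k s' (p s')}"
      by (auto simp: greedy_def)
    also have "\<dots> \<in> sets prt"
      using Pol_det[OF p]
      by (intro sets.sets_Collect_finite_All borel_measurable_less Qcut_measurable) (use S in auto)
    finally show ?thesis .
  qed
  then have "{y\<in>space prt. \<exists>p\<in>{p\<in>Pol. adm p \<and> dev \<sigma> p x s a}. greedy p x y s a k} \<in> sets prt"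
    by (intro sets.sets_Collect_finite_Ex) (auto simp: Pol_def finite_PiE)
  then show "{y\<in>space prt. \<exists>p\<in>Pol. adm p \<and> greedy p x y s a k \<and> dev \<sigma> p x s a} \<in> sets prt"
    by (rule back_subst[of "\<lambda>B. B \<in> sets prt"]) auto
qed

lemma greedy_unique:
  assumes "p \<in> Pol" "p' \<in> Pol" "greedy p x \<Delta> s a k" "greedy p' x \<Delta> s a k"
  shows "p = p'"
proof (rule PiE_ext[OF assms(1,2)[unfolded Pol_def]])
  fix j assume "j \<in> {..<S}"
  then have j: "j < S" by simp
  show "p j = p' j"
  proof (rule ccontr)
    assume ne: "p j \<noteq> p' j"
    have "Qcut x \<Delta> s a k j (p' j) < Qcut x \<Delta> s a k j (p j)"
      using assms(3) j Pol_det[OF assms(2) j] ne unfolding greedy_def by metis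
    moreover have "Qcut x \<Delta> s a k j (p j) < Qcut x \<Delta> s a k j (p' j)"
      using assms(4) j Pol_det[OF assms(1) j] ne unfolding greedy_def by metis
    ultimately show False by simp
  qed
qed

lemma Qcut_dep:
  assumes eq: "\<And>s' a' i. (s', a') \<noteq> (s, a) \<Longrightarrow> s' < S \<Longrightarrow> a' < A \<Longrightarrow> i < n \<Longrightarrow>
      x (s', a', i) = x' (s', a', i)" and "j < S" "b < A"
  shows "Qcut x \<Delta> s a k j b = Qcut x' \<Delta> s a k j b"
  unfolding Qcut_def
proof (rule qopt_cong[OF substoch_cut_kernel[OF substoch_kernel_emp_kern]
      substoch_cut_kernel[OF substoch_kernel_emp_kern] gam(1,2) A _ assms(2,3)])
  fix i b s' assume ib: "i < S" "b < A"
  show "cut_kernel s a (emp_kern n x) i b s' = cut_kernel s a (emp_kern n x') i b s'"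
  proof (cases "(i, b) = (s, a)")
    case False
    then have "{l. l < n \<and> x (i, b, l) = s'} = {l. l < n \<and> x' (i, b, l) = s'}"
      using eq[OF False ib] by auto
    then show ?thesis by (simp add: cut_kernel_def emp_kern_def)
  qed (simp add: cut_kernel_def)
qed

lemma bad2_le:
  assumes "s < S" "a < A" "\<bar>\<sigma>\<bar> = 1"
  shows "emeasure \<Omega> (bad2 \<sigma> s a k) \<le> ennreal (exp (- L))"
proof (rule emeasure_pair_section2_le[OF prob_smp prob_prt bad2_sets])
  fix y assume y: "y \<in> space prt"
  have "(\<lambda>x. (x, y)) -` bad2 \<sigma> s a k = {x\<in>space smp. \<exists>p\<in>{p\<in>Pol. adm p}. greedy p x y s a k \<and> dev \<sigma> p x s a}"
    using y by (auto simp: bad2_def space_pair_measure)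
  also have "emeasure smp \<dots> \<le> ennreal (exp (- L))"
  proof (rule dev_probability[OF assms])
    show "p = p'" if "p \<in> {p\<in>Pol. adm p}" "p' \<in> {p\<in>Pol. adm p}" "greedy p x y s a k" "greedy p' x y s a k"
      for x p p' using greedy_unique that by blast
    show "greedy p x y s a k = greedy p x' y s a k"
      if "\<And>s' a' i. (s', a') \<noteq> (s, a) \<Longrightarrow> s' < S \<Longrightarrow> a' < A \<Longrightarrow> i < n \<Longrightarrow> x (s', a', i) = x' (s', a', i)"
        "p \<in> {p\<in>Pol. adm p}" for x x' p
    proof -
      have "Qcut x y s a k j b = Qcut x' y s a k j b" if "j < S" "b < A" for j b
        by (rule Qcut_dep) (use \<open>\<And>s' a' i. _ \<Longrightarrow> _ \<Longrightarrow> _ \<Longrightarrow> _ \<Longrightarrow> x (s', a', i) = _\<close> that in auto)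
      moreover have "p j < A" if "j < S" for j using Pol_det that \<open>p \<in> {p\<in>Pol. adm p}\<close> by blast
      ultimately show ?thesis by (simp add: greedy_def)
    qed
  qed simp
  finally show "emeasure smp ((\<lambda>x. (x, y)) -` bad2 \<sigma> s a k) \<le> ennreal (exp (- L))" .
qed

lemma bad3_sets:
  assumes "s < S" "a < A" "a' < A"
  shows "bad3 s a a' \<in> sets \<Omega>"
  unfolding bad3_def
proof (rule sets_smp_pair)
  fix x
  have m: "(\<lambda>y. Qopt x y s b) \<in> borel_measurable prt" if "b < A" for b
    unfolding Qopt_def by (rule qopt_pert_measurable[OF substoch_kernel_emp_kern gam(1,2) A assms(1) that])
  note [measurable] = m[OF assms(2)] m[OF assms(3)]
  show "{y\<in>space prt. \<bar>Qopt x y s a - Qopt x y s a'\<bar> \<le> om} \<in> sets prt" by measurable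
qed

lemma bad3_le:
  assumes "s < S" "a < A" "a' < A" "a' \<noteq> a"
  shows "emeasure \<Omega> (bad3 s a a') \<le> ennreal (4 * om * n / \<xi>)"
proof (rule emeasure_pair_section1_le[OF prob_smp prob_prt bad3_sets[OF assms(1-3)]])
  fix x assume x: "x \<in> space smp"
  have "Pair x -` bad3 s a a' = {y\<in>space prt. \<bar>Qopt x y s a - Qopt x y s a'\<bar> \<le> om}"
    using x by (auto simp: bad3_def space_pair_measure)
  also have "emeasure prt \<dots> \<le> ennreal (4 * om / (1 - \<gamma>) / \<xi>)"
    unfolding Qopt_def using om0
    by (intro gap_probability[OF substoch_kernel_emp_kern gam(1,2) A xi(1) _ assms]) simp
  also have "4 * om / (1 - \<gamma>) / \<xi> = 4 * om * n / \<xi>" by (simp add: gam(3))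
  finally show "emeasure prt (Pair x -` bad3 s a a') \<le> ennreal (4 * om * n / \<xi>)" .
qed

lemma bad4_sets: "bad4 \<in> sets \<Omega>"
  unfolding bad4_def
proof (rule sets_smp_pair)
  fix x
  note [measurable] = prt_component_measurable
  have "{y\<in>space prt. in_range x y} = {y\<in>space prt. \<forall>s\<in>{..<S}. \<forall>a\<in>{..<A}. (\<forall>i<n. x (s, a, i) < S)
      \<and> 0 \<le> y (s, a) \<and> y (s, a) \<le> \<xi>}"
    by (auto simp: in_range_def)
  also have "\<dots> \<in> sets prt"
    by (intro sets.sets_Collect_finite_All sets.sets_Collect_conj borel_measurable_le
        prt_component_measurable) (use S A in auto)
  finally have "space prt - {y\<in>space prt. in_range x y} \<in> sets prt" by blast
  then show "{y\<in>space prt. \<not> in_range x y} \<in> sets prt"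
    by (rule back_subst[of "\<lambda>B. B \<in> sets prt"]) auto
qed

lemma bad4_le: "emeasure \<Omega> bad4 \<le> ennreal 0"
proof -
  define C where "C = {w\<in>space \<Omega>. \<not> (\<forall>s<S. \<forall>a<A. \<forall>i<n. fst w (s, a, i) < S)}"
  \<comment> \<open>Splits \<open>bad4\<close> into a part decided by the samples alone and a rest
    caused by the rewards; each is null on sections in the other coordinate.\<close>
  define D where "D = bad4 - C"
  have C: "C \<in> sets \<Omega>" unfolding C_def by (rule sets_smp_pair) simp
  have D: "D \<in> sets \<Omega>" unfolding D_def using C bad4_sets by blast
  have "emeasure \<Omega> C \<le> 0"
  proof (rule emeasure_pair_section2_le[OF prob_smp prob_prt C])
    fix y assume y: "y \<in> space prt"
    have Cy: "(\<lambda>x. (x, y)) -` C = {x\<in>space smp. \<not> (\<forall>s<S. \<forall>a<A. \<forall>i<n. x (s, a, i) < S)}"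
      using y by (auto simp: C_def space_pair_measure)
    have null: "{x\<in>space smp. \<not> (\<forall>s<S. \<forall>a<A. \<forall>i<n. x (s, a, i) < S)} \<in> null_sets smp"
    proof -
      have "AE x in smp. \<forall>s<S. \<forall>a<A. \<forall>i<n. x (s, a, i) < S" by (rule smp_in_range) (rule supp)
      then show ?thesis
        by (subst (asm) AE_iff_null) (auto simp: sets_smp_measure space_smp_measure)
    qed
    show "emeasure smp ((\<lambda>x. (x, y)) -` C) \<le> 0"
      unfolding Cy null_setsD1[OF null] by (rule order_refl)
  qed
  moreover have "emeasure \<Omega> D \<le> 0"
  proof (rule emeasure_pair_section1_le[OF prob_smp prob_prt D])
    fix x assume x: "x \<in> space smp"
    have "AE y in prt. y \<notin> Pair x -` D"
      using prt_in_range[OF xi(1), of S A]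
      by eventually_elim (auto simp: D_def C_def bad4_def in_range_def)
    then have "Pair x -` D \<in> null_sets prt" by (subst AE_iff_null_sets[OF sets_Pair1[OF D]])
    then show "emeasure prt (Pair x -` D) \<le> 0" using null_setsD1 by fastforce
  qed
  moreover have "emeasure \<Omega> bad4 \<le> emeasure \<Omega> (C \<union> D)"
    by (intro emeasure_mono sets.Un C D) (auto simp: D_def)
  moreover have "emeasure \<Omega> (C \<union> D) \<le> emeasure \<Omega> C + emeasure \<Omega> D"
    by (rule emeasure_subadditive[OF C D])
  ultimately show ?thesis by (simp add: order_trans)
qed

definition bad where
  "bad = (\<Union>(\<sigma>, s, a)\<in>{1, -1} \<times> {..<S} \<times> {..<A}. bad1 \<sigma> s a)
    \<union> (\<Union>(\<sigma>, s, a, k)\<in>{1, -1} \<times> {..<S} \<times> {..<A} \<times> {..N}. bad2 \<sigma> s a k)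
    \<union> (\<Union>(s, a, a')\<in>{(s, a, a'). s < S \<and> a < A \<and> a' < A \<and> a' \<noteq> a}. bad3 s a a') \<union> bad4"

text \<open>One half of \<delta> is spent on the deviation events \<open>bad1\<close> and
  \<open>bad2\<close>, the other half on \<open>bad3\<close>; \<open>bad4\<close> is null.\<close>

lemma bad_measure: "bad \<in> sets \<Omega>" "measure \<Omega> bad \<le> \<delta>"
proof -
  let ?I1 = "{1, -1::real} \<times> {..<S} \<times> {..<A}"
  let ?I2 = "{1, -1::real} \<times> {..<S} \<times> {..<A} \<times> {..N}"
  let ?I3 = "{(s, a, a'). s < S \<and> a < A \<and> a' < A \<and> a' \<noteq> a}"
  let ?B1 = "\<Union>(\<sigma>, s, a)\<in>?I1. bad1 \<sigma> s a"
  let ?B2 = "\<Union>(\<sigma>, s, a, k)\<in>?I2. bad2 \<sigma> s a k"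
  let ?B3 = "\<Union>(s, a, a')\<in>?I3. bad3 s a a'"
  interpret prob_space \<Omega> by (rule prob_\<Omega>)
  have I3: "?I3 \<subseteq> {..<S} \<times> {..<A} \<times> {..<A}" by auto
  then have f3: "finite ?I3" by (rule finite_subset) auto
  have c3: "card ?I3 \<le> S * (A * A)" using card_mono[OF _ I3] by (simp add: card_cartesian_product)
  have s1: "?B1 \<in> sets \<Omega>" by (intro sets.finite_UN) (auto simp: bad1_sets)
  have s2: "?B2 \<in> sets \<Omega>" by (intro sets.finite_UN) (auto simp: bad2_sets)
  have s3: "?B3 \<in> sets \<Omega>" by (intro sets.finite_UN f3) (auto intro: bad3_sets)
  show "bad \<in> sets \<Omega>" unfolding bad_def using s1 s2 s3 bad4_sets by blast
  have T0: "0 < T" using T_ge(1) by simp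
  have m1: "measure \<Omega> ?B1 \<le> real (card ?I1) * exp (- L)"
    by (rule measure_UN_le_card[OF prob_\<Omega>]) (auto simp: bad1_sets intro!: bad1_le)
  have m2: "measure \<Omega> ?B2 \<le> real (card ?I2) * exp (- L)"
    by (rule measure_UN_le_card[OF prob_\<Omega>]) (auto simp: bad2_sets intro!: bad2_le)
  have m3: "measure \<Omega> ?B3 \<le> real (card ?I3) * (4 * om * n / \<xi>)"
    by (rule measure_UN_le_card[OF prob_\<Omega> f3])
      (use om0 xi in \<open>auto intro: bad3_sets bad3_le\<close>)
  also have "\<dots> \<le> real (S * (A * A)) * (4 * om * n / \<xi>)"
    using c3 om0 xi by (intro mult_right_mono) (auto simp flip: of_nat_mult)
  also have "\<dots> = \<delta> / 2"
    using S A n xi by (simp add: om_def field_simps power2_eq_square)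
  finally have m3': "measure \<Omega> ?B3 \<le> \<delta> / 2" .
  have m4: "measure \<Omega> bad4 = 0" using bad4_le by (simp add: emeasure_eq_measure ennreal_le_iff2)
  have "4 * real n / om = 32 * ((real n)\<^sup>2 * real S * (real A)\<^sup>2 / (\<delta> * \<xi>))"
    using S A n xi del by (simp add: om_def field_simps power2_eq_square)
  also have "\<dots> \<le> 32 * T\<^sup>2" using T_ge(4) by simp
  finally have N1: "4 * real n / om \<le> 32 * T\<^sup>2" .
  have "0 \<le> 4 * real n / om" using om0 by simp
  then have "real N \<le> 4 * real n / om" unfolding N_def by (simp add: of_nat_nat)
  then have N2: "real N \<le> 32 * T\<^sup>2" using N1 by linarith
  have T2: "4 \<le> T\<^sup>2" using power_mono[OF T_ge(1), of 2] by simp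
  \<comment> \<open>For each sign and pair there is one event \<open>bad1\<close> and there are
    \<open>N + 1\<close> events \<open>bad2\<close>.\<close>
  have "real (card ?I1) + real (card ?I2) = 2 * (real S * real A) * (real N + 2)"
    by (simp add: card_cartesian_product algebra_simps)
  also have "\<dots> \<le> 2 * T * (33 * T\<^sup>2)"
    using T_ge(3) N2 T2 T0 by (intro mult_mono) auto
  finally have "(real (card ?I1) + real (card ?I2)) * exp (- L) \<le> (66 * T ^ 3) * (1 / T ^ 12)"
    unfolding exp_L using T0 by (intro mult_right_mono) (auto simp: power3_eq_cube power2_eq_square)
  also have "T ^ 12 = T ^ 3 * T ^ 9" by (simp flip: power_add)
  also have "66 * T ^ 3 * (1 / (T ^ 3 * T ^ 9)) = 66 / T ^ 9"
  proof -
    have *: "66 * a * (1 / (a * b)) = 66 / b" if "a \<noteq> 0" for a b :: real using that by simp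
    show ?thesis by (rule *) (use T0 in simp)
  qed
  also have "\<dots> \<le> (1 / T) / 2"
  proof -
    have "(2::real) ^ 8 \<le> T ^ 8" using T_ge(1) by (intro power_mono) auto
    then have "132 * T \<le> T ^ 8 * T" using T0 by (intro mult_right_mono) auto
    also have "T ^ 8 * T = T ^ 9" by (simp add: eval_nat_numeral)
    finally show ?thesis using T0 by (simp add: field_simps)
  qed
  also have "\<dots> \<le> \<delta> / 2" using T_ge(2) del T0 by (simp add: field_simps)
  finally have "measure \<Omega> ?B1 + measure \<Omega> ?B2 \<le> \<delta> / 2" using m1 m2 by (simp add: algebra_simps)
  moreover have "measure \<Omega> bad \<le> measure \<Omega> ?B1 + measure \<Omega> ?B2 + measure \<Omega> ?B3 + measure \<Omega> bad4"
    unfolding bad_def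
    by (intro order_trans[OF measure_Un_le] add_right_mono order_refl sets.Un s1 s2 s3 bad4_sets)
  ultimately show "measure \<Omega> bad \<le> \<delta>" using m3' m4 by linarith
qed

end

section \<open>Deterministic consequences of the good event\<close>

context plug_in
begin

lemma stoch_emp: "in_range x \<Delta> \<Longrightarrow> stoch_kernel S A (emp_kern n x)"
  by (rule stoch_kernel_emp_kern[OF n]) (auto simp: in_range_def)

text \<open>This is \<open>value_error\<close> with \<open>\<epsilon> = L / n\<close>. In units of
  \<open>Z = sqrt (L * H1 p * n)\<close> its terms, multiplied by \<open>n\<close>, are at most 1, 8
  and 8, and the reward perturbation contributes \<open>n * \<xi> \<le> 1\<close>.\<close>

lemma emp_value_close:
  assumes x: "in_range x \<Delta>" and p: "det_ok S A p" "adm p" and n2: "2 \<le> n"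
    and dev: "\<And>s \<sigma>. s < S \<Longrightarrow> \<sigma> \<in> {1, -1} \<Longrightarrow> \<not> dev \<sigma> p x s (p s)" and s: "s < S"
  shows "\<bar>pol_value S A (emp_kern n x) (pert r \<Delta>) \<gamma> p s - val p s\<bar> \<le> 17 * sqrt (L * H1 p * n) + 1"
proof -
  let ?Q = "emp_kern n x"
  have xr: "\<And>s a i. s < S \<Longrightarrow> a < A \<Longrightarrow> i < n \<Longrightarrow> x (s, a, i) < S" using x by (auto simp: in_range_def)
  have Qh: "stoch_kernel S A ?Q" by (rule stoch_emp[OF x])
  define H where "H = span S (val p)"
  have H: "0 \<le> H" "H1 p = H + 1" using span_nonneg[OF S, of "val p"] by (auto simp: H_def H1_def)
  define k where "k = kap p"
  have k0: "0 < k" unfolding k_def by (rule kap_pos)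
  have kH: "k * H \<le> 1 / 8"
  proof -
    have "k * H \<le> k * H1 p" using k0 H by (intro mult_left_mono) auto
    then show ?thesis using kap_H1[OF p(2)] by (simp add: k_def)
  qed
  have pA: "p i < A" if "i < S" for i using p(1) that by (simp add: det_ok_def)
  have "\<bar>pol_value S A ?Q (pert r \<Delta>) \<gamma> p s - pol_value S A (kern P) r \<gamma> p s\<bar>
      \<le> (\<xi> + 8 * k * span S (pol_value S A (kern P) r \<gamma> p) + 8 * span S (pol_value S A (kern P) r \<gamma> p) * (L / n)
        + (L / n) / k) / (1 - \<gamma>)"
  proof (rule value_error[OF stoch_P Qh p(1) _ gam(2) _ _ k0 _ _ _ s])
    show "1 / 2 \<le> \<gamma>" using n2 by (simp add: \<gamma>_def field_simps)
    show "0 \<le> r i (p i) \<and> r i (p i) \<le> 1" if "i < S" for i using r01[OF that pA[OF that]] .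
    show "\<bar>pert r \<Delta> i (p i) - r i (p i)\<bar> \<le> \<xi>" if "i < S" for i
      using x that pA[OF that] by (simp add: in_range_def pert_def)
    show "k * span S (pol_value S A (kern P) r \<gamma> p) \<le> 1 / 8" using kH by (simp add: H_def val_def)
    show "0 \<le> L / n" using L_pos by simp
    fix i assume i: "i < S"
    define m where "m = mean p i (p i)"
    define D where "D = (\<Sum>l<n. val p (x (i, p i, l)) - m)"
    define W where "W = (\<Sum>l<n. (val p (x (i, p i, l)) - m)\<^sup>2)"
    have dsum: "\<sigma> * k * D - k\<^sup>2 * W < L" if "\<sigma> \<in> {1, -1}" for \<sigma>
    proof -
      have sq: "(\<sigma> * k * y)\<^sup>2 = k\<^sup>2 * y\<^sup>2" for y using that by (auto simp: power_mult_distrib)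
      have "(\<Sum>l<n. \<sigma> * kap p * (val p (x (i, p i, l)) - m) - (\<sigma> * kap p * (val p (x (i, p i, l)) - m))\<^sup>2)
          = \<sigma> * k * D - k\<^sup>2 * W"
        unfolding k_def[symmetric] sq D_def W_def sum_distrib_left sum_subtractf[symmetric] ..
      then show ?thesis using dev[OF i that] unfolding dev_def m_def by simp
    qed
    have qe: "qexp S ?Q f i (p i) = (\<Sum>l<n. f (x (i, p i, l))) / n" for f
      by (rule qexp_emp_kern) (rule xr[OF i pA[OF i]])
    have "k * \<bar>D\<bar> \<le> k\<^sup>2 * W + L" using dsum[of 1] dsum[of "-1"] by (cases "0 \<le> D") auto
    then have "k * \<bar>D\<bar> / n \<le> (k\<^sup>2 * W + L) / n" by (intro divide_right_mono) auto
    moreover have "qexp S ?Q (val p) i (p i) - m = D / n"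
      using n by (simp add: qe D_def sum_subtractf field_simps)
    moreover have "qexp S ?Q (\<lambda>j. (val p j - m)\<^sup>2) i (p i) = W / n"
      by (simp add: qe W_def)
    ultimately show "k * \<bar>qexp S ?Q (pol_value S A (kern P) r \<gamma> p) i (p i) - qexp S (kern P) (pol_value S A (kern P) r \<gamma> p) i (p i)\<bar>
      \<le> k\<^sup>2 * qexp S ?Q (\<lambda>j. (pol_value S A (kern P) r \<gamma> p j - qexp S (kern P) (pol_value S A (kern P) r \<gamma> p) i (p i))\<^sup>2) i (p i) + L / n"
      unfolding m_def mean_def val_def by (simp add: add_divide_distrib abs_mult)
  qed
  also have "\<dots> = real n * \<xi> + 8 * (k * H * n) + 8 * (H * L) + L / k"
    unfolding gam(3) using n k0 by (simp add: H_def val_def field_simps)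
  also have "\<dots> \<le> 1 + Z + 8 * Z + 8 * Z" if Z: "Z = sqrt (L * H1 p * n)" for Z
  proof -
    have pos: "0 < L * H1 p" using L_pos H1_ge[of p] by simp
    then have "0 < L * H1 p * n" using n by simp
    then have Z0: "0 < Z" "Z * Z = L * H1 p * n" unfolding Z by simp_all
    have kZ: "k * (8 * H1 p * n) = Z" using H1_ge[of p] n by (simp add: k_def kap_def Z)
    have "k * H * n * 8 \<le> k * H1 p * n * 8" using k0 H by (intro mult_right_mono mult_left_mono) auto
    then have t1: "8 * (k * H * n) \<le> Z" using kZ by (simp add: mult_ac)
    \<comment> \<open>Admissibility makes the lower-order term \<open>H * L\<close> no larger than
      the leading one.\<close>
    have "(L * H1 p)\<^sup>2 \<le> L * H1 p * n"
      using p(2) pos unfolding adm_def power2_eq_square by (intro mult_left_mono) auto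
    then have "L * H1 p \<le> Z" unfolding Z by (rule real_le_rsqrt)
    moreover have "H * L \<le> L * H1 p" using H L_pos by (simp add: algebra_simps)
    ultimately have t2: "H * L \<le> Z" by linarith
    have "L = 8 * k * Z"
    proof -
      have "L * (H1 p * n) = Z * Z" using Z0(2) by (simp add: mult_ac)
      also have "\<dots> = Z * (k * (8 * H1 p * n))" unfolding kZ ..
      also have "\<dots> = (8 * k * Z) * (H1 p * n)" by (simp add: mult_ac)
      finally show ?thesis by (rule mult_right_cancel[THEN iffD1, rotated]) (use H1_ge[of p] n in auto)
    qed
    then have t3: "L / k = 8 * Z" using k0 by simp
    have "real n * \<xi> \<le> real n * (1 / n)" using xi by (intro mult_left_mono) auto
    then have "real n * \<xi> \<le> 1" using n by simp
    then show ?thesis using t1 t2 t3 by linarith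
  qed
  finally show ?thesis by (simp add: val_def)
qed

lemma good_greedy:
  assumes w: "(x, \<Delta>) \<in> space \<Omega> - bad" and p: "det_ok S A \<pi>"
    and opt: "\<And>s a. s < S \<Longrightarrow> a < A \<Longrightarrow>
      qval S \<gamma> (pert r \<Delta>) (emp_kern n x) (pol_value S A (emp_kern n x) (pert r \<Delta>) \<gamma> \<pi>) s a
      \<le> pol_value S A (emp_kern n x) (pert r \<Delta>) \<gamma> \<pi> s"
    and s: "s < S" and a: "a < A"
  shows "\<exists>k\<le>N. greedy (restrict \<pi> {..<S}) x \<Delta> s a k"
proof -
  let ?K = "emp_kern n x" and ?R = "pert r \<Delta>"
  let ?V = "pol_value S A ?K ?R \<gamma> \<pi>"
  have rng: "in_range x \<Delta>" using w by (auto simp: bad_def bad4_def)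
  have K: "stoch_kernel S A ?K" by (rule stoch_emp[OF rng])
  have K': "substoch_kernel S A ?K" by (rule substoch_kernel_emp_kern)
  have pA: "\<pi> i < A" if "i < S" for i using p that by (simp add: det_ok_def)
  have n1: "1 \<le> real n" using n by simp
  then have "1 / real n \<le> 1" by simp
  then have xi1: "\<xi> \<le> 1" using xi by linarith
  have R: "0 \<le> ?R i b" "?R i b \<le> 2" if "i < S" "b < A" for i b
    using r01[OF that] rng that xi1 unfolding in_range_def pert_def by (force intro: add_nonneg_nonneg)+
  have Vpi: "?V i = qval S \<gamma> ?R ?K ?V i (\<pi> i)" if "i < S" for i
    unfolding qval_def by (rule pol_value_bellman[OF K p gam(1,2) that])
  have bfix: "bellman_fix S A \<gamma> ?R ?K ?V"
    unfolding bellman_fix_def using opt Vpi pA by metis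
  have Veq: "?V i = opt_value S A \<gamma> ?R ?K i" if "i < S" for i
    by (rule bellman_fix_unique[OF K' gam(1,2) bfix opt_value_fix[OF K' gam(1,2) A] that])
  have Qeq: "Qopt x \<Delta> i b = qval S \<gamma> ?R ?K ?V i b" for i b
    unfolding Qopt_def qopt_def qval_def using Veq qexp_cong[of S ?V "opt_value S A \<gamma> ?R ?K" ?K i b] by simp
  define q where "q = Qopt x \<Delta> s a"
  have V0: "0 \<le> ?V i" if "i < S" for i
    using R(1) pA by (intro pol_value_nonneg[OF K p gam(1,2) _ that]) auto
  have q0: "0 \<le> q"
  proof -
    have "0 \<le> qexp S ?K ?V s a"
      using qexp_mono[OF K s a, of "\<lambda>_. 0" ?V] V0 by (simp add: qexp_const[OF K s a])
    then show ?thesis using R(1)[OF s a] gam(1) by (simp add: q_def Qeq qval_def)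
  qed
  have "q \<le> ?V s" using opt[OF s a] by (simp add: q_def Qeq)
  also have "\<dots> \<le> 2 / (1 - \<gamma>)"
    using R(2) pA by (intro pol_value_le[OF K p gam(1,2) _ _ s]) auto
  finally have q1: "q \<le> 2 * n" by (simp add: gam(3))
  \<comment> \<open>Rounding down to the grid of spacing \<open>om / 2\<close> keeps the payoff
    within \<open>om / 2\<close> of the true action value.\<close>
  define k where "k = nat \<lfloor>2 * q / om\<rfloor>"
  have "2 * q / om \<le> 4 * real n / om" using q1 om0 by (intro divide_right_mono) auto
  then have kN: "k \<le> N" unfolding k_def N_def by (intro nat_mono floor_mono)
  have kr: "real k \<le> 2 * q / om" "2 * q / om < real k + 1"
    using q0 om0 unfolding k_def by (auto simp: of_nat_nat)
  then have uq: "\<bar>real k * om / 2 - q\<bar> \<le> om / 2" using om0 by (simp add: abs_le_iff field_simps)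
  have close: "\<bar>Qcut x \<Delta> s a k i b - Qopt x \<Delta> i b\<bar> \<le> om / 2" if "i < S" "b < A" for i b
  proof -
    have "\<bar>Qcut x \<Delta> s a k i b - qval S \<gamma> ?R ?K ?V i b\<bar> \<le> \<bar>real k * om / 2 - qval S \<gamma> ?R ?K ?V s a\<bar>"
      unfolding Qcut_def qopt_def
      by (rule qval_cut_close[OF K' gam(1,2) bfix opt_value_fix[OF substoch_cut_kernel[OF K'] gam(1,2) A] that])
    then show ?thesis using uq by (simp add: q_def Qeq)
  qed
  have "greedy (restrict \<pi> {..<S}) x \<Delta> s a k"
    unfolding greedy_def
  proof (intro allI impI)
    fix i b assume ib: "i < S" "b < A" "b \<noteq> restrict \<pi> {..<S} i"
    then have ne: "b \<noteq> \<pi> i" by simp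
    \<comment> \<open>Outside \<open>bad3\<close> the gap strictly exceeds \<open>om\<close>, so
      errors of \<open>om / 2\<close> on both actions cannot close it.\<close>
    have "(x, \<Delta>) \<notin> bad3 i (\<pi> i) b" using w ib pA[OF ib(1)] ne unfolding bad_def by blast
    then have "om < \<bar>Qopt x \<Delta> i (\<pi> i) - Qopt x \<Delta> i b\<bar>" using w by (auto simp: bad3_def)
    moreover have "Qopt x \<Delta> i b \<le> Qopt x \<Delta> i (\<pi> i)"
      using opt[OF ib(1,2)] Vpi[OF ib(1)] by (simp add: Qeq)
    ultimately have "om < Qopt x \<Delta> i (\<pi> i) - Qopt x \<Delta> i b" by simp
    then show "Qcut x \<Delta> s a k i b < Qcut x \<Delta> s a k i (restrict \<pi> {..<S} i)"
      using abs_le_D1[OF close[OF ib(1,2)]] abs_le_D2[OF close[OF ib(1) pA[OF ib(1)]]] ib(1) by simp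
  qed
  then show ?thesis using kN by blast
qed

text \<open>Pass from true to empirical values for \<open>\<pi>0\<close>, use empirical optimality
  of \<pi>, and pass back. The policy is replaced by its restriction to the states, which lies in
  \<open>Pol\<close> and has the same values there.\<close>

lemma good_value_gap:
  assumes w: "(x, \<Delta>) \<in> space \<Omega> - bad" and p: "det_ok S A \<pi>" and n2: "2 \<le> n"
    and opt: "\<And>s a. s < S \<Longrightarrow> a < A \<Longrightarrow>
      pert r \<Delta> s a + \<gamma> * qexp S (emp_kern n x) (pol_value S A (emp_kern n x) (pert r \<Delta>) \<gamma> \<pi>) s a
      \<le> pol_value S A (emp_kern n x) (pert r \<Delta>) \<gamma> \<pi> s"
    and ad: "adm \<pi>0" "adm \<pi>" and s: "s < S"
  shows "val \<pi>0 s - val \<pi> s \<le> 17 * sqrt (L * H1 \<pi>0 * n) + 17 * sqrt (L * H1 \<pi> * n) + 2"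
proof -
  let ?K = "emp_kern n x" and ?R = "pert r \<Delta>"
  define p where "p = restrict \<pi> {..<S}"
  have rng: "in_range x \<Delta>" using w by (auto simp: bad_def bad4_def)
  have K: "stoch_kernel S A ?K" by (rule stoch_emp[OF rng])
  have pdet: "det_ok S A p" and pPol: "p \<in> Pol" and peq: "\<And>i. i < S \<Longrightarrow> p i = \<pi> i"
    using p by (auto simp: p_def Pol_def det_ok_def)
  have vp: "val p i = val \<pi> i" if "i < S" for i
    unfolding val_def by (rule pol_value_cong[OF stoch_P pdet p gam(1,2) peq that])
  have Hp: "H1 p = H1 \<pi>" unfolding H1_def using span_cong[of S "val p" "val \<pi>" 0] vp by simp
  have adp: "adm p" using ad(2) by (simp add: adm_def Hp)
  have e0: "\<bar>pol_value S A ?K ?R \<gamma> \<pi>0 s - val \<pi>0 s\<bar> \<le> 17 * sqrt (L * H1 \<pi>0 * n) + 1"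
  proof (rule emp_value_close[OF rng p0 ad(1) n2 _ s])
    fix i \<sigma> assume i: "i < S" "\<sigma> \<in> {1, - 1::real}"
    have "\<pi>0 i < A" using p0 i by (simp add: det_ok_def)
    then have "(x, \<Delta>) \<notin> bad1 \<sigma> i (\<pi>0 i)" using w i unfolding bad_def by blast
    then show "\<not> dev \<sigma> \<pi>0 x i (\<pi>0 i)" using w ad(1) by (auto simp: bad1_def)
  qed
  have e1: "\<bar>pol_value S A ?K ?R \<gamma> p s - val p s\<bar> \<le> 17 * sqrt (L * H1 p * n) + 1"
  proof (rule emp_value_close[OF rng pdet adp n2 _ s])
    fix i \<sigma> assume i: "i < S" "\<sigma> \<in> {1, - 1::real}"
    have pi: "p i < A" using pdet i by (simp add: det_ok_def)
    \<comment> \<open>The index depends on the state, because the pair left out is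
      \<open>(i, p i)\<close>; \<open>bad\<close> contains the events of all pairs and
      indices.\<close>
    obtain k where k: "k \<le> N" "greedy p x \<Delta> i (p i) k"
      using good_greedy[OF w p _ i(1) pi] opt unfolding qval_def p_def by blast
    have "(x, \<Delta>) \<notin> bad2 \<sigma> i (p i) k" using w i pi k(1) unfolding bad_def by blast
    then show "\<not> dev \<sigma> p x i (p i)" using w adp pPol k(2) by (auto simp: bad2_def)
  qed
  have "pol_value S A ?K ?R \<gamma> \<pi>0 s \<le> pol_value S A ?K ?R \<gamma> \<pi> s"
    by (rule pol_value_le_bellman[OF K p0 gam(1,2) opt s])
  also have "\<dots> = pol_value S A ?K ?R \<gamma> p s"
    by (rule pol_value_cong[OF K p pdet gam(1,2) peq[symmetric] s])
  finally show ?thesis using e0 e1 vp[OF s] by (simp add: Hp abs_le_iff)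
qed

text \<open>The value of \<open>\<pi>0\<close> is compared with \<open>n \<rho>\<close> through its
  bias, that of \<pi> with its gain through averaging; \<open>h\<close> enters as the span of the
  discounted value of \<pi>, which equals its anchored bias span.\<close>

lemma good_gain_gap:
  assumes w: "(x, \<Delta>) \<in> space \<Omega> - bad" and wc: "weakly_communicating S A (kern P)"
    and b0: "blackwell_opt S A (kern P) r \<pi>0" and s0: "s0 < S"
    and b: "blackwell_opt S A (anchor (1 / real n) s0 (emp_kern n x)) (pert r \<Delta>) \<pi>" and s: "s < S"
  defines "a \<equiv> span S (bias S (Pmat A (kern P) (det_pol \<pi>0)) (rvec A r (det_pol \<pi>0)))"
    and "h \<equiv> span S (bias S (Pmat A (anchor (1 / real n) s0 (kern P)) (det_pol \<pi>)) (rvec A r (det_pol \<pi>)))"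
  shows "gain S (Pmat A (kern P) (det_pol \<pi>0)) (rvec A r (det_pol \<pi>0)) s
      - gain S (Pmat A (kern P) (det_pol \<pi>)) (rvec A r (det_pol \<pi>)) s
    \<le> sqrt (100000 * (ln T) ^ 3 / real n * (a + h + 1))"
proof -
  let ?g = "\<lambda>p. gain S (Pmat A (kern P) (det_pol p)) (rvec A r (det_pol p))"
  have p: "det_ok S A \<pi>" using b by (simp add: blackwell_opt_def)
  have rng: "in_range x \<Delta>" using w by (auto simp: bad_def bad4_def)
  have st: "stoch S (Pmat A (kern P) (det_pol p))" if "det_ok S A p" for p
    by (rule stoch_Pmat[OF stoch_P policy_ok_det[OF that]])
  have rv: "0 \<le> rvec A r (det_pol p) i" "rvec A r (det_pol p) i \<le> 1" if "det_ok S A p" "i < S" for p i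
    using that r01[of i "p i"] by (auto simp: det_ok_def rvec_det)
  have h: "h = span S (val \<pi>)"
    unfolding h_def val_def pol_value_def \<gamma>_def using n s0 p
    by (intro span_bias_anchor[OF st[OF p]]) (auto simp: Pmat_anchor)
  have a0: "0 \<le> a" and h0: "0 \<le> h" unfolding a_def h by (rule span_nonneg[OF S])+
  obtain \<rho> where \<rho>: "\<And>s. s < S \<Longrightarrow> ?g \<pi>0 s = \<rho>"
    using blackwell_gain_constant[OF stoch_P wc b0 S] by metis
  have v0: "\<bar>val \<pi>0 i - n * \<rho>\<bar> \<le> a" if "i < S" for i
    using disc_near_gain[OF stoch_P p0 gam(1,2) that, of r] \<rho>[OF that]
    by (simp add: a_def val_def gam(3) mult.commute)
  have sp0: "H1 \<pi>0 \<le> 2 * a + 1"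
  proof -
    have "val \<pi>0 i - val \<pi>0 j \<le> 2 * a" if "i < S" "j < S" for i j
      using v0[OF that(1)] v0[OF that(2)] by (simp add: abs_le_iff)
    then show ?thesis unfolding H1_def using span_le[OF S, of "val \<pi>0" "2 * a"] by simp
  qed
  define G where "G = a + h + 1"
  define l where "l = ln T"
  have l: "2 / 3 \<le> l"
  proof -
    have "ln 2 \<le> ln T" using T_ge(1) by simp
    then show ?thesis using ln2_ge_two_thirds by (simp add: l_def)
  qed
  have l2: "4 / 9 \<le> l\<^sup>2" using power_mono[OF l, of 2] by (simp add: power_divide)
  have Ll: "L = 12 * l" by (simp add: L_def l_def)
  have G1: "1 \<le> G" using a0 h0 by (simp add: G_def)
  have n0: "0 < real n" using n by simp
  \<comment> \<open>The argument produces a single logarithm; \<open>2 / 3 \<le> l\<close> trades it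
    for the cube, as \<open>100000 * 4 / 9\<close> exceeds 40000.\<close>
  have scale: "sqrt (c * l * G / n) \<le> sqrt (100000 * l ^ 3 / real n * G)" if "c \<le> 40000" for c
  proof (rule real_sqrt_le_mono)
    have "c \<le> 100000 * l\<^sup>2" using l2 that by simp
    then have "c * (l * G / n) \<le> 100000 * l\<^sup>2 * (l * G / n)"
      using l G1 n0 by (intro mult_right_mono) auto
    then show "c * l * G / n \<le> 100000 * l ^ 3 / real n * G"
      by (simp add: power3_eq_cube power2_eq_square mult_ac)
  qed
  \<comment> \<open>For \<open>n < 2 * L * G\<close> the right-hand side is at least 1, while gains
    lie in \<open>[0, 1]\<close>. Otherwise both policies are admissible, since both
    \<open>H1\<close> are at most \<open>2 * G\<close>.\<close>
  show ?thesis
  proof (cases "real n < 2 * L * G")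
    case True
    have "?g \<pi>0 s \<le> 1" by (rule gain_le[OF st[OF p0] s rv(2)[OF p0]])
    moreover have "0 \<le> ?g \<pi> s" by (rule gain_ge[OF st[OF p] s rv(1)[OF p]])
    moreover have "1 \<le> sqrt (24 * l * G / n)" using True n0 by (simp add: Ll)
    moreover have "sqrt (24 * l * G / n) \<le> sqrt (100000 * l ^ 3 / real n * G)" by (rule scale) simp
    ultimately show ?thesis unfolding G_def l_def by linarith
  next
    case False
    define Z where "Z = sqrt (2 * L * G * n)"
    have big: "2 * L * G \<le> n" using False by simp
    have LG: "8 * G \<le> L * G" using l G1 by (intro mult_right_mono) (auto simp: Ll)
    have n2: "2 \<le> n"
    proof -
      have "2 \<le> real n" using big LG G1 by linarith
      then show ?thesis by simp
    qed
    have H: "H1 \<pi>0 \<le> 2 * G" "H1 \<pi> \<le> 2 * G"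
      using sp0 a0 h0 by (auto simp: G_def H1_def h)
    have LH: "L * H1 p \<le> 2 * L * G" if "H1 p \<le> 2 * G" for p
      using mult_left_mono[OF that, of L] L_pos by simp
    have ad: "adm \<pi>0" "adm \<pi>" unfolding adm_def using LH[OF H(1)] LH[OF H(2)] big by linarith+
    have ZH: "sqrt (L * H1 p * n) \<le> Z" if "H1 p \<le> 2 * G" for p
      unfolding Z_def using LH[OF that] by (intro real_sqrt_le_mono mult_right_mono) auto
    \<comment> \<open>Lets one further \<open>Z\<close> cover the additive terms: \<open>a\<close>
      from the gain of \<open>\<pi>0\<close>, and 1 for each policy from the reward perturbation.
      Thus \<open>35 = 17 + 17 + 1\<close>.\<close>
    have "2 * G \<le> Z"
    proof -
      have "2 * G * (2 * G) \<le> 2 * L * G * n"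
      proof (rule mult_mono)
        show "2 * G \<le> 2 * L * G" "2 * G \<le> n" using big LG G1 by linarith+
        show "0 \<le> 2 * L * G" using L_pos G1 by simp
      qed (use G1 in simp)
      then have "(2 * G)\<^sup>2 \<le> 2 * L * G * n" unfolding power2_eq_square .
      then show ?thesis unfolding Z_def by (rule real_le_rsqrt)
    qed
    then have aG: "a + 2 \<le> Z" using G1 h0 a0 by (simp add: G_def)
    have val: "n * \<rho> - 35 * Z \<le> val \<pi> i" if "i < S" for i
    proof -
      have "val \<pi>0 i - val \<pi> i \<le> 17 * sqrt (L * H1 \<pi>0 * n) + 17 * sqrt (L * H1 \<pi> * n) + 2"
      proof (rule good_value_gap[OF w p n2 _ ad that])
        fix s a assume sa: "s < S" "a < A"
        show "pert r \<Delta> s a + \<gamma> * qexp S (emp_kern n x) (pol_value S A (emp_kern n x) (pert r \<Delta>) \<gamma> \<pi>) s a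
            \<le> pol_value S A (emp_kern n x) (pert r \<Delta>) \<gamma> \<pi> s"
          unfolding \<gamma>_def using n
          by (intro blackwell_anchor_bellman[OF stoch_emp[OF rng] _ _ s0 b sa]) auto
      qed
      then show ?thesis using ZH[OF H(1)] ZH[OF H(2)] v0[OF that] aG by (simp add: abs_le_iff)
    qed
    \<comment> \<open>Here the benchmark must not depend on the state: averaging over the chain of
      \<pi> needs one lower bound valid everywhere.\<close>
    have "(1 - \<gamma>) * (n * \<rho> - 35 * Z) \<le> ?g \<pi> s"
      by (rule gain_ge_disc[OF stoch_P p gam(1,2) _ s]) (use val in \<open>simp add: val_def\<close>)
    then have "\<rho> - 35 * Z / n \<le> ?g \<pi> s" using n0 by (simp add: gam(3) diff_divide_distrib)
    then have "?g \<pi>0 s - ?g \<pi> s \<le> 35 * Z / n" using \<rho>[OF s] by simp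
    \<comment> \<open>With \<open>L = 12 * l\<close>, the constant is
      \<open>35^2 * 2 * 12\<close>.\<close>
    also have "\<dots> = sqrt (29400 * l * G / n)"
    proof -
      have "(35 * Z / n)\<^sup>2 = 1225 * (2 * L * G * n) / (real n)\<^sup>2"
        unfolding Z_def power_mult_distrib power_divide using L_pos G1 by simp
      also have "\<dots> = 29400 * l * G / n" using n0 by (simp add: Ll power2_eq_square)
      finally have "sqrt (29400 * l * G / n) = \<bar>35 * Z / n\<bar>" by (metis real_sqrt_abs)
      moreover have "0 \<le> Z" using \<open>2 * G \<le> Z\<close> G1 by simp
      ultimately show ?thesis by simp
    qed
    also have "\<dots> \<le> sqrt (100000 * l ^ 3 / real n * G)" by (rule scale) simp
    finally show ?thesis unfolding G_def l_def .
  qed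
qed

end

theorem mainTheorem5:
  shows "\<exists>C>0. \<forall>(S::nat) (A::nat) (P::nat \<Rightarrow> nat \<Rightarrow> nat pmf) (r::nat \<Rightarrow> nat \<Rightarrow> real)
            (s0::nat) (n::nat) (\<xi>::real) (\<delta>::real) (\<pi>star::nat \<Rightarrow> nat).
     0 < S \<longrightarrow> 0 < A \<longrightarrow> 0 < n \<longrightarrow>
     (\<forall>s<S. \<forall>a<A. set_pmf (P s a) \<subseteq> {..<S}) \<longrightarrow>
     (\<forall>s<S. \<forall>a<A. 0 \<le> r s a \<and> r s a \<le> 1) \<longrightarrow>
     weakly_communicating S A (kern P) \<longrightarrow>
     s0 < S \<longrightarrow> 0 < \<xi> \<longrightarrow> \<xi> \<le> 1 / real n \<longrightarrow>
     0 < \<delta> \<longrightarrow> \<delta> < 1 \<longrightarrow>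
     blackwell_opt S A (kern P) r \<pi>star \<longrightarrow>
     (\<exists>E \<in> sets (sample_space S A P n \<xi>).
        measure (sample_space S A P n \<xi>) E \<ge> 1 - \<delta> \<and>
        (\<forall>\<omega>\<in>E. \<forall>\<pi>hat.
           blackwell_opt S A (anchor (1 / real n) s0 (emp_kern n (fst \<omega>)))
                         (\<lambda>s a. r s a + snd \<omega> (s, a)) \<pi>hat \<longrightarrow>
           (\<forall>s<S.
              gain S (Pmat A (kern P) (det_pol \<pi>star)) (rvec A r (det_pol \<pi>star)) s
              - gain S (Pmat A (kern P) (det_pol \<pi>hat)) (rvec A r (det_pol \<pi>hat)) s
              \<le> sqrt (C * (ln (real S * real A * real n / (\<delta> * \<xi>))) ^ 3 / real n
                   * (span S (bias S (Pmat A (kern P) (det_pol \<pi>star)) (rvec A r (det_pol \<pi>star)))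
                      + span S (bias S (Pmat A (anchor (1 / real n) s0 (kern P)) (det_pol \<pi>hat))
                                          (rvec A r (det_pol \<pi>hat)))
                      + 1)))))"
proof (intro exI[of _ 100000] conjI allI impI)
  fix S A :: nat and P :: "nat \<Rightarrow> nat \<Rightarrow> nat pmf" and r :: "nat \<Rightarrow> nat \<Rightarrow> real"
    and s0 n :: nat and \<xi> \<delta> :: real and \<pi>star :: "nat \<Rightarrow> nat"
  let ?c = "\<lambda>\<pi>hat. 100000 * (ln (real S * real A * real n / (\<delta> * \<xi>))) ^ 3 / real n
    * (span S (bias S (Pmat A (kern P) (det_pol \<pi>star)) (rvec A r (det_pol \<pi>star)))
      + span S (bias S (Pmat A (anchor (1 / real n) s0 (kern P)) (det_pol \<pi>hat)) (rvec A r (det_pol \<pi>hat))) + 1)"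
  let ?g = "\<lambda>p. gain S (Pmat A (kern P) (det_pol p)) (rvec A r (det_pol p))"
  let ?M = "sample_space S A P n \<xi>"
  assume S: "0 < S" and A: "0 < A" and n: "0 < n"
    and supp: "\<forall>s<S. \<forall>a<A. set_pmf (P s a) \<subseteq> {..<S}"
    and r01: "\<forall>s<S. \<forall>a<A. 0 \<le> r s a \<and> r s a \<le> 1"
    and wc: "weakly_communicating S A (kern P)" and s0: "s0 < S"
    and xi: "0 < \<xi>" "\<xi> \<le> 1 / real n" and del: "0 < \<delta>" "\<delta> < 1"
    and b0: "blackwell_opt S A (kern P) r \<pi>star"
  have p0: "det_ok S A \<pi>star" using b0 by (simp add: blackwell_opt_def)
  show "\<exists>E \<in> sets ?M. measure ?M E \<ge> 1 - \<delta> \<and> (\<forall>\<omega>\<in>E. \<forall>\<pi>hat.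
           blackwell_opt S A (anchor (1 / real n) s0 (emp_kern n (fst \<omega>)))
                         (\<lambda>s a. r s a + snd \<omega> (s, a)) \<pi>hat \<longrightarrow>
           (\<forall>s<S. ?g \<pi>star s - ?g \<pi>hat s \<le> sqrt (?c \<pi>hat)))"
  proof (cases "2 \<le> S * A")
    case True
    interpret plug_in S A n P r \<xi> \<delta> \<pi>star
      using S A n supp r01 xi del True p0 by unfold_locales auto
    interpret prob_space \<Omega> by (rule prob_\<Omega>)
    \<comment> \<open>The event is built without reference to \<open>\<pi>hat\<close>, so it is
      measurable whatever Blackwell-optimal policy is chosen, and it serves all of them at
      once.\<close>
    show ?thesis
    proof (intro bexI[of _ "space \<Omega> - bad"] conjI ballI allI impI)
      show "space \<Omega> - bad \<in> sets ?M" unfolding sample_space_eq using bad_measure(1) by auto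
      show "1 - \<delta> \<le> measure ?M (space \<Omega> - bad)"
        unfolding sample_space_eq using bad_measure prob_compl[OF bad_measure(1)] by simp
      fix \<omega> \<pi>hat s
      assume w: "\<omega> \<in> space \<Omega> - bad" and s: "s < S"
        and b: "blackwell_opt S A (anchor (1 / real n) s0 (emp_kern n (fst \<omega>)))
                         (\<lambda>s a. r s a + snd \<omega> (s, a)) \<pi>hat"
      have w': "(fst \<omega>, snd \<omega>) \<in> space \<Omega> - bad" using w by simp
      have "pert r (snd \<omega>) = (\<lambda>s a. r s a + snd \<omega> (s, a))" by (simp add: fun_eq_iff pert_def)
      with b have "blackwell_opt S A (anchor (1 / real n) s0 (emp_kern n (fst \<omega>))) (pert r (snd \<omega>)) \<pi>hat"
        by simp
      from good_gain_gap[OF w' wc b0 s0 this s] show "?g \<pi>star s - ?g \<pi>hat s \<le> sqrt (?c \<pi>hat)"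
        unfolding T_def .
    qed
  next
    case False
    \<comment> \<open>With one state and one action the logarithm may be arbitrarily close to 0, but
      all policies agree on the state, the gap is 0 and the whole space serves as event.\<close>
    have "S * A = 1" using False S A by (cases "S * A") auto
    then have one: "S = 1" "A = 1" by auto
    have Q: "stoch_kernel S A (kern P)" by (rule stoch_kernel_kern) (use supp in auto)
    interpret a: prob_space "smp_measure S A P n" by (rule prob_space_smp_measure)
    interpret b: prob_space "prt_measure S A \<xi>" by (rule prob_space_prt_measure[OF xi(1)])
    interpret pair_prob_space "smp_measure S A P n" "prt_measure S A \<xi>" ..
    have M: "?M = smp_measure S A P n \<Otimes>\<^sub>M prt_measure S A \<xi>"
      by (simp add: sample_space_def smp_measure_def prt_measure_def)
    show ?thesis
    proof (intro bexI[of _ "space ?M"] conjI ballI allI impI)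
      show "1 - \<delta> \<le> measure ?M (space ?M)" unfolding M using prob_space del by simp
      fix \<omega> \<pi>hat s
      assume s: "s < S" and b: "blackwell_opt S A (anchor (1 / real n) s0 (emp_kern n (fst \<omega>)))
                         (\<lambda>s a. r s a + snd \<omega> (s, a)) \<pi>hat"
      have p: "det_ok S A \<pi>hat" using b by (simp add: blackwell_opt_def)
      have "?g \<pi>star s = ?g \<pi>hat s"
      proof (rule gain_cong[OF stoch_Pmat[OF Q policy_ok_det[OF p]] _ _ s])
        fix i assume i: "i < S"
        have z: "\<pi>star i = 0" "\<pi>hat i = 0" using p p0 i one by (auto simp: det_ok_def)
        show "Pmat A (kern P) (det_pol \<pi>star) i = Pmat A (kern P) (det_pol \<pi>hat) i"
          by (simp add: fun_eq_iff Pmat_def det_pol_def z)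
        show "rvec A r (det_pol \<pi>star) i = rvec A r (det_pol \<pi>hat) i"
          by (simp add: rvec_def det_pol_def z)
      qed
      moreover have "0 \<le> ?c \<pi>hat"
      proof -
        have n1: "1 \<le> real n" using n by simp
        then have "1 / real n \<le> 1" by simp
        then have "\<xi> \<le> 1" using xi by linarith
        then have "\<delta> * \<xi> \<le> 1" using xi del by (intro mult_le_one) auto
        then have "1 \<le> real n / (\<delta> * \<xi>)" using n1 xi del by (simp add: le_divide_eq)
        then have "0 \<le> ln (real S * real A * real n / (\<delta> * \<xi>))" using one by simp
        moreover have "0 \<le> span S v" for v by (rule span_nonneg[OF S])
        ultimately show ?thesis by (intro mult_nonneg_nonneg divide_nonneg_nonneg add_nonneg_nonneg zero_le_power) auto
      qed
      ultimately show "?g \<pi>star s - ?g \<pi>hat s \<le> sqrt (?c \<pi>hat)" by simp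
    qed simp
  qed
qed simp

end
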